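(* Let $T_1>0$, $T_0\in[0,T_1)$, $\alpha\in(\tfrac12,1)$, $\beta\in(0,\alpha)$. Fix $B_x,B_w>0$ and $w_0\in\mathbb R^m$. Let $\mathcal I$ be the set of pairs $(x,w)$ with $x\in\mathcal C^1([0,T_1],\mathbb R^d)$, $w\in\mathcal C^\alpha([0,T_0],\mathbb R^m)$ having the fixed initial value $w_0$ at time $0$, $|x_0|+\|x\|_{1;[0,T_1]}\le B_x$ and $\|w\|_{\alpha;[0,T_0]}\le B_w$. Let $f:\Lambda^\alpha_\beta([0,T_1],\mathbb R^m)\to L(\mathbb R^d,\mathbb R^m)$ be a continuous non-anticipative functional such that (i) for every compact $K\subset\mathcal C^\alpha_\beta([0,T_1],\mathbb R^m)$ there is $L_K>0$ with $|f(t,u_{\cdot\wedge t})-f(t,v_{\cdot\wedge t})|\le L_K(|u_0-v_0|+\|u_{\cdot\wedge t}-v_{\cdot\wedge t}\|_{\beta;[0,T_1]})$ for all $t\in[0,T_1]$, $u,v\in K$; (ii) there is $C_f>0$ with $|f(t,u_{\cdot\wedge t})|\le C_f(1+|u_0|+\|u_{\cdot\wedge t}\|_{\beta;[0,T_1]})$ for all $(t,u_{\cdot\wedge t})\in\Lambda^\alpha_\beta([0,T_1],\mathbb R^m)$. Let $\sigma:\mathbb C\to\mathbb C$ be an entire function with $\sigma(\mathbb R)\subset\mathbb R$ whose restriction to $\mathbb R$ is bounded, Lipschitz, strictly monotone (and hence satisfies $|\sigma(r)|\le C_\sigma(1+\ln(1+|r|))$, $r\in\mathbb R$, for some constant $C_\sigma$).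 Then there exists a sequence $(\boldsymbol\ell_n)_{n\ge1}\subset(G(\mathbb R^{m+1})^* )^{m\times d}$ of bounded entire maps on group-like elements such that, for $(x,w)\in\mathcal I$, the solutions $y^{(n)}$ of $$y^{(n),i}_t=w^i_{T_0}+\sum_{j=1}^d\int_{T_0}^t\langle\boldsymbol\ell^{ij}_n,S(\hat y^{(n)})_{0,s}\rangle\,\mathrm dx^j_s,\ t\in[T_0,T_1],\qquad y^{(n),i}|_{[0,T_0]}=w^i,\quad i=1,\dots,m,$$ converge in the $\beta$-H\"older topology to the solution $y$ of $$y^i_t=w^i_{T_0}+\sum_{j=1}^d\int_{T_0}^tf^{ij}(y|_{[0,s]})\,\mathrm dx^j_s,\ t\in[T_0,T_1],\qquad y^i|_{[0,T_0]}=w^i,\quad i=1,\dots,m.$$ The convergence is uniform over $(x,w)\in\mathcal I$ (with the same $\boldsymbol\ell_n$ for all $(x,w)\in\mathcal I$).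
   Context: $\mathcal C^\gamma([0,T],\mathbb R^m)$, $\gamma\in(0,1]$, is the space of $\gamma$-H\"older paths with norm $|y_0|+\|y\|_{\gamma;[0,T]}$, $\|y\|_{\gamma;[0,T]}=\sup_{s<t}|y_t-y_s|/|t-s|^\gamma$ ($\gamma=1$: Lipschitz). $\mathcal C^\alpha_\beta$ is the set $\mathcal C^\alpha$ with the topology of the $\beta$-H\"older norm. $y_{\cdot\wedge t}$ is the path stopped at $t$; $\Lambda^\alpha_\beta([0,T],\mathbb R^m)=\{(t,y_{\cdot\wedge t}):t\in[0,T],y\in\mathcal C^\alpha([0,T],\mathbb R^m)\}$ has metric $|t-s|+|y_0-z_0|+\|y_{\cdot\wedge t}-z_{\cdot\wedge s}\|_{\beta;[0,T]}$; $(t,y_{\cdot\wedge t})$ is also written $y|_{[0,t]}$. A non-anticipative functional is a map on $\Lambda^\alpha_\beta$. For $D\in\mathbb N$: $T((\mathbb R^D))=\prod_{n\ge0}(\mathbb R^D)^{\otimes n}$, $T(\mathbb R^D)=\bigoplus_{n\ge0}(\mathbb R^D)^{\otimes n}$; elements are written in the word basis as $\sum_w a_we_w$, $w$ ranging over finite words in a $D$-letter alphabet; $|w|$ is word length; $\langle\cdot,\cdot\rangle$ is the coordinatewise pairing of $T(\mathbb R^D)$ with $T((\mathbb R^D))$; ⧢ (written $\sqcup\!\sqcup$) is the shuffle product. Group-like elements: $G(\mathbb R^D)=\{\mathbf g\in T((\mathbb R^D))\setminus\{0\}:\langle\mathbf b_1,\mathbf g\rangle\langle\mathbf b_2,\mathbf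 g\rangle=\langle\mathbf b_1\sqcup\!\sqcup\,\mathbf b_2,\mathbf g\rangle\ \forall\,\mathbf b_1,\mathbf b_2\in T(\mathbb R^D)\}$. For $\boldsymbol\ell\in T((\mathbb R^D))$, $|\boldsymbol\ell|_{\mathbf g}=\sum_{k\ge1}|\sum_{|w|=k}\ell_wg_w|$, and $G(\mathbb R^D)^*=\{\boldsymbol\ell\in T((\mathbb R^D)):|\boldsymbol\ell|_{\mathbf g}<\infty\ \forall\mathbf g\in G(\mathbb R^D)\}$. For $\boldsymbol\ell\in G(\mathbb R^D)^*$, $\langle\boldsymbol\ell,\mathbf g\rangle=\sum_{n\ge0}\sum_{|w|=n}\ell_wg_w$; the map $G(\mathbb R^D)\ni\mathbf g\mapsto\langle\boldsymbol\ell,\mathbf g\rangle\in\mathbb R$ is called an entire map on group-like elements, and it is bounded if it is a bounded function on $G(\mathbb R^D)$. $\hat y_t=(t,y_t)\in\mathbb R^{m+1}$; the signature is $S(\hat y)_{0,t}=(1,S^{(1)},S^{(2)},\dots)$, $S^{(n)}=\int_{0<t_1<\dots<t_n<t}\mathrm d\hat y_{t_1}\otimes\cdots\otimes\mathrm d\hat y_{t_n}$ (Young integrals), which lies in $G(\mathbb R^{m+1})$. Integrals against $x$ are Riemann–Stieltjes; solutions are paths in $\mathcal C^\alpha([0,T_1],\mathbb R^m)$. *)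

theory Defs
  imports "HOL-Analysis.Analysis" "HOL-Library.Multiset"
begin

section \<open>Hoelder paths on \<open>[0,T]\<close>\<close>

text \<open>
  A path on \<open>[0,T]\<close> is a function in \<open>extensional {0..T}\<close>, so that paths are equal iff they agree
  on \<open>[0,T]\<close>. The supremum is formed in \<^typ>\<open>ennreal\<close>: it is \<open>0\<close> when there are no \<open>s < t\<close> (that is,
  \<open>T = 0\<close>), and it is infinite exactly for the functions that are not Hoelder continuous.
\<close>

definition holder_sup :: "real \<Rightarrow> real \<Rightarrow> (real \<Rightarrow> 'b::real_normed_vector) \<Rightarrow> ennreal" where
  "holder_sup \<gamma> T y =
     (SUP (s, t) \<in> {(s, t). 0 \<le> s \<and> s < t \<and> t \<le> T}. ennreal (norm (y t - y s) / (t - s) powr \<gamma>))"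

definition holder_seminorm :: "real \<Rightarrow> real \<Rightarrow> (real \<Rightarrow> 'b::real_normed_vector) \<Rightarrow> real" where
  "holder_seminorm \<gamma> T y = enn2real (holder_sup \<gamma> T y)"

definition holder_norm :: "real \<Rightarrow> real \<Rightarrow> (real \<Rightarrow> 'b::real_normed_vector) \<Rightarrow> real" where
  "holder_norm \<gamma> T y = norm (y 0) + holder_seminorm \<gamma> T y"

definition holder_paths :: "real \<Rightarrow> real \<Rightarrow> (real \<Rightarrow> 'b::real_normed_vector) set" where
  "holder_paths \<gamma> T = {y \<in> extensional {0..T}. holder_sup \<gamma> T y < \<infinity>}"

definition holder_dist ::
  "real \<Rightarrow> real \<Rightarrow> (real \<Rightarrow> 'b::real_normed_vector) \<Rightarrow> (real \<Rightarrow> 'b) \<Rightarrow> real" where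
  "holder_dist \<beta> T y z = holder_norm \<beta> T (\<lambda>r. y r - z r)"

definition holder_topology ::
  "real \<Rightarrow> real \<Rightarrow> real \<Rightarrow> (real \<Rightarrow> 'b::real_normed_vector) topology" where
  "holder_topology \<alpha> \<beta> T = Metric_space.mtopology (holder_paths \<alpha> T) (holder_dist \<beta> T)"

definition stopped :: "real \<Rightarrow> real \<Rightarrow> (real \<Rightarrow> 'b) \<Rightarrow> (real \<Rightarrow> 'b)" where
  "stopped T t y = (\<lambda>s\<in>{0..T}. y (min s t))"

definition stopped_paths :: "real \<Rightarrow> real \<Rightarrow> (real \<times> (real \<Rightarrow> 'b::real_normed_vector)) set" where
  "stopped_paths \<alpha> T = {(t, stopped T t y) | t y. t \<in> {0..T} \<and> y \<in> holder_paths \<alpha> T}"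

text \<open>The second components of the arguments are meant to be stopped already.\<close>

definition stopped_dist ::
  "real \<Rightarrow> real \<Rightarrow> real \<times> (real \<Rightarrow> 'b::real_normed_vector) \<Rightarrow> real \<times> (real \<Rightarrow> 'b) \<Rightarrow> real" where
  "stopped_dist \<beta> T p q = \<bar>fst p - fst q\<bar> + holder_dist \<beta> T (snd p) (snd q)"

definition stopped_topology ::
  "real \<Rightarrow> real \<Rightarrow> real \<Rightarrow> (real \<times> (real \<Rightarrow> 'b::real_normed_vector)) topology" where
  "stopped_topology \<alpha> \<beta> T = Metric_space.mtopology (stopped_paths \<alpha> T) (stopped_dist \<beta> T)"

subsection \<open>The two topologies come from metrics when \<open>\<beta> \<le> \<alpha>\<close>\<close>

lemma holder_sup_finite_iff:
  "holder_sup \<gamma> T y < \<infinity> \<longleftrightarrow>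
     (\<exists>C\<ge>0. \<forall>s t. 0 \<le> s \<longrightarrow> s < t \<longrightarrow> t \<le> T \<longrightarrow> norm (y t - y s) \<le> C * (t - s) powr \<gamma>)"
proof
  assume fin: "holder_sup \<gamma> T y < \<infinity>"
  have "norm (y t - y s) \<le> enn2real (holder_sup \<gamma> T y) * (t - s) powr \<gamma>"
    if "0 \<le> s" "s < t" "t \<le> T" for s t
  proof -
    have "ennreal (norm (y t - y s) / (t - s) powr \<gamma>) \<le> holder_sup \<gamma> T y"
      unfolding holder_sup_def by (rule SUP_upper2[of "(s, t)"]) (use that in auto)
    then have "norm (y t - y s) / (t - s) powr \<gamma> \<le> enn2real (holder_sup \<gamma> T y)"
      using fin enn2real_mono[of _ "holder_sup \<gamma> T y"] by fastforce
    then show ?thesis using that by (simp add: divide_simps)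
  qed
  then show "\<exists>C\<ge>0. \<forall>s t. 0 \<le> s \<longrightarrow> s < t \<longrightarrow> t \<le> T \<longrightarrow> norm (y t - y s) \<le> C * (t - s) powr \<gamma>"
    using enn2real_nonneg by blast
next
  assume "\<exists>C\<ge>0. \<forall>s t. 0 \<le> s \<longrightarrow> s < t \<longrightarrow> t \<le> T \<longrightarrow> norm (y t - y s) \<le> C * (t - s) powr \<gamma>"
  then obtain C where "C \<ge> 0"
    and C: "\<And>s t. 0 \<le> s \<Longrightarrow> s < t \<Longrightarrow> t \<le> T \<Longrightarrow> norm (y t - y s) \<le> C * (t - s) powr \<gamma>" by blast
  have "holder_sup \<gamma> T y \<le> ennreal C"
    unfolding holder_sup_def
    by (rule SUP_least) (use C in \<open>auto intro!: ennreal_leI simp: divide_simps\<close>)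
  then show "holder_sup \<gamma> T y < \<infinity>" using le_less_trans by fastforce
qed

lemma holder_seminorm_nonneg [simp]: "0 \<le> holder_seminorm \<gamma> T y"
  by (simp add: holder_seminorm_def)

lemma holder_seminorm_bound:
  assumes "holder_sup \<gamma> T y < \<infinity>" "0 \<le> s" "s < t" "t \<le> T"
  shows "norm (y t - y s) \<le> holder_seminorm \<gamma> T y * (t - s) powr \<gamma>"
proof -
  have "ennreal (norm (y t - y s) / (t - s) powr \<gamma>) \<le> holder_sup \<gamma> T y"
    unfolding holder_sup_def by (rule SUP_upper2[of "(s, t)"]) (use assms in auto)
  then have "norm (y t - y s) / (t - s) powr \<gamma> \<le> holder_seminorm \<gamma> T y"
    unfolding holder_seminorm_def using assms(1) enn2real_mono[of _ "holder_sup \<gamma> T y"] by fastforce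
  then show ?thesis using assms by (simp add: divide_simps)
qed

lemma holder_seminorm_le:
  assumes "0 \<le> C"
    and "\<And>s t. 0 \<le> s \<Longrightarrow> s < t \<Longrightarrow> t \<le> T \<Longrightarrow> norm (y t - y s) \<le> C * (t - s) powr \<gamma>"
  shows "holder_seminorm \<gamma> T y \<le> C"
proof -
  have "holder_sup \<gamma> T y \<le> ennreal C"
    unfolding holder_sup_def
    by (rule SUP_least) (use assms in \<open>auto intro!: ennreal_leI simp: divide_simps\<close>)
  then show ?thesis
    unfolding holder_seminorm_def using assms(1) by (metis enn2real_ennreal enn2real_mono ennreal_less_top)
qed

lemma holder_sup_mono_exponent:
  assumes "\<beta> \<le> \<alpha>" "holder_sup \<alpha> T y < \<infinity>"
  shows "holder_sup \<beta> T y < \<infinity>"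
proof -
  obtain C where "C \<ge> 0"
    and C: "\<And>s t. 0 \<le> s \<Longrightarrow> s < t \<Longrightarrow> t \<le> T \<Longrightarrow> norm (y t - y s) \<le> C * (t - s) powr \<alpha>"
    using assms(2) unfolding holder_sup_finite_iff by blast
  have "norm (y t - y s) \<le> (C * T powr (\<alpha> - \<beta>)) * (t - s) powr \<beta>"
    if "0 \<le> s" "s < t" "t \<le> T" for s t
  proof -
    have "norm (y t - y s) \<le> C * ((t - s) powr (\<alpha> - \<beta>) * (t - s) powr \<beta>)"
      using C[OF that] by (simp flip: powr_add)
    also have "\<dots> \<le> C * (T powr (\<alpha> - \<beta>) * (t - s) powr \<beta>)"
      using that assms(1) \<open>C \<ge> 0\<close> by (intro mult_left_mono mult_right_mono powr_mono2) auto
    finally show ?thesis by (simp add: mult.assoc)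
  qed
  then show ?thesis
    unfolding holder_sup_finite_iff using \<open>C \<ge> 0\<close>
    by (intro exI[of _ "C * T powr (\<alpha> - \<beta>)"]) auto
qed

lemma holder_sup_diff:
  assumes "holder_sup \<gamma> T y < \<infinity>" "holder_sup \<gamma> T z < \<infinity>"
  shows "holder_sup \<gamma> T (\<lambda>r. y r - z r) < \<infinity>"
    (is ?fin) and "holder_seminorm \<gamma> T (\<lambda>r. y r - z r) \<le> holder_seminorm \<gamma> T y + holder_seminorm \<gamma> T z"
    (is ?le)
proof -
  have *: "norm ((y t - z t) - (y s - z s))
      \<le> (holder_seminorm \<gamma> T y + holder_seminorm \<gamma> T z) * (t - s) powr \<gamma>"
    if "0 \<le> s" "s < t" "t \<le> T" for s t
  proof -
    have "norm ((y t - z t) - (y s - z s)) \<le> norm (y t - y s) + norm (z t - z s)"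
      by (metis norm_triangle_ineq4 diff_diff_eq2 add_diff_eq diff_add_eq diff_diff_eq add.commute)
    then show ?thesis
      using holder_seminorm_bound[OF assms(1) that] holder_seminorm_bound[OF assms(2) that]
      by (simp add: distrib_right)
  qed
  show ?fin
    unfolding holder_sup_finite_iff
    using * by (intro exI[of _ "holder_seminorm \<gamma> T y + holder_seminorm \<gamma> T z"]) auto
  show ?le
    by (rule holder_seminorm_le) (use * in auto)
qed

lemma holder_sup_diff_paths:
  assumes "\<beta> \<le> \<alpha>" "y \<in> holder_paths \<alpha> T" "z \<in> holder_paths \<alpha> T"
  shows "holder_sup \<beta> T (\<lambda>r. y r - z r) < \<infinity>"
  by (rule holder_sup_diff(1); rule holder_sup_mono_exponent[OF assms(1)])
    (use assms in \<open>simp_all add: holder_paths_def\<close>)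

lemma holder_dist_nonneg [simp]: "0 \<le> holder_dist \<beta> T y z"
  by (simp add: holder_dist_def holder_norm_def)

lemma holder_dist_commute: "holder_dist \<beta> T y z = holder_dist \<beta> T z y"
proof -
  have "norm (y t - z t - (y s - z s)) = norm (z t - y t - (z s - y s))" for s t
    using norm_minus_cancel[of "y t - z t - (y s - z s)"] by (simp add: algebra_simps)
  then show ?thesis
    by (simp add: holder_dist_def holder_norm_def holder_seminorm_def holder_sup_def norm_minus_commute)
qed

lemma Metric_space_holder:
  fixes T :: real
  assumes "\<beta> \<le> \<alpha>" "0 \<le> T"
  shows "Metric_space (holder_paths \<alpha> T :: (real \<Rightarrow> 'b::real_normed_vector) set) (holder_dist \<beta> T)"
proof
  fix x y :: "real \<Rightarrow> 'b"
  show "0 \<le> holder_dist \<beta> T x y" by simp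
  show "holder_dist \<beta> T x y = holder_dist \<beta> T y x" by (rule holder_dist_commute)
next
  fix x y :: "real \<Rightarrow> 'b"
  assume xy: "x \<in> holder_paths \<alpha> T" "y \<in> holder_paths \<alpha> T"
  have fin: "holder_sup \<beta> T (\<lambda>r. x r - y r) < \<infinity>"
    by (rule holder_sup_diff_paths[OF assms(1) xy])
  show "holder_dist \<beta> T x y = 0 \<longleftrightarrow> x = y"
  proof
    assume "holder_dist \<beta> T x y = 0"
    then have 0: "x 0 = y 0" and s0: "holder_seminorm \<beta> T (\<lambda>r. x r - y r) = 0"
      using holder_seminorm_nonneg[of \<beta> T "\<lambda>r. x r - y r"] norm_ge_zero[of "x 0 - y 0"]
      unfolding holder_dist_def holder_norm_def
      by (metis add_nonneg_eq_0_iff norm_eq_zero right_minus_eq)+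
    have "x t = y t" if "t \<in> {0..T}" for t
      using holder_seminorm_bound[OF fin, of 0 t] that 0 s0 by (cases "t = 0") auto
    then show "x = y"
      using xy by (auto simp: holder_paths_def intro: extensionalityI)
  next
    assume "x = y"
    have "holder_seminorm \<beta> T (\<lambda>r. 0 :: 'b) \<le> 0" by (rule holder_seminorm_le) auto
    then show "holder_dist \<beta> T x y = 0"
      using \<open>x = y\<close> holder_seminorm_nonneg[of \<beta> T "\<lambda>r. 0 :: 'b"] by (simp add: holder_dist_def holder_norm_def)
  qed
next
  fix x y z :: "real \<Rightarrow> 'b"
  assume xyz: "x \<in> holder_paths \<alpha> T" "y \<in> holder_paths \<alpha> T" "z \<in> holder_paths \<alpha> T"
  have "holder_sup \<beta> T (\<lambda>r. x r - y r) < \<infinity>" "holder_sup \<beta> T (\<lambda>r. z r - y r) < \<infinity>"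
    by (rule holder_sup_diff_paths[OF assms(1)]; use xyz in simp)+
  from holder_sup_diff(2)[OF this]
  have "holder_seminorm \<beta> T (\<lambda>r. x r - z r)
      \<le> holder_seminorm \<beta> T (\<lambda>r. x r - y r) + holder_seminorm \<beta> T (\<lambda>r. z r - y r)" by simp
  moreover have "norm (x 0 - z 0) \<le> norm (x 0 - y 0) + norm (z 0 - y 0)"
    by (metis dist_norm dist_triangle2)
  ultimately have "holder_dist \<beta> T x z \<le> holder_dist \<beta> T x y + holder_dist \<beta> T z y"
    by (simp add: holder_dist_def holder_norm_def)
  then show "holder_dist \<beta> T x z \<le> holder_dist \<beta> T x y + holder_dist \<beta> T y z"
    by (simp add: holder_dist_commute[of \<beta> T y z])
qed

lemma stopped_in_holder_paths:
  assumes "0 \<le> \<alpha>" "t \<in> {0..T}" "y \<in> holder_paths \<alpha> T"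
  shows "stopped T t y \<in> holder_paths \<alpha> T"
proof -
  have fin: "holder_sup \<alpha> T y < \<infinity>" using assms(3) by (simp add: holder_paths_def)
  have "norm (stopped T t y v - stopped T t y u) \<le> holder_seminorm \<alpha> T y * (v - u) powr \<alpha>"
    if "0 \<le> u" "u < v" "v \<le> T" for u v
  proof (cases "u < t")
    case True
    have "norm (stopped T t y v - stopped T t y u) \<le> holder_seminorm \<alpha> T y * (min v t - u) powr \<alpha>"
      using holder_seminorm_bound[OF fin, of u "min v t"] that True by (simp add: stopped_def min_absorb1)
    also have "\<dots> \<le> holder_seminorm \<alpha> T y * (v - u) powr \<alpha>"
      using that True assms(1) by (intro mult_left_mono powr_mono2) auto
    finally show ?thesis .
  qed (use that in \<open>simp add: stopped_def\<close>)
  then have "holder_sup \<alpha> T (stopped T t y) < \<infinity>"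
    unfolding holder_sup_finite_iff by (intro exI[of _ "holder_seminorm \<alpha> T y"]) auto
  then show ?thesis by (simp add: holder_paths_def stopped_def)
qed

lemma Metric_space_stopped:
  fixes T :: real
  assumes "\<beta> \<le> \<alpha>" "0 \<le> \<alpha>" "0 \<le> T"
  shows "Metric_space (stopped_paths \<alpha> T :: (real \<times> (real \<Rightarrow> 'b::real_normed_vector)) set) (stopped_dist \<beta> T)"
proof -
  interpret H: Metric_space "holder_paths \<alpha> T :: (real \<Rightarrow> 'b) set" "holder_dist \<beta> T"
    by (rule Metric_space_holder) (use assms in auto)
  have snd: "snd p \<in> holder_paths \<alpha> T" if "p \<in> stopped_paths \<alpha> T" for p :: "real \<times> (real \<Rightarrow> 'b)"
    using that assms by (auto simp: stopped_paths_def intro!: stopped_in_holder_paths)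
  show ?thesis
  proof
    fix x y :: "real \<times> (real \<Rightarrow> 'b)"
    show "0 \<le> stopped_dist \<beta> T x y" by (simp add: stopped_dist_def)
    show "stopped_dist \<beta> T x y = stopped_dist \<beta> T y x"
      by (simp add: stopped_dist_def holder_dist_commute[of \<beta> T "snd x"] abs_minus_commute)
  next
    fix x y :: "real \<times> (real \<Rightarrow> 'b)"
    assume "x \<in> stopped_paths \<alpha> T" "y \<in> stopped_paths \<alpha> T"
    then show "stopped_dist \<beta> T x y = 0 \<longleftrightarrow> x = y"
      using H.zero[OF snd snd, of x y] by (auto simp: stopped_dist_def prod_eq_iff add_nonneg_eq_0_iff)
  next
    fix x y z :: "real \<times> (real \<Rightarrow> 'b)"
    assume "x \<in> stopped_paths \<alpha> T" "y \<in> stopped_paths \<alpha> T" "z \<in> stopped_paths \<alpha> T"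
    then show "stopped_dist \<beta> T x z \<le> stopped_dist \<beta> T x y + stopped_dist \<beta> T y z"
      using H.triangle[OF snd snd snd, of x y z] by (simp add: stopped_dist_def)
  qed
qed


section \<open>Riemann--Stieltjes integrals\<close>

text \<open>
  Limit of the tagged Riemann--Stieltjes sums as the mesh tends to zero. For Hoelder functions
  whose exponents add up to more than one this is the Young integral.
\<close>

definition has_rs_integral ::
  "(real \<Rightarrow> real) \<Rightarrow> (real \<Rightarrow> real) \<Rightarrow> real \<Rightarrow> real \<Rightarrow> real \<Rightarrow> bool" where
  "has_rs_integral f g a b I \<longleftrightarrow>
     (\<forall>\<epsilon>>0. \<exists>\<delta>>0. \<forall>n (p :: nat \<Rightarrow> real) \<xi>.
        p 0 = a \<and> p n = b \<and>
        (\<forall>k<n. p k \<le> \<xi> k \<and> \<xi> k \<le> p (Suc k) \<and> p (Suc k) - p k < \<delta>) \<longrightarrow>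
        \<bar>(\<Sum>k<n. f (\<xi> k) * (g (p (Suc k)) - g (p k))) - I\<bar> < \<epsilon>)"

definition rs_integrable :: "(real \<Rightarrow> real) \<Rightarrow> (real \<Rightarrow> real) \<Rightarrow> real \<Rightarrow> real \<Rightarrow> bool" where
  "rs_integrable f g a b \<longleftrightarrow> (\<exists>I. has_rs_integral f g a b I)"

definition rs_integral :: "(real \<Rightarrow> real) \<Rightarrow> (real \<Rightarrow> real) \<Rightarrow> real \<Rightarrow> real \<Rightarrow> real" where
  "rs_integral f g a b = (THE I. has_rs_integral f g a b I)"

lemma has_rs_integral_unique:
  assumes "a \<le> b" "has_rs_integral f g a b I" "has_rs_integral f g a b J"
  shows "I = J"
proof (rule ccontr)
  assume "I \<noteq> J"
  define \<epsilon> where "\<epsilon> = \<bar>I - J\<bar> / 2"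
  have "\<epsilon> > 0" using \<open>I \<noteq> J\<close> by (simp add: \<epsilon>_def)
  define adm where "adm \<delta> n p \<xi> \<longleftrightarrow> p 0 = a \<and> p n = b \<and>
    (\<forall>k<n. p k \<le> \<xi> k \<and> \<xi> k \<le> p (Suc k) \<and> p (Suc k) - p k < \<delta>)"
    for \<delta> n and p \<xi> :: "nat \<Rightarrow> real"
  define S where "S n p \<xi> = (\<Sum>k<n. f (\<xi> k) * (g (p (Suc k)) - g (p k)))"
    for n and p \<xi> :: "nat \<Rightarrow> real"
  obtain d1 where d1: "d1 > 0" "\<And>n p \<xi>. adm d1 n p \<xi> \<Longrightarrow> \<bar>S n p \<xi> - I\<bar> < \<epsilon>"
    using assms(2) \<open>\<epsilon> > 0\<close> unfolding has_rs_integral_def adm_def S_def by blast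
  obtain d2 where d2: "d2 > 0" "\<And>n p \<xi>. adm d2 n p \<xi> \<Longrightarrow> \<bar>S n p \<xi> - J\<bar> < \<epsilon>"
    using assms(3) \<open>\<epsilon> > 0\<close> unfolding has_rs_integral_def adm_def S_def by blast
  define d where "d = min d1 d2"
  have "d > 0" using d1 d2 by (simp add: d_def)
  obtain n :: nat where n: "real n > (b - a) / d" using reals_Archimedean2 by blast
  with \<open>d > 0\<close> \<open>a \<le> b\<close> have "n > 0" by (cases n) (auto simp: divide_simps split: if_splits)
  define h where "h = (b - a) / n"
  have h: "0 \<le> h" "h < d" "a + n * h = b"
    using n \<open>n > 0\<close> \<open>d > 0\<close> \<open>a \<le> b\<close> by (auto simp: h_def field_simps)
  define p where "p k = a + real k * h" for k
  have "adm d1 n p p" "adm d2 n p p"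
    using h by (auto simp: adm_def p_def d_def algebra_simps)
  then have "\<bar>S n p p - I\<bar> < \<epsilon>" "\<bar>S n p p - J\<bar> < \<epsilon>" using d1 d2 by blast+
  then show False
    using abs_triangle_ineq4[of "S n p p - J" "S n p p - I"] by (simp add: \<epsilon>_def)
qed


section \<open>Tensor series and group-like elements\<close>

text \<open>
  The finite type \<open>'a\<close> is the alphabet, so \<open>D = CARD('a)\<close>. An element of \<open>T((\<real>\<^sup>D))\<close> is given by its
  coordinates in the word basis.
\<close>

type_synonym 'a tensor_series = "'a list \<Rightarrow> real"

definition tensor_polys :: "'a tensor_series set" where
  "tensor_polys = {b. finite {w. b w \<noteq> 0}}"

definition tensor_pairing :: "'a tensor_series \<Rightarrow> 'a tensor_series \<Rightarrow> real" where
  "tensor_pairing b g = (\<Sum>w | b w \<noteq> 0. b w * g w)"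

text \<open>Shuffles of two words with multiplicity, which \<^const>\<open>shuffles\<close> forgets.\<close>

fun word_shuffle :: "'a list \<Rightarrow> 'a list \<Rightarrow> 'a list multiset" where
  "word_shuffle [] v = {#v#}"
| "word_shuffle u [] = {#u#}"
| "word_shuffle (i # u) (j # v) =
     image_mset ((#) i) (word_shuffle u (j # v)) + image_mset ((#) j) (word_shuffle (i # u) v)"

definition tensor_shuffle :: "'a tensor_series \<Rightarrow> 'a tensor_series \<Rightarrow> 'a tensor_series" where
  "tensor_shuffle b c =
     (\<lambda>w. \<Sum>u | b u \<noteq> 0. \<Sum>v | c v \<noteq> 0. b u * c v * real (count (word_shuffle u v) w))"

definition group_like :: "'a tensor_series set" where
  "group_like = {g. g \<noteq> (\<lambda>w. 0) \<and>
     (\<forall>b\<in>tensor_polys. \<forall>c\<in>tensor_polys.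
        tensor_pairing b g * tensor_pairing c g = tensor_pairing (tensor_shuffle b c) g)}"

definition level_pairing :: "nat \<Rightarrow> 'a::finite tensor_series \<Rightarrow> 'a tensor_series \<Rightarrow> real" where
  "level_pairing k l g = (\<Sum>w | length w = k. l w * g w)"

definition gl_abs :: "'a::finite tensor_series \<Rightarrow> 'a tensor_series \<Rightarrow> ennreal" where
  "gl_abs l g = (\<Sum>k. ennreal \<bar>level_pairing (Suc k) l g\<bar>)"

definition group_like_dual :: "'a::finite tensor_series set" where
  "group_like_dual = {l. \<forall>g\<in>group_like. gl_abs l g < \<infinity>}"

definition entire_map :: "'a::finite tensor_series \<Rightarrow> 'a tensor_series \<Rightarrow> real" where
  "entire_map l g = (\<Sum>n. level_pairing n l g)"

definition bounded_entire :: "'a::finite tensor_series \<Rightarrow> bool" where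
  "bounded_entire l \<longleftrightarrow> l \<in> group_like_dual \<and> bounded (entire_map l ` group_like)"


section \<open>Signatures\<close>

text \<open>
  The coordinate of the word \<open>w i\<close> is the integral of the coordinate of \<open>w\<close> against the \<open>i\<close>-th
  component, so the recursion removes the \<^emph>\<open>last\<close> letter and is run on the reversed word.
\<close>

fun sig_rev :: "(real \<Rightarrow> real ^ 'a) \<Rightarrow> 'a list \<Rightarrow> real \<Rightarrow> real" where
  "sig_rev z [] t = 1"
| "sig_rev z (i # w) t = rs_integral (sig_rev z w) (\<lambda>s. z s $ i) 0 t"

definition signature :: "(real \<Rightarrow> real ^ 'a) \<Rightarrow> real \<Rightarrow> 'a tensor_series" where
  "signature z t = (\<lambda>w. sig_rev z (rev w) t)"

text \<open>\<open>\<real>\<^bsup>m+1\<^esup>\<close> is \<open>real ^ 'm option\<close>; the index \<^const>\<open>None\<close> is the time coordinate.\<close>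

definition time_extend :: "(real \<Rightarrow> real ^ 'm) \<Rightarrow> real \<Rightarrow> real ^ 'm option" where
  "time_extend y t = (\<chi> k. case k of None \<Rightarrow> t | Some i \<Rightarrow> y t $ i)"


section \<open>Path-dependent equations\<close>

text \<open>
  \<open>F y s i j\<close> is the \<open>(i,j)\<close> entry at time \<open>s\<close> of the coefficient evaluated along \<open>y\<close>. Since
  \<^const>\<open>rs_integral\<close> is unspecified where the integral does not exist, existence is part of being
  a solution.
\<close>

definition solves ::
  "real \<Rightarrow> real \<Rightarrow> real \<Rightarrow> ((real \<Rightarrow> real ^ 'm) \<Rightarrow> real \<Rightarrow> 'm \<Rightarrow> 'd \<Rightarrow> real) \<Rightarrow>
   (real \<Rightarrow> real ^ 'd) \<Rightarrow> (real \<Rightarrow> real ^ 'm) \<Rightarrow> (real \<Rightarrow> real ^ 'm) \<Rightarrow> bool" where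
  "solves \<alpha> T0 T1 F x w y \<longleftrightarrow>
     y \<in> holder_paths \<alpha> T1 \<and>
     (\<forall>t\<in>{0..T0}. y t = w t) \<and>
     (\<forall>t\<in>{T0..T1}. \<forall>i.
        (\<forall>j. rs_integrable (\<lambda>s. F y s i j) (\<lambda>s. x s $ j) T0 t) \<and>
        y t $ i = w T0 $ i + (\<Sum>j\<in>UNIV. rs_integral (\<lambda>s. F y s i j) (\<lambda>s. x s $ j) T0 t))"

definition functional_coeff ::
  "real \<Rightarrow> (real \<times> (real \<Rightarrow> real ^ 'm) \<Rightarrow> (real ^ 'd) \<Rightarrow>\<^sub>L (real ^ 'm)) \<Rightarrow>
   (real \<Rightarrow> real ^ 'm) \<Rightarrow> real \<Rightarrow> 'm \<Rightarrow> 'd \<Rightarrow> real" where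
  "functional_coeff T f y s i j = matrix (blinfun_apply (f (s, stopped T s y))) $ i $ j"

definition signature_coeff ::
  "('m \<Rightarrow> 'd \<Rightarrow> 'm option tensor_series) \<Rightarrow>
   (real \<Rightarrow> real ^ 'm::finite) \<Rightarrow> real \<Rightarrow> 'm \<Rightarrow> 'd \<Rightarrow> real" where
  "signature_coeff l y s i j = entire_map (l i j) (signature (time_extend y) s)"

definition input_set ::
  "real \<Rightarrow> real \<Rightarrow> real \<Rightarrow> real \<Rightarrow> real \<Rightarrow> real ^ 'm \<Rightarrow>
   ((real \<Rightarrow> real ^ 'd) \<times> (real \<Rightarrow> real ^ 'm)) set" where
  "input_set \<alpha> T0 T1 Bx Bw w0 =
     {(x, w). x \<in> holder_paths 1 T1 \<and> holder_norm 1 T1 x \<le> Bx \<and>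
              w \<in> holder_paths \<alpha> T0 \<and> w 0 = w0 \<and> holder_seminorm \<alpha> T0 w \<le> Bw}"

end

(*
  The approximating coefficients are built from the sine. Shuffle powers of a single word w are
  homogeneous, so sin (r g_w) is a bounded entire map of g, and the shuffle product makes bounded
  entire maps an algebra. Evaluated at signatures, the words "time" and "i, time, ..., time"
  recover the pair (t, path stopped at t), because iterated time integrals determine all moments
  of a continuous function. Hence, by Stone-Weierstrass, this algebra is dense in the continuous
  functionals on the compact set of stopped paths with a fixed initial value and a bounded
  alpha-Hoelder seminorm, and its elements are Lipschitz in the supremum norm.

  On the side of the equations, Hoelder bounds with the weight exp (rho t) turn the Picard map
  into a contraction. An approximation of f that is close only on the compact set still maps
  this set to itself, so its fixed point lies there; by global uniqueness it is the solution,
  and the weighted estimate compares it with the solution for f. Young integration is needed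
  only to see that signatures are group-like.
*)
theory Submission
  imports Defs "HOL-Complex_Analysis.Great_Picard"
begin

section \<open>Riemann--Stieltjes primitives\<close>

text \<open>The Lipschitz constants of the approximating coefficients are not controlled as the
  approximation improves, so no uniform constant may depend on them. Hence the ball radius
  \<open>R\<close> is fixed before any approximation is chosen: it depends on the coefficient only
  through a growth constant \<open>C\<close>, in which a summand 1 absorbs all approximation errors
  up to 1. Hence also the difference of solutions \<open>y\<close> (for \<open>F\<close>) and
  \<open>z\<close> (for \<open>G\<close>) is split as \<open>F y - F z\<close> plus
  \<open>F z - G z\<close>: only the Lipschitz constant of \<open>F\<close> enters, and closeness is
  used at \<open>z\<close>, which lies in the ball. The weight helps because integration against a
  Lipschitz path produces increments of order \<open>t - s\<close>, which leaves an exponent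
  \<open>1 - \<beta>\<close> to spare over the Hoelder norm; the spare becomes the factor
  \<open>\<rho> powr (\<beta> - 1)\<close>, small for large \<rho>. Integrals are handled through
  \<open>rs_primitive\<close>, which says that a single tagged summand misses the increment of a
  candidate primitive by o(t - s), uniformly in position and tag. Tagged sums over partitions then
  have to be examined only once, and primitives can be found as limits of ordinary
  integrals.\<close>

definition rs_primitive ::
  "(real \<Rightarrow> real) \<Rightarrow> (real \<Rightarrow> real) \<Rightarrow> (real \<Rightarrow> real) \<Rightarrow> real \<Rightarrow> real \<Rightarrow> bool" where
  "rs_primitive f g I a b \<longleftrightarrow>
     (\<forall>\<epsilon>>0. \<exists>\<delta>>0. \<forall>s \<xi> t. a \<le> s \<longrightarrow> s \<le> \<xi> \<longrightarrow> \<xi> \<le> t \<longrightarrow> t \<le> b \<longrightarrow> t - s < \<delta> \<longrightarrow>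
        \<bar>I t - I s - f \<xi> * (g t - g s)\<bar> \<le> \<epsilon> * (t - s))"

lemma rs_primitiveD:
  assumes "rs_primitive f g I a b" "\<epsilon> > 0"
  obtains \<delta> where "\<delta> > 0"
    "\<And>s \<xi> t. a \<le> s \<Longrightarrow> s \<le> \<xi> \<Longrightarrow> \<xi> \<le> t \<Longrightarrow> t \<le> b \<Longrightarrow> t - s < \<delta> \<Longrightarrow>
       \<bar>I t - I s - f \<xi> * (g t - g s)\<bar> \<le> \<epsilon> * (t - s)"
  using assms unfolding rs_primitive_def by meson

lemma partition_mono:
  fixes p :: "nat \<Rightarrow> real"
  assumes "\<And>k. k < n \<Longrightarrow> p k \<le> p (Suc k)" "i \<le> j" "j \<le> n"
  shows "p i \<le> p j"
  using assms(2,3)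
proof (induction j rule: dec_induct)
  case (step m)
  then show ?case using assms(1)[of m] by simp
qed simp

text \<open>Over a fine partition the increments of \<open>I\<close> telescope to
  \<open>I d - I c\<close>, and errors that are linear in the length of each piece add up to at most
  \<open>e * (d - c)\<close>.\<close>

lemma has_rs_integral_primitive:
  assumes "rs_primitive f g I a b" "a \<le> c" "c \<le> d" "d \<le> b"
  shows "has_rs_integral f g c d (I d - I c)"
  unfolding has_rs_integral_def
proof (intro allI impI)
  fix \<epsilon> :: real assume "\<epsilon> > 0"
  \<comment> \<open>The summand 1 keeps the denominator positive when \<open>c = d\<close>; the
    factor 2 makes the final inequality strict.\<close>
  define e where "e = \<epsilon> / (2 * (d - c + 1))"
  have "e > 0" using \<open>\<epsilon> > 0\<close> assms by (simp add: e_def)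
  have ed: "e * (d - c) < \<epsilon>"
  proof -
    have "e * (d - c) \<le> e * (d - c + 1)" using \<open>e > 0\<close> by simp
    also have "\<dots> = \<epsilon> / 2" using assms by (simp add: e_def field_simps)
    finally show ?thesis using \<open>\<epsilon> > 0\<close> by simp
  qed
  obtain \<delta> where \<delta>: "\<delta> > 0"
    "\<And>s \<xi> t. a \<le> s \<Longrightarrow> s \<le> \<xi> \<Longrightarrow> \<xi> \<le> t \<Longrightarrow> t \<le> b \<Longrightarrow> t - s < \<delta> \<Longrightarrow>
       \<bar>I t - I s - f \<xi> * (g t - g s)\<bar> \<le> e * (t - s)"
    using rs_primitiveD[OF assms(1) \<open>e > 0\<close>] by blast
  have "\<bar>(\<Sum>k<n. f (\<xi> k) * (g (p (Suc k)) - g (p k))) - (I d - I c)\<bar> < \<epsilon>"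
    if p: "p 0 = c" "p n = d"
      and k: "\<forall>k<n. p k \<le> \<xi> k \<and> \<xi> k \<le> p (Suc k) \<and> p (Suc k) - p k < \<delta>"
    for n and p \<xi> :: "nat \<Rightarrow> real"
  proof -
    have mono: "p i \<le> p j" if "i \<le> j" "j \<le> n" for i j
      by (rule partition_mono[of n p]) (use k that in force)+
    have piece: "\<bar>f (\<xi> k) * (g (p (Suc k)) - g (p k)) - (I (p (Suc k)) - I (p k))\<bar>
        \<le> e * (p (Suc k) - p k)" if "k < n" for k
    proof -
      have "a \<le> p k" "p (Suc k) \<le> b"
        using mono[of 0 k] mono[of "Suc k" n] that assms p by auto
      then show ?thesis
        using \<delta>(2)[of "p k" "\<xi> k" "p (Suc k)"] k that by (simp add: abs_minus_commute)
    qed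
    have "I d - I c = (\<Sum>k<n. I (p (Suc k)) - I (p k))"
      using sum_lessThan_telescope[of "\<lambda>k. I (p k)" n] p by simp
    then have "\<bar>(\<Sum>k<n. f (\<xi> k) * (g (p (Suc k)) - g (p k))) - (I d - I c)\<bar> =
        \<bar>\<Sum>k<n. f (\<xi> k) * (g (p (Suc k)) - g (p k)) - (I (p (Suc k)) - I (p k))\<bar>"
      by (simp add: sum_subtractf)
    also have "\<dots> \<le> (\<Sum>k<n. e * (p (Suc k) - p k))"
      by (rule order_trans[OF sum_abs]) (rule sum_mono, use piece in auto)
    also have "\<dots> = e * (d - c)"
      using sum_lessThan_telescope[of p n] p by (simp flip: sum_distrib_left)
    finally show ?thesis using ed by simp
  qed
  then show "\<exists>\<delta>>0. \<forall>n p \<xi>. p 0 = c \<and> p n = d \<and>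
      (\<forall>k<n. p k \<le> \<xi> k \<and> \<xi> k \<le> p (Suc k) \<and> p (Suc k) - p k < \<delta>) \<longrightarrow>
      \<bar>(\<Sum>k<n. f (\<xi> k) * (g (p (Suc k)) - g (p k))) - (I d - I c)\<bar> < \<epsilon>"
    using \<delta>(1) by blast
qed

lemma rs_integral_primitive:
  assumes "rs_primitive f g I a b" "a \<le> c" "c \<le> d" "d \<le> b"
  shows "rs_integrable f g c d" "rs_integral f g c d = I d - I c"
proof -
  have *: "has_rs_integral f g c d (I d - I c)" by (rule has_rs_integral_primitive[OF assms])
  then show "rs_integrable f g c d" unfolding rs_integrable_def by blast
  show "rs_integral f g c d = I d - I c"
    unfolding rs_integral_def
    using * has_rs_integral_unique[OF assms(3) _ *] by (intro the_equality) blast+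
qed

text \<open>Subdivide into \<open>n\<close> equal pieces; the increments telescope to at most \<open>\<epsilon> (b - a)\<close>.\<close>

lemma nonincreasing_if_small_increments:
  fixes h :: "real \<Rightarrow> real"
  assumes "a \<le> b"
    and "\<And>\<epsilon>. \<epsilon> > 0 \<Longrightarrow> \<exists>\<delta>>0. \<forall>s t. a \<le> s \<longrightarrow> s \<le> t \<longrightarrow> t \<le> b \<longrightarrow> t - s < \<delta> \<longrightarrow> h t - h s \<le> \<epsilon> * (t - s)"
  shows "h b \<le> h a"
proof (rule field_le_epsilon)
  fix e :: real assume "e > 0"
  define \<epsilon> where "\<epsilon> = e / (b - a + 1)"
  have "\<epsilon> > 0" using \<open>e > 0\<close> assms(1) by (simp add: \<epsilon>_def)
  have ee: "\<epsilon> * (b - a) \<le> e" using \<open>e > 0\<close> assms(1) by (simp add: \<epsilon>_def field_simps)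
  obtain \<delta> where \<delta>: "\<delta> > 0"
    "\<And>s t. a \<le> s \<Longrightarrow> s \<le> t \<Longrightarrow> t \<le> b \<Longrightarrow> t - s < \<delta> \<Longrightarrow> h t - h s \<le> \<epsilon> * (t - s)"
    using assms(2)[OF \<open>\<epsilon> > 0\<close>] by blast
  obtain n :: nat where n: "real n > (b - a) / \<delta>" using reals_Archimedean2 by blast
  with \<delta>(1) assms(1) have "n > 0" by (cases n) (auto simp: divide_simps split: if_splits)
  define d where "d = (b - a) / n"
  have d: "0 \<le> d" "d < \<delta>" "real n * d = b - a"
    using n \<open>n > 0\<close> \<delta>(1) assms(1) by (auto simp: d_def field_simps)
  define p where "p k = a + real k * d" for k
  have "h (p (Suc k)) - h (p k) \<le> \<epsilon> * (p (Suc k) - p k)" if "k < n" for k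
  proof (rule \<delta>(2))
    have "real (Suc k) * d \<le> real n * d" using that d by (intro mult_right_mono) auto
    then show "p (Suc k) \<le> b" using d by (simp add: p_def)
  qed (use d in \<open>auto simp: p_def algebra_simps\<close>)
  then have "(\<Sum>k<n. h (p (Suc k)) - h (p k)) \<le> (\<Sum>k<n. \<epsilon> * (p (Suc k) - p k))"
    by (intro sum_mono) auto
  then have "h (p n) - h (p 0) \<le> \<epsilon> * (p n - p 0)"
    using sum_lessThan_telescope[of "\<lambda>k. h (p k)" n] sum_lessThan_telescope[of p n]
    by (simp flip: sum_distrib_left)
  then show "h b \<le> h a + e" using ee d by (simp add: p_def)
qed

lemma powr_superlinear_small:
  fixes K \<theta> :: real
  assumes "1 < \<theta>" "0 \<le> K" "\<epsilon> > 0"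
  shows "\<exists>\<delta>>0. \<forall>h. 0 \<le> h \<longrightarrow> h < \<delta> \<longrightarrow> K * h powr \<theta> \<le> \<epsilon> * h"
\<comment> \<open>The threshold solves \<open>(K + 1) * h powr (\<theta> - 1) = \<epsilon>\<close>;
  \<open>K + 1\<close> replaces \<open>K\<close> to avoid division by zero.\<close>
proof (intro exI[of _ "(\<epsilon> / (K + 1)) powr (1 / (\<theta> - 1))"] conjI allI impI)
  fix h :: real assume h: "0 \<le> h" "h < (\<epsilon> / (K + 1)) powr (1 / (\<theta> - 1))"
  show "K * h powr \<theta> \<le> \<epsilon> * h"
  proof (cases "h = 0")
    case False
    then have "h powr (\<theta> - 1) \<le> ((\<epsilon> / (K + 1)) powr (1 / (\<theta> - 1))) powr (\<theta> - 1)"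
      using h assms by (intro powr_mono2) auto
    also have "\<dots> = \<epsilon> / (K + 1)" using assms by (simp add: powr_powr)
    finally have "K * h powr (\<theta> - 1) \<le> (K + 1) * (\<epsilon> / (K + 1))"
      using assms by (intro mult_mono) auto
    also have "\<dots> = \<epsilon>" using assms by simp
    finally have "K * h powr (\<theta> - 1) * h \<le> \<epsilon> * h" using h by (intro mult_right_mono) auto
    moreover have "h powr \<theta> = h powr (\<theta> - 1) * h"
      using False h by (simp add: powr_diff)
    ultimately show ?thesis by (simp add: mult.assoc)
  qed (use assms in simp)
qed (use assms in auto)

lemma rs_primitive_superlinear:
  assumes "1 < \<theta>" "0 \<le> K"
    and "\<And>s \<xi> t. a \<le> s \<Longrightarrow> s \<le> \<xi> \<Longrightarrow> \<xi> \<le> t \<Longrightarrow> t \<le> b \<Longrightarrow>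
      \<bar>I t - I s - f \<xi> * (g t - g s)\<bar> \<le> K * (t - s) powr \<theta>"
  shows "rs_primitive f g I a b"
  unfolding rs_primitive_def
proof (intro allI impI)
  fix \<epsilon> :: real assume "\<epsilon> > 0"
  then obtain \<delta> where \<delta>: "\<delta> > 0" "\<And>h. 0 \<le> h \<Longrightarrow> h < \<delta> \<Longrightarrow> K * h powr \<theta> \<le> \<epsilon> * h"
    using powr_superlinear_small[OF assms(1,2)] by blast
  have "\<bar>I t - I s - f \<xi> * (g t - g s)\<bar> \<le> \<epsilon> * (t - s)"
    if "a \<le> s" "s \<le> \<xi>" "\<xi> \<le> t" "t \<le> b" "t - s < \<delta>" for s \<xi> t
    using assms(3)[OF that(1-4)] \<delta>(2)[of "t - s"] that by simp
  then show "\<exists>\<delta>>0. \<forall>s \<xi> t. a \<le> s \<longrightarrow> s \<le> \<xi> \<longrightarrow> \<xi> \<le> t \<longrightarrow> t \<le> b \<longrightarrow> t - s < \<delta> \<longrightarrow>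
      \<bar>I t - I s - f \<xi> * (g t - g s)\<bar> \<le> \<epsilon> * (t - s)"
    using \<delta>(1) by blast
qed

text \<open>An increment of order above 1 is o(t - s), so both \<open>h\<close> and
  \<open>- h\<close> are nonincreasing. This is the uniqueness principle behind the shuffle identity
  for iterated integrals: matching first order expansions force equality.\<close>

lemma constant_if_superlinear_increments:
  fixes h :: "real \<Rightarrow> real"
  assumes "1 < \<theta>" "0 \<le> K" "a \<le> b"
    and "\<And>s t. a \<le> s \<Longrightarrow> s \<le> t \<Longrightarrow> t \<le> b \<Longrightarrow> \<bar>h t - h s\<bar> \<le> K * (t - s) powr \<theta>"
  shows "h b = h a"
proof -
  have small: "\<exists>\<delta>>0. \<forall>s t. a \<le> s \<longrightarrow> s \<le> t \<longrightarrow> t \<le> b \<longrightarrow> t - s < \<delta> \<longrightarrow> c * h t - c * h s \<le> \<epsilon> * (t - s)"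
    if "\<epsilon> > 0" "\<bar>c\<bar> = 1" for \<epsilon> c
  proof -
    obtain \<delta> where \<delta>: "\<delta> > 0" "\<And>h. 0 \<le> h \<Longrightarrow> h < \<delta> \<Longrightarrow> K * h powr \<theta> \<le> \<epsilon> * h"
      using powr_superlinear_small[OF assms(1,2) \<open>\<epsilon> > 0\<close>] by blast
    have "c * h t - c * h s \<le> \<epsilon> * (t - s)" if "a \<le> s" "s \<le> t" "t \<le> b" "t - s < \<delta>" for s t
    proof -
      have "c * h t - c * h s \<le> \<bar>c * (h t - h s)\<bar>"
        unfolding right_diff_distrib by (rule abs_ge_self)
      also have "\<dots> = \<bar>h t - h s\<bar>" using \<open>\<bar>c\<bar> = 1\<close> by (simp add: abs_mult)
      finally show ?thesis using assms(4)[OF that(1-3)] \<delta>(2)[of "t - s"] that by simp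
    qed
    then show ?thesis using \<delta>(1) by blast
  qed
  have "1 * h b \<le> 1 * h a" "(-1) * h b \<le> (-1) * h a"
    by (rule nonincreasing_if_small_increments[OF assms(3), where h = "\<lambda>t. c * h t" for c]; rule small; simp)+
  then show ?thesis by simp
qed

text \<open>The majorant \<open>\<Phi>\<close> plays the part of the integral of
  \<open>\<bar>f\<bar> * L\<close>, so a bound by an exponential weight can be integrated exactly.
  The functions \<open>I - \<Phi>\<close> and \<open>- I - \<Phi>\<close> have increments below
  \<open>\<epsilon> * (t - s)\<close> on short intervals and are therefore nonincreasing.\<close>

lemma rs_primitive_bound:
  assumes prim: "rs_primitive f g I a b" and "a \<le> c" "c \<le> d" "d \<le> b" "0 \<le> L"
    and lip: "\<And>s t. a \<le> s \<Longrightarrow> s \<le> t \<Longrightarrow> t \<le> b \<Longrightarrow> \<bar>g t - g s\<bar> \<le> L * (t - s)"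
    and maj: "\<And>s t. c \<le> s \<Longrightarrow> s \<le> t \<Longrightarrow> t \<le> d \<Longrightarrow> \<bar>f s\<bar> * L * (t - s) \<le> \<Phi> t - \<Phi> s"
  shows "\<bar>I d - I c\<bar> \<le> \<Phi> d - \<Phi> c"
proof -
  have *: "\<exists>\<delta>>0. \<forall>s t. c \<le> s \<longrightarrow> s \<le> t \<longrightarrow> t \<le> d \<longrightarrow> t - s < \<delta> \<longrightarrow>
      \<bar>I t - I s\<bar> \<le> \<Phi> t - \<Phi> s + \<epsilon> * (t - s)" if "\<epsilon> > 0" for \<epsilon>
  proof -
    obtain \<delta> where \<delta>: "\<delta> > 0"
      "\<And>s \<xi> t. a \<le> s \<Longrightarrow> s \<le> \<xi> \<Longrightarrow> \<xi> \<le> t \<Longrightarrow> t \<le> b \<Longrightarrow> t - s < \<delta> \<Longrightarrow>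
         \<bar>I t - I s - f \<xi> * (g t - g s)\<bar> \<le> \<epsilon> * (t - s)"
      using rs_primitiveD[OF prim \<open>\<epsilon> > 0\<close>] by blast
    have "\<bar>I t - I s\<bar> \<le> \<Phi> t - \<Phi> s + \<epsilon> * (t - s)"
      if st: "c \<le> s" "s \<le> t" "t \<le> d" "t - s < \<delta>" for s t
    proof -
      have "\<bar>f s * (g t - g s)\<bar> \<le> \<bar>f s\<bar> * (L * (t - s))"
        unfolding abs_mult using st assms by (intro mult_left_mono lip) auto
      moreover have "\<bar>I t - I s - f s * (g t - g s)\<bar> \<le> \<epsilon> * (t - s)"
        using st assms by (intro \<delta>(2)) auto
      ultimately show ?thesis using maj[OF st(1-3)] by (simp add: mult.assoc)
    qed
    then show ?thesis using \<delta>(1) by blast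
  qed
  have "c' * I d - \<Phi> d \<le> c' * I c - \<Phi> c" if "\<bar>c'\<bar> = 1" for c'
  proof (rule nonincreasing_if_small_increments[OF \<open>c \<le> d\<close>, where h = "\<lambda>t. c' * I t - \<Phi> t"])
    fix \<epsilon> :: real assume "\<epsilon> > 0"
    obtain \<delta> where \<delta>: "\<delta> > 0" "\<And>s t. c \<le> s \<Longrightarrow> s \<le> t \<Longrightarrow> t \<le> d \<Longrightarrow> t - s < \<delta> \<Longrightarrow>
      \<bar>I t - I s\<bar> \<le> \<Phi> t - \<Phi> s + \<epsilon> * (t - s)" using *[OF \<open>\<epsilon> > 0\<close>] by blast
    have "c' * I t - \<Phi> t - (c' * I s - \<Phi> s) \<le> \<epsilon> * (t - s)"
      if "c \<le> s" "s \<le> t" "t \<le> d" "t - s < \<delta>" for s t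
    proof -
      have "c' * I t - c' * I s \<le> \<bar>c' * (I t - I s)\<bar>"
        unfolding right_diff_distrib by (rule abs_ge_self)
      also have "\<dots> = \<bar>I t - I s\<bar>" using \<open>\<bar>c'\<bar> = 1\<close> by (simp add: abs_mult)
      finally show ?thesis using \<delta>(2)[OF that] by simp
    qed
    then show "\<exists>\<delta>>0. \<forall>s t. c \<le> s \<longrightarrow> s \<le> t \<longrightarrow> t \<le> d \<longrightarrow> t - s < \<delta> \<longrightarrow>
        c' * I t - \<Phi> t - (c' * I s - \<Phi> s) \<le> \<epsilon> * (t - s)"
      using \<delta>(1) by blast
  qed
  from this[of 1] this[of "-1"] show ?thesis by auto
qed

lemma rs_primitive_diff:
  assumes "rs_primitive f1 g I1 a b" "rs_primitive f2 g I2 a b"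
  shows "rs_primitive (\<lambda>t. f1 t - f2 t) g (\<lambda>t. I1 t - I2 t) a b"
  unfolding rs_primitive_def
proof (intro allI impI)
  fix \<epsilon> :: real assume "\<epsilon> > 0"
  then have e: "\<epsilon> / 2 > 0" by simp
  obtain d1 where d1: "d1 > 0"
    "\<And>s \<xi> t. a \<le> s \<Longrightarrow> s \<le> \<xi> \<Longrightarrow> \<xi> \<le> t \<Longrightarrow> t \<le> b \<Longrightarrow> t - s < d1 \<Longrightarrow>
       \<bar>I1 t - I1 s - f1 \<xi> * (g t - g s)\<bar> \<le> \<epsilon> / 2 * (t - s)"
    using rs_primitiveD[OF assms(1) e] by blast
  obtain d2 where d2: "d2 > 0"
    "\<And>s \<xi> t. a \<le> s \<Longrightarrow> s \<le> \<xi> \<Longrightarrow> \<xi> \<le> t \<Longrightarrow> t \<le> b \<Longrightarrow> t - s < d2 \<Longrightarrow>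
       \<bar>I2 t - I2 s - f2 \<xi> * (g t - g s)\<bar> \<le> \<epsilon> / 2 * (t - s)"
    using rs_primitiveD[OF assms(2) e] by blast
  have "\<bar>I1 t - I2 t - (I1 s - I2 s) - (f1 \<xi> - f2 \<xi>) * (g t - g s)\<bar> \<le> \<epsilon> * (t - s)"
    if "a \<le> s" "s \<le> \<xi>" "\<xi> \<le> t" "t \<le> b" "t - s < min d1 d2" for s \<xi> t
  proof -
    have "\<bar>I1 t - I1 s - f1 \<xi> * (g t - g s)\<bar> \<le> \<epsilon> / 2 * (t - s)"
      "\<bar>I2 t - I2 s - f2 \<xi> * (g t - g s)\<bar> \<le> \<epsilon> / 2 * (t - s)"
      using d1(2)[of s \<xi> t] d2(2)[of s \<xi> t] that by auto
    moreover have "\<epsilon> / 2 * (t - s) + \<epsilon> / 2 * (t - s) = \<epsilon> * (t - s)" by simp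
    ultimately show ?thesis by (simp only: left_diff_distrib)
  qed
  then show "\<exists>\<delta>>0. \<forall>s \<xi> t. a \<le> s \<longrightarrow> s \<le> \<xi> \<longrightarrow> \<xi> \<le> t \<longrightarrow> t \<le> b \<longrightarrow> t - s < \<delta> \<longrightarrow>
      \<bar>I1 t - I2 t - (I1 s - I2 s) - (f1 \<xi> - f2 \<xi>) * (g t - g s)\<bar> \<le> \<epsilon> * (t - s)"
    using d1(1) d2(1) by (intro exI[of _ "min d1 d2"]) auto
qed

section \<open>Existence of primitives: Lipschitz and Young\<close>

text \<open>An explicit constant on an arbitrary interval lets estimates be chained without forming
  suprema. The case \<open>s = t\<close> is included and harmless, because
  \<open>0 powr \<gamma> = 0\<close>.\<close>

definition holder_on :: "real \<Rightarrow> real \<Rightarrow> real \<Rightarrow> real \<Rightarrow> (real \<Rightarrow> 'b::real_normed_vector) \<Rightarrow> bool" where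
  "holder_on \<gamma> C a b f \<longleftrightarrow>
     (\<forall>s t. a \<le> s \<longrightarrow> s \<le> t \<longrightarrow> t \<le> b \<longrightarrow> norm (f t - f s) \<le> C * (t - s) powr \<gamma>)"

lemma holder_onD:
  "holder_on \<gamma> C a b f \<Longrightarrow> a \<le> s \<Longrightarrow> s \<le> t \<Longrightarrow> t \<le> b \<Longrightarrow> norm (f t - f s) \<le> C * (t - s) powr \<gamma>"
  by (simp add: holder_on_def)

lemma holder_onD_abs:
  assumes "holder_on \<gamma> C a b f" "s \<in> {a..b}" "t \<in> {a..b}"
  shows "norm (f t - f s) \<le> C * \<bar>t - s\<bar> powr \<gamma>"
  using assms holder_onD[of \<gamma> C a b f s t] holder_onD[of \<gamma> C a b f t s]
  by (cases "s \<le> t") (auto simp: norm_minus_commute)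

lemma holder_on_small:
  fixes C \<gamma> :: real
  assumes "0 < \<gamma>" "0 \<le> C" "0 < e"
  shows "\<exists>d>0. \<forall>h. \<bar>h\<bar> < d \<longrightarrow> C * \<bar>h\<bar> powr \<gamma> < e"
proof (intro exI[of _ "(e / (C + 1)) powr (1 / \<gamma>)"] conjI allI impI)
  fix h :: real assume h: "\<bar>h\<bar> < (e / (C + 1)) powr (1 / \<gamma>)"
  have "\<bar>h\<bar> powr \<gamma> < ((e / (C + 1)) powr (1 / \<gamma>)) powr \<gamma>"
    using h assms by (intro powr_less_mono2) auto
  also have "\<dots> = e / (C + 1)" using assms by (simp add: powr_powr)
  finally have "C * \<bar>h\<bar> powr \<gamma> \<le> C * (e / (C + 1))"
    using assms by (intro mult_left_mono) auto
  also have "\<dots> < e" using assms by (simp add: field_simps)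
  finally show "C * \<bar>h\<bar> powr \<gamma> < e" .
qed (use assms in auto)

lemma holder_on_imp_continuous_on:
  assumes "holder_on \<gamma> C a b f" "0 < \<gamma>" "0 \<le> C"
  shows "continuous_on {a..b} f"
  unfolding continuous_on_iff
proof (intro ballI allI impI)
  fix s e assume s: "s \<in> {a..b}" and "0 < (e::real)"
  then obtain d where d: "d > 0" "\<And>h. \<bar>h\<bar> < d \<Longrightarrow> C * \<bar>h\<bar> powr \<gamma> < e"
    using holder_on_small[OF assms(2,3)] by blast
  have "dist (f t) (f s) < e" if "t \<in> {a..b}" "dist t s < d" for t
    using holder_onD_abs[OF assms(1) s that(1)] d(2)[of "t - s"] that
    by (simp add: dist_norm)
  then show "\<exists>d>0. \<forall>x'\<in>{a..b}. dist x' s < d \<longrightarrow> dist (f x') (f s) < e" using d(1) by blast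
qed

text \<open>A common Hoelder constant gives equicontinuity and, with the bound at \<open>a\<close>,
  uniform boundedness, so Arzela-Ascoli applies; the Hoelder inequality passes to the limit
  pointwise. All limit objects below arise from here: primitives, points of compact balls, and fixed
  points of the Picard map.\<close>

lemma holder_on_compactness:
  fixes F :: "nat \<Rightarrow> real \<Rightarrow> 'b::euclidean_space"
  assumes "0 < \<gamma>" "0 \<le> C" "\<And>n. holder_on \<gamma> C a b (F n)" "\<And>n. norm (F n a) \<le> B" "a \<le> b"
  obtains G k where "strict_mono (k :: nat \<Rightarrow> nat)"
    "uniform_limit {a..b} (\<lambda>n. F (k n)) G sequentially" "holder_on \<gamma> C a b G"
proof -
  have bd: "norm (F n t) \<le> B + C * (b - a) powr \<gamma>" if "t \<in> {a..b}" for n t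
  proof -
    have "norm (F n t) \<le> norm (F n a) + norm (F n t - F n a)" by (metis norm_triangle_sub)
    also have "\<dots> \<le> B + C * (t - a) powr \<gamma>"
      using that by (intro add_mono assms(4) holder_onD[OF assms(3)]) auto
    also have "\<dots> \<le> B + C * (b - a) powr \<gamma>"
      using that assms by (intro add_left_mono mult_left_mono powr_mono2) auto
    finally show ?thesis .
  qed
  have eq: "\<exists>d. 0 < d \<and> (\<forall>n y. y \<in> {a..b} \<and> norm (x - y) < d \<longrightarrow> norm (F n x - F n y) < e)"
    if x: "x \<in> {a..b}" and "0 < e" for x e
  proof -
    obtain d where d: "d > 0" "\<And>h. \<bar>h\<bar> < d \<Longrightarrow> C * \<bar>h\<bar> powr \<gamma> < e"
      using holder_on_small[OF assms(1,2) \<open>0 < e\<close>] by blast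
    have "norm (F n x - F n y) < e" if "y \<in> {a..b}" "norm (x - y) < d" for n y
      using holder_onD_abs[OF assms(3)[of n] that(1) x] d(2)[of "x - y"] that by simp
    then show ?thesis using d(1) by blast
  qed
  obtain G k where "strict_mono (k :: nat \<Rightarrow> nat)"
    and lim: "\<And>e. 0 < e \<Longrightarrow> \<exists>N. \<forall>n x. n \<ge> N \<and> x \<in> {a..b} \<longrightarrow> norm (F (k n) x - G x) < e"
    using Arzela_Ascoli[of "{a..b}" F "B + C * (b - a) powr \<gamma>"] bd eq by (metis compact_Icc)
  have ul: "uniform_limit {a..b} (\<lambda>n. F (k n)) G sequentially"
    unfolding uniform_limit_iff eventually_sequentially dist_norm using lim by blast
  have "norm (G t - G s) \<le> C * (t - s) powr \<gamma>" if "a \<le> s" "s \<le> t" "t \<le> b" for s t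
  proof (rule LIMSEQ_le_const2)
    show "(\<lambda>n. norm (F (k n) t - F (k n) s)) \<longlonglongrightarrow> norm (G t - G s)"
      using that by (intro tendsto_norm tendsto_diff tendsto_uniform_limitI[OF ul]) auto
    show "\<exists>N. \<forall>n\<ge>N. norm (F (k n) t - F (k n) s) \<le> C * (t - s) powr \<gamma>"
      using holder_onD[OF assms(3) that] by blast
  qed
  then have "holder_on \<gamma> C a b G" by (simp add: holder_on_def)
  with that \<open>strict_mono k\<close> ul show thesis by blast
qed

text \<open>Steklov averages; by the mean value theorem their increments are increments of \<open>g\<close> itself.\<close>

lemma holder_on_mollify:
  fixes g :: "real \<Rightarrow> real"
  assumes "holder_on \<gamma> C a b g" "0 < \<gamma>" "\<gamma> \<le> 1" "0 \<le> C" "a \<le> b"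
  obtains gn gn' where
    "\<And>n t. t \<in> {a..b} \<Longrightarrow> (gn n has_real_derivative gn' n t) (at t within {a..b})"
    "\<And>n::nat. continuous_on {a..b} (gn' n)"
    "\<And>n. holder_on \<gamma> C a b (gn n)"
    "\<And>t. t \<in> {a..b} \<Longrightarrow> (\<lambda>n. gn n t) \<longlonglongrightarrow> g t"
    "\<And>n t. t \<in> {a..b} \<Longrightarrow> \<bar>gn' n t\<bar> \<le> C * (real n + 1) powr (1 - \<gamma>)"
proof -
  \<comment> \<open>Constant continuation beyond the interval keeps the Hoelder constant and gives
    the averaging windows to the right of \<open>b\<close> a meaning.\<close>
  define G where "G u = g (max a (min u b))" for u
  define h where "h n = 1 / (real n + 1)" for n
  have h: "h n > 0" for n by (simp add: h_def)
  have Gh: "\<bar>G t - G s\<bar> \<le> C * (t - s) powr \<gamma>" if "s \<le> t" for s t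
  proof -
    have "\<bar>G t - G s\<bar> \<le> C * (max a (min t b) - max a (min s b)) powr \<gamma>"
      using holder_onD[OF assms(1), of "max a (min s b)" "max a (min t b)"] that assms(5)
      by (auto simp: G_def)
    also have "\<dots> \<le> C * (t - s) powr \<gamma>"
      using assms that by (intro mult_left_mono powr_mono2) auto
    finally show ?thesis .
  qed
  have "continuous_on {a..b} g" by (rule holder_on_imp_continuous_on[OF assms(1,2,4)])
  then have contG: "continuous_on S G" for S
    unfolding G_def
    by (rule continuous_on_compose2[of "{a..b}" g]) (use assms(5) in \<open>auto intro!: continuous_on_max continuous_on_min\<close>)
  \<comment> \<open>The base point \<open>a - 1\<close> makes every \<open>t \<ge> a\<close> an
    interior point, so the derivative at \<open>a\<close> is two-sided.\<close>
  define \<Gamma> where "\<Gamma> t = integral {a - 1..t} G" for t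
  have \<Gamma>': "(\<Gamma> has_real_derivative G t) (at t)" if "a \<le> t" for t
  proof -
    have "(\<Gamma> has_vector_derivative G t) (at t within {a - 1..t + 1})"
      unfolding \<Gamma>_def using that by (intro integral_has_vector_derivative contG) auto
    then have "(\<Gamma> has_vector_derivative G t) (at t within {a - 1<..<t + 1})"
      by (rule has_vector_derivative_within_subset) auto
    moreover have "at t within {a - 1<..<t + 1} = at t"
      by (rule at_within_open) (use that in auto)
    ultimately show ?thesis by (simp only: has_real_derivative_iff_has_vector_derivative)
  qed
  define gn where "gn n t = (\<Gamma> (t + h n) - \<Gamma> t) / h n" for n t
  define gn' where "gn' n t = (G (t + h n) - G t) / h n" for n t
  have shift: "((\<lambda>x. \<Gamma> (x + t)) has_real_derivative G (v + t)) (at v)" if "a \<le> v + t" for v t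
    by (rule DERIV_shift[THEN iffD1, OF \<Gamma>'[OF that]])
  \<comment> \<open>The mean value theorem is applied to the difference of two shifts of
    \<open>\<Gamma>\<close>. This yields one \<open>v\<close> common to both points; separate
    applications would lose the increment.\<close>
  have mvt: "\<exists>v. 0 < v \<and> v < h n \<and> gn n t - gn n s = G (v + t) - G (v + s)"
    if "a \<le> s" "a \<le> t" for n s t
  proof -
    have "\<exists>v. v > 0 \<and> v < h n \<and>
        (\<Gamma> (h n + t) - \<Gamma> (h n + s)) - (\<Gamma> (0 + t) - \<Gamma> (0 + s)) = (h n - 0) * (G (v + t) - G (v + s))"
      by (rule MVT2[where f = "\<lambda>v. \<Gamma> (v + t) - \<Gamma> (v + s)", OF h])
        (use that in \<open>intro DERIV_diff shift; simp\<close>)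
    then obtain v where v: "v > 0" "v < h n"
      "(\<Gamma> (h n + t) - \<Gamma> (h n + s)) - (\<Gamma> t - \<Gamma> s) = h n * (G (v + t) - G (v + s))"
      by auto
    have "gn n t - gn n s = ((\<Gamma> (h n + t) - \<Gamma> (h n + s)) - (\<Gamma> t - \<Gamma> s)) / h n"
      unfolding gn_def by (simp add: add.commute flip: diff_divide_distrib)
    also have "\<dots> = G (v + t) - G (v + s)" unfolding v(3) using h[of n] by simp
    finally show ?thesis using v by blast
  qed
  have val: "\<exists>v. 0 < v \<and> v < h n \<and> gn n t = G (t + v)" if "a \<le> t" for n t
  proof -
    have "\<exists>v. v > t \<and> v < t + h n \<and> \<Gamma> (t + h n) - \<Gamma> t = (t + h n - t) * G v"
      by (rule MVT2[where f = \<Gamma>]) (use h[of n] that in \<open>auto intro: \<Gamma>'\<close>)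
    then obtain v where "v > t" "v < t + h n" "\<Gamma> (t + h n) - \<Gamma> t = h n * G v" by auto
    then show ?thesis
      using h[of n] by (intro exI[of _ "v - t"]) (simp add: gn_def)
  qed
  show thesis
  proof (rule that[of gn gn'])
    fix n :: nat and t assume t: "t \<in> {a..b}"
    have "((\<lambda>t. \<Gamma> (t + h n)) has_real_derivative G (t + h n)) (at t)"
      using \<Gamma>'[of "t + h n"] t h[of n] by (simp add: DERIV_shift)
    then have "(gn n has_real_derivative gn' n t) (at t)"
      unfolding gn_def gn'_def using t by (intro DERIV_cdivide DERIV_diff \<Gamma>') auto
    then show "(gn n has_real_derivative gn' n t) (at t within {a..b})"
      by (rule has_field_derivative_at_within)
    \<comment> \<open>At \<open>\<gamma> = 1\<close> the factor depending on \<open>n\<close>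
      disappears; the construction for Lipschitz integrators rests on that case.\<close>
    have "\<bar>gn' n t\<bar> \<le> C * h n powr \<gamma> / h n"
      using Gh[of t "t + h n"] h[of n] by (simp add: gn'_def divide_right_mono)
    also have "\<dots> = C * (real n + 1) powr (1 - \<gamma>)"
      by (simp add: h_def powr_divide powr_diff)
    finally show "\<bar>gn' n t\<bar> \<le> C * (real n + 1) powr (1 - \<gamma>)" .
  next
    show "continuous_on {a..b} (gn' n)" for n
    proof -
      have "continuous_on {a..b} (\<lambda>t. G (t + h n))"
        by (rule continuous_on_compose2[OF contG[of UNIV], of _ "\<lambda>t. t + h n"])
          (auto intro: continuous_on_add continuous_on_const continuous_on_id)
      then show ?thesis
        unfolding gn'_def using h[of n]
        by (intro continuous_on_divide continuous_on_diff continuous_on_const contG) auto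
    qed
  next
    fix n
    have "\<bar>gn n t - gn n s\<bar> \<le> C * (t - s) powr \<gamma>" if st: "a \<le> s" "s \<le> t" for s t
    proof -
      obtain v where "gn n t - gn n s = G (v + t) - G (v + s)" using mvt[of s t n] st by auto
      then show ?thesis using Gh[of "v + s" "v + t"] st by simp
    qed
    then show "holder_on \<gamma> C a b (gn n)" by (auto simp: holder_on_def)
  next
    fix t assume t: "t \<in> {a..b}"
    have "\<bar>gn n t - g t\<bar> \<le> C * h n powr \<gamma>" for n
    proof -
      obtain v where v: "0 < v" "v < h n" "gn n t = G (t + v)" using val[of t n] t by auto
      moreover have "G t = g t" using t by (simp add: G_def)
      moreover have "\<bar>G (t + v) - G t\<bar> \<le> C * v powr \<gamma>" using Gh[of t "t + v"] v by simp
      moreover have "C * v powr \<gamma> \<le> C * h n powr \<gamma>"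
        using v assms by (intro mult_left_mono powr_mono2) auto
      ultimately show ?thesis by simp
    qed
    moreover have "h \<longlonglongrightarrow> 0"
      unfolding h_def using LIMSEQ_inverse_real_of_nat by (simp add: inverse_eq_divide add.commute)
    then have "(\<lambda>n. C * h n powr \<gamma>) \<longlonglongrightarrow> C * 0 powr \<gamma>"
      using assms h by (intro tendsto_intros tendsto_powr') (auto simp: less_imp_le)
    ultimately have "(\<lambda>n. gn n t - g t) \<longlonglongrightarrow> 0"
      by (intro Lim_null_comparison[where g = "\<lambda>n. C * h n powr \<gamma>" and f = "\<lambda>n. gn n t - g t", OF always_eventually]) auto
    then show "(\<lambda>n. gn n t) \<longlonglongrightarrow> g t" by (simp add: LIM_zero_iff)
  qed
qed

section \<open>Primitives against Lipschitz integrators\<close>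

lemma continuous_on_Icc_bounded:
  fixes f :: "real \<Rightarrow> real"
  assumes "continuous_on {a..b} f"
  obtains A where "0 \<le> A" "\<And>u. u \<in> {a..b} \<Longrightarrow> \<bar>f u\<bar> \<le> A"
proof -
  have "bounded (f ` {a..b})"
    by (intro compact_imp_bounded compact_continuous_image assms compact_Icc)
  then obtain A where "0 < A" "\<forall>x\<in>f ` {a..b}. norm x \<le> A" unfolding bounded_pos by blast
  then show thesis using that[of A] by auto
qed

text \<open>By the fundamental theorem \<open>c * (g t - g s)\<close> is the integral of
  \<open>c * g'\<close>, so only \<open>(f - c) * g'\<close> has to be bounded. Taking
  \<open>c = 0\<close> bounds increments of the integral; taking a value of \<open>f\<close> gives
  its first order expansion.\<close>

lemma integral_mult_increment:
  fixes f g' :: "real \<Rightarrow> real"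
  assumes f: "continuous_on {a..b} f" and g': "continuous_on {a..b} g'"
    and der: "\<And>t. t \<in> {a..b} \<Longrightarrow> (g has_real_derivative g' t) (at t within {a..b})"
    and st: "a \<le> s" "s \<le> t" "t \<le> b"
    and bd: "\<And>u. s \<le> u \<Longrightarrow> u \<le> t \<Longrightarrow> \<bar>f u - c\<bar> * \<bar>g' u\<bar> \<le> B"
  shows "\<bar>integral {a..t} (\<lambda>u. f u * g' u) - integral {a..s} (\<lambda>u. f u * g' u) - c * (g t - g s)\<bar> \<le> B * (t - s)"
proof -
  have int: "(\<lambda>u. f u * g' u) integrable_on {c..d}" if "a \<le> c" "d \<le> b" for c d
    by (intro integrable_continuous_interval continuous_on_mult
        continuous_on_subset[OF f] continuous_on_subset[OF g']) (use that in auto)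
  have 1: "integral {a..t} (\<lambda>u. f u * g' u) = integral {a..s} (\<lambda>u. f u * g' u) + integral {s..t} (\<lambda>u. f u * g' u)"
    by (rule Henstock_Kurzweil_Integration.integral_combine[symmetric]) (use st int in auto)
  have "(g' has_integral (g t - g s)) {s..t}"
  proof (rule fundamental_theorem_of_calculus)
    fix u assume "u \<in> {s..t}"
    then show "(g has_vector_derivative g' u) (at u within {s..t})"
      using der[of u] st has_field_derivative_subset[of g "g' u" u "{a..b}" "{s..t}"]
      by (auto simp: has_real_derivative_iff_has_vector_derivative)
  qed (use st in simp)
  from has_integral_diff[OF integrable_integral[OF int[of s t]] has_integral_mult_right[OF this, of c]]
  have 2: "((\<lambda>u. (f u - c) * g' u) has_integral
      (integral {s..t} (\<lambda>u. f u * g' u) - c * (g t - g s))) {s..t}"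
    using st by (simp add: left_diff_distrib)
  have "norm (integral {s..t} (\<lambda>u. f u * g' u) - c * (g t - g s)) \<le> B * measure lborel (cbox s t)"
  proof (rule has_integral_bound)
    show "0 \<le> B" using bd[of s] st by (meson abs_ge_zero mult_nonneg_nonneg order_refl order_trans)
    show "((\<lambda>u. (f u - c) * g' u) has_integral
      (integral {s..t} (\<lambda>u. f u * g' u) - c * (g t - g s))) (cbox s t)" using 2 by simp
    show "norm ((f u - c) * g' u) \<le> B" if "u \<in> cbox s t" for u
      using bd[of u] that by (simp add: abs_mult)
  qed
  then show ?thesis using 1 st by simp
qed

text \<open>The hypothesis refers to the deviation of \<open>f\<close> from a constant and to no
  derivative of \<open>g\<close>, so it survives limits in \<open>I\<close> and \<open>g\<close>.
  Uniform continuity of \<open>f\<close> makes the deviation small on short intervals.\<close>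

lemma rs_primitive_of_oscillation:
  fixes f g I :: "real \<Rightarrow> real"
  assumes f: "continuous_on {a..b} f" and "0 \<le> L"
    and inc: "\<And>s t c B. a \<le> s \<Longrightarrow> s \<le> t \<Longrightarrow> t \<le> b \<Longrightarrow>
      (\<And>u. s \<le> u \<Longrightarrow> u \<le> t \<Longrightarrow> \<bar>f u - c\<bar> \<le> B) \<Longrightarrow> \<bar>I t - I s - c * (g t - g s)\<bar> \<le> B * L * (t - s)"
  shows "rs_primitive f g I a b"
  unfolding rs_primitive_def
proof (intro allI impI)
  fix \<epsilon> :: real assume "\<epsilon> > 0"
  then have "\<epsilon> / (L + 1) > 0" using \<open>0 \<le> L\<close> by simp
  moreover have "uniformly_continuous_on {a..b} f" using f by (rule compact_uniformly_continuous) simp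
  ultimately obtain d where d: "d > 0"
    "\<And>x x'. x \<in> {a..b} \<Longrightarrow> x' \<in> {a..b} \<Longrightarrow> dist x' x < d \<Longrightarrow> dist (f x') (f x) < \<epsilon> / (L + 1)"
    unfolding uniformly_continuous_on_def by meson
  have "\<bar>I t - I s - f \<xi> * (g t - g s)\<bar> \<le> \<epsilon> * (t - s)"
    if st: "a \<le> s" "s \<le> \<xi>" "\<xi> \<le> t" "t \<le> b" "t - s < d" for s \<xi> t
  proof -
    have "\<bar>I t - I s - f \<xi> * (g t - g s)\<bar> \<le> \<epsilon> / (L + 1) * L * (t - s)"
    proof (rule inc)
      fix u assume u: "s \<le> u" "u \<le> t"
      have "dist u \<xi> < d" using u st by (simp add: dist_real_def abs_less_iff)
      then show "\<bar>f u - f \<xi>\<bar> \<le> \<epsilon> / (L + 1)"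
        using d(2)[of \<xi> u] u st by (simp add: dist_real_def)
    qed (use st in auto)
    also have "\<dots> \<le> \<epsilon> * (t - s)"
      using \<open>\<epsilon> > 0\<close> \<open>0 \<le> L\<close> st by (intro mult_right_mono) (auto simp: field_simps)
    finally show ?thesis .
  qed
  then show "\<exists>\<delta>>0. \<forall>s \<xi> t. a \<le> s \<longrightarrow> s \<le> \<xi> \<longrightarrow> \<xi> \<le> t \<longrightarrow> t \<le> b \<longrightarrow> t - s < \<delta> \<longrightarrow>
      \<bar>I t - I s - f \<xi> * (g t - g s)\<bar> \<le> \<epsilon> * (t - s)" using d(1) by blast
qed

text \<open>For the Steklov averages of \<open>g\<close> the integrals of \<open>f * gn'\<close> are
  Lipschitz with the common constant \<open>A * L\<close>, so a subsequence converges uniformly, and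
  the oscillation estimate is inherited by the limit.\<close>

lemma rs_primitive_Lipschitz_exists:
  fixes f g :: "real \<Rightarrow> real"
  assumes f: "continuous_on {a..b} f" and g: "holder_on 1 L a b g" and "0 \<le> L" "a \<le> b"
  obtains I where "rs_primitive f g I a b"
proof -
  obtain gn gn' where
    der: "\<And>n t. t \<in> {a..b} \<Longrightarrow> (gn n has_real_derivative gn' n t) (at t within {a..b})"
    and cont: "\<And>n::nat. continuous_on {a..b} (gn' n)"
    and lim: "\<And>t. t \<in> {a..b} \<Longrightarrow> (\<lambda>n. gn n t) \<longlonglongrightarrow> g t"
    and bd': "\<And>n t. t \<in> {a..b} \<Longrightarrow> \<bar>gn' n t\<bar> \<le> L * (real n + 1) powr (1 - 1)"
    by (rule holder_on_mollify[OF g]) (use assms in auto)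
  have bd: "\<bar>gn' n t\<bar> \<le> L" if "t \<in> {a..b}" for n t using bd'[OF that, of n] by simp
  define In where "In n t = integral {a..t} (\<lambda>u. f u * gn' n u)" for n t
  obtain A where A0: "0 \<le> A" and A: "\<And>u. u \<in> {a..b} \<Longrightarrow> \<bar>f u\<bar> \<le> A"
    using continuous_on_Icc_bounded[OF f] by blast
  have inc: "\<bar>In n t - In n s - c * (gn n t - gn n s)\<bar> \<le> B * L * (t - s)"
    if "a \<le> s" "s \<le> t" "t \<le> b" and "\<And>u. s \<le> u \<Longrightarrow> u \<le> t \<Longrightarrow> \<bar>f u - c\<bar> \<le> B" for n s t c B
    unfolding In_def
  proof (rule integral_mult_increment[OF f cont der that(1-3)])
    fix u assume u: "s \<le> u" "u \<le> t"
    have "0 \<le> B" using that(4)[OF u] by linarith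
    then show "\<bar>f u - c\<bar> * \<bar>gn' n u\<bar> \<le> B * L"
      using that u by (intro mult_mono bd) auto
  qed
  have hol: "holder_on 1 (A * L) a b (In n)" for n
    unfolding holder_on_def
  proof (intro allI impI)
    fix s t assume st: "a \<le> s" "s \<le> t" "t \<le> b"
    show "norm (In n t - In n s) \<le> A * L * (t - s) powr 1"
      using inc[OF st, of 0 A n] A st by simp
  qed
  obtain I k where k: "strict_mono (k :: nat \<Rightarrow> nat)"
    and ul: "uniform_limit {a..b} (\<lambda>n. In (k n)) I sequentially"
    by (rule holder_on_compactness[OF _ _ hol, where B = 0]) (use assms A0 in \<open>auto simp: In_def\<close>)
  have limI: "(\<lambda>n. In (k n) t) \<longlonglongrightarrow> I t" if "t \<in> {a..b}" for t
    by (rule tendsto_uniform_limitI[OF ul that])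
  have limg: "(\<lambda>n. gn (k n) t) \<longlonglongrightarrow> g t" if "t \<in> {a..b}" for t
    using LIMSEQ_subseq_LIMSEQ[OF lim[OF that] k] by (simp add: o_def)
  have incI: "\<bar>I t - I s - c * (g t - g s)\<bar> \<le> B * L * (t - s)"
    if "a \<le> s" "s \<le> t" "t \<le> b" and "\<And>u. s \<le> u \<Longrightarrow> u \<le> t \<Longrightarrow> \<bar>f u - c\<bar> \<le> B" for s t c B
  proof (rule LIMSEQ_le_const2)
    show "(\<lambda>n. \<bar>In (k n) t - In (k n) s - c * (gn (k n) t - gn (k n) s)\<bar>) \<longlonglongrightarrow> \<bar>I t - I s - c * (g t - g s)\<bar>"
      using that by (intro tendsto_intros limI limg) auto
  qed (use inc[OF that] in blast)
  have "rs_primitive f g I a b" by (rule rs_primitive_of_oscillation[OF f \<open>0 \<le> L\<close> incI])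
  then show thesis by (rule that)
qed

section \<open>Young primitives by sewing\<close>

lemma powr_double: "(x::real) powr (2 * a) = x powr a * x powr a"
  by (simp flip: powr_add)

text \<open>
  The sewing estimate: bisect until the pieces have length below \<open>\<delta>\<close>. The linear error \<open>\<epsilon> (t - s)\<close>
  is preserved by bisection, and the geometric series in \<open>2 powr (1 - \<theta>)\<close> sums the defects.
\<close>

lemma sewing_estimate:
  fixes R :: "real \<Rightarrow> real \<Rightarrow> real"
  assumes "1 < \<theta>" "0 \<le> K"
    and sub: "\<And>s t. a \<le> s \<Longrightarrow> s \<le> t \<Longrightarrow> t \<le> b \<Longrightarrow>
      \<bar>R s t\<bar> \<le> \<bar>R s ((s + t) / 2)\<bar> + \<bar>R ((s + t) / 2) t\<bar> + K * (t - s) powr \<theta>"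
    and small: "\<And>\<epsilon>. \<epsilon> > 0 \<Longrightarrow> \<exists>\<delta>>0. \<forall>s t. a \<le> s \<longrightarrow> s \<le> t \<longrightarrow> t \<le> b \<longrightarrow> t - s < \<delta> \<longrightarrow> \<bar>R s t\<bar> \<le> \<epsilon> * (t - s)"
    and "a \<le> s" "s \<le> t" "t \<le> b"
  shows "\<bar>R s t\<bar> \<le> K / (1 - 2 powr (1 - \<theta>)) * (t - s) powr \<theta>"
proof (rule field_le_epsilon)
  define A where "A = K / (1 - 2 powr (1 - \<theta>))"
  have q: "2 powr (1 - \<theta>) < 1" using powr_less_mono[of "1 - \<theta>" 0 2] assms(1) by simp
  have A0: "0 \<le> A" using q assms(2) by (simp add: A_def)
  \<comment> \<open>\<open>A\<close> is the fixed point of one bisection: two halves of an error of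
    order \<open>\<theta>\<close> retain the fraction \<open>2 powr (1 - \<theta>)\<close>, and the
    defect \<open>K\<close> makes up exactly for the loss.\<close>
  have AK: "A * 2 powr (1 - \<theta>) + K = A"
  proof -
    have "A * (1 - 2 powr (1 - \<theta>)) = K" using assms(1) by (simp add: A_def)
    then show ?thesis by (simp add: algebra_simps)
  qed
  fix e :: real assume "e > 0"
  define \<epsilon> where "\<epsilon> = e / (b - a + 1)"
  have ba: "a \<le> b" using assms by linarith
  have "\<epsilon> > 0" using \<open>e > 0\<close> ba by (simp add: \<epsilon>_def)
  obtain \<delta> where \<delta>: "\<delta> > 0"
    "\<And>s t. a \<le> s \<Longrightarrow> s \<le> t \<Longrightarrow> t \<le> b \<Longrightarrow> t - s < \<delta> \<Longrightarrow> \<bar>R s t\<bar> \<le> \<epsilon> * (t - s)"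
    using small[OF \<open>\<epsilon> > 0\<close>] by blast
  have main: "\<bar>R s t\<bar> \<le> \<epsilon> * (t - s) + A * (t - s) powr \<theta>"
    if "a \<le> s" "s \<le> t" "t \<le> b" "t - s < \<delta> * 2 ^ k" for k s t
    using that
  proof (induction k arbitrary: s t)
    case 0
    then have "\<bar>R s t\<bar> \<le> \<epsilon> * (t - s)" by (intro \<delta>(2)) auto
    moreover have "0 \<le> A * (t - s) powr \<theta>" using A0 by simp
    ultimately show ?case by linarith
  next
    case (Suc k)
    define u where "u = (s + t) / 2"
    have u: "u - s = (t - s) / 2" "t - u = (t - s) / 2" by (auto simp: u_def field_simps)
    have l: "\<bar>R s u\<bar> \<le> \<epsilon> * (u - s) + A * (u - s) powr \<theta>"
      using Suc.prems by (intro Suc.IH) (auto simp: u_def field_simps)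
    have r: "\<bar>R u t\<bar> \<le> \<epsilon> * (t - u) + A * (t - u) powr \<theta>"
      using Suc.prems by (intro Suc.IH) (auto simp: u_def field_simps)
    have half: "((t - s) / 2) powr \<theta> * 2 = 2 powr (1 - \<theta>) * (t - s) powr \<theta>"
      using Suc.prems by (simp add: powr_divide powr_diff)
    have "\<bar>R s t\<bar> \<le> \<epsilon> * (t - s) + A * (((t - s) / 2) powr \<theta> * 2) + K * (t - s) powr \<theta>"
      using sub[OF Suc.prems(1-3)] l r unfolding u u_def[symmetric]
      by (simp only: times_divide_eq_right mult_2_right distrib_left)
    also have "\<dots> = \<epsilon> * (t - s) + (A * 2 powr (1 - \<theta>) + K) * (t - s) powr \<theta>"
      unfolding half by (simp add: algebra_simps)
    finally show ?case unfolding AK .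
  qed
  obtain k :: nat where "(t - s) / \<delta> < 2 ^ k" using real_arch_pow[of 2 "(t - s) / \<delta>"] by auto
  then have "t - s < \<delta> * 2 ^ k" using \<delta>(1) by (simp add: field_simps)
  then have "\<bar>R s t\<bar> \<le> \<epsilon> * (t - s) + A * (t - s) powr \<theta>" by (intro main assms)
  moreover have "\<epsilon> * (t - s) \<le> \<epsilon> * (b - a + 1)"
    using \<open>\<epsilon> > 0\<close> assms by (intro mult_left_mono) auto
  moreover have "\<epsilon> * (b - a + 1) = e" using ba by (simp add: \<epsilon>_def)
  ultimately show "\<bar>R s t\<bar> \<le> K / (1 - 2 powr (1 - \<theta>)) * (t - s) powr \<theta> + e"
    unfolding A_def by linarith
qed

text \<open>Smoothness of \<open>g\<close> serves to make the remainder \<open>R\<close> of size o(t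
  - s), as sewing requires. The resulting constant contains only the Hoelder constants of
  \<open>f\<close> and \<open>g\<close>, not \<open>g'\<close>, and so survives removal of the
  mollification.\<close>

lemma young_estimate_smooth:
  fixes f g :: "real \<Rightarrow> real"
  assumes f: "holder_on \<alpha> A a b f" and g: "holder_on \<alpha> C a b g" and "1/2 < \<alpha>" "0 \<le> A" "0 \<le> C" "a \<le> b"
    and der: "\<And>t. t \<in> {a..b} \<Longrightarrow> (g has_real_derivative g' t) (at t within {a..b})"
    and g': "continuous_on {a..b} g'"
    and "a \<le> s" "s \<le> t" "t \<le> b"
  shows "\<bar>integral {a..t} (\<lambda>u. f u * g' u) - integral {a..s} (\<lambda>u. f u * g' u) - f s * (g t - g s)\<bar>
    \<le> A * C / (1 - 2 powr (1 - 2 * \<alpha>)) * (t - s) powr (2 * \<alpha>)"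
proof -
  define I where "I t = integral {a..t} (\<lambda>u. f u * g' u)" for t
  have contf: "continuous_on {a..b} f"
    by (rule holder_on_imp_continuous_on[OF f]) (use assms in auto)
  obtain D where D0: "0 \<le> D" and D: "\<And>u. u \<in> {a..b} \<Longrightarrow> \<bar>g' u\<bar> \<le> D"
    using continuous_on_Icc_bounded[OF g'] by blast
  define R where "R s t = I t - I s - f s * (g t - g s)" for s t
  have "\<bar>R s t\<bar> \<le> A * C / (1 - 2 powr (1 - 2 * \<alpha>)) * (t - s) powr (2 * \<alpha>)"
  proof (rule sewing_estimate)
    fix s t assume st: "a \<le> s" "s \<le> t" "t \<le> b"
    define u where "u = (s + t) / 2"
    have u: "s \<le> u" "u \<le> t" using st by (auto simp: u_def)
    \<comment> \<open>The failure of \<open>R\<close> to be additive at \<open>u\<close> is a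
      product of two \<alpha>-Hoelder increments, hence of order \<open>2 * \<alpha>\<close>, which
      exceeds 1.\<close>
    have "R s t = R s u + R u t + (f u - f s) * (g t - g u)"
      by (simp add: R_def algebra_simps)
    moreover have "\<bar>(f u - f s) * (g t - g u)\<bar> \<le> A * (u - s) powr \<alpha> * (C * (t - u) powr \<alpha>)"
      unfolding abs_mult using holder_onD[OF f, of s u] holder_onD[OF g, of u t] st u \<open>0 \<le> A\<close>
      by (intro mult_mono) auto
    moreover have "\<dots> \<le> A * (t - s) powr \<alpha> * (C * (t - s) powr \<alpha>)"
      by (rule mult_mono[OF mult_left_mono[OF powr_mono2] mult_left_mono[OF powr_mono2]])
        (use st u assms in auto)
    moreover have "\<dots> = A * C * (t - s) powr (2 * \<alpha>)"
      by (simp add: powr_double)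
    ultimately show "\<bar>R s t\<bar> \<le> \<bar>R s ((s + t) / 2)\<bar> + \<bar>R ((s + t) / 2) t\<bar> + A * C * (t - s) powr (2 * \<alpha>)"
      unfolding u_def[symmetric] by linarith
  next
    fix \<epsilon> :: real assume "\<epsilon> > 0"
    then have "\<epsilon> / (D + 1) > 0" using D0 by simp
    then obtain \<delta> where \<delta>: "\<delta> > 0" "\<And>h. \<bar>h\<bar> < \<delta> \<Longrightarrow> A * \<bar>h\<bar> powr \<alpha> < \<epsilon> / (D + 1)"
      using holder_on_small[of \<alpha> A "\<epsilon> / (D + 1)"] assms by auto
    have "\<bar>R s t\<bar> \<le> \<epsilon> * (t - s)" if st: "a \<le> s" "s \<le> t" "t \<le> b" "t - s < \<delta>" for s t
    proof -
      have "\<bar>R s t\<bar> \<le> \<epsilon> / (D + 1) * D * (t - s)"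
        unfolding R_def I_def
      proof (rule integral_mult_increment[OF contf g' der st(1-3)])
        fix u assume u: "s \<le> u" "u \<le> t"
        have "\<bar>f u - f s\<bar> \<le> A * \<bar>u - s\<bar> powr \<alpha>" using holder_onD[OF f, of s u] st u by simp
        also have "\<dots> < \<epsilon> / (D + 1)" using \<delta>(2)[of "u - s"] u st by auto
        finally show "\<bar>f u - f s\<bar> * \<bar>g' u\<bar> \<le> \<epsilon> / (D + 1) * D"
          using st u D0 \<open>\<epsilon> > 0\<close> by (intro mult_mono D) auto
      qed
      also have "\<dots> \<le> \<epsilon> * (t - s)"
        using \<open>\<epsilon> > 0\<close> D0 st by (intro mult_right_mono) (auto simp: field_simps)
      finally show ?thesis .
    qed
    then show "\<exists>\<delta>>0. \<forall>s t. a \<le> s \<longrightarrow> s \<le> t \<longrightarrow> t \<le> b \<longrightarrow> t - s < \<delta> \<longrightarrow> \<bar>R s t\<bar> \<le> \<epsilon> * (t - s)"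
      using \<delta>(1) by blast
  qed (use assms in auto)
  then show ?thesis by (simp add: R_def I_def)
qed

lemma holder_on_of_expansion:
  fixes f g I :: "real \<Rightarrow> real"
  assumes g: "holder_on \<alpha> C a b g" and M: "\<And>u. u \<in> {a..b} \<Longrightarrow> \<bar>f u\<bar> \<le> M"
    and "0 \<le> M" "0 \<le> K" "0 \<le> \<alpha>"
    and exp: "\<And>s t. a \<le> s \<Longrightarrow> s \<le> t \<Longrightarrow> t \<le> b \<Longrightarrow>
      \<bar>I t - I s - f s * (g t - g s)\<bar> \<le> K * (t - s) powr (2 * \<alpha>)"
  shows "holder_on \<alpha> (M * C + K * (b - a) powr \<alpha>) a b I"
  unfolding holder_on_def
proof (intro allI impI)
  fix s t assume st: "a \<le> s" "s \<le> t" "t \<le> b"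
  have "\<bar>f s * (g t - g s)\<bar> \<le> M * (C * (t - s) powr \<alpha>)"
    unfolding abs_mult using M[of s] \<open>0 \<le> M\<close> holder_onD[OF g st] st by (intro mult_mono) auto
  moreover have "K * (t - s) powr (2 * \<alpha>) \<le> K * (b - a) powr \<alpha> * (t - s) powr \<alpha>"
    unfolding powr_double mult.assoc
    by (rule mult_left_mono[OF mult_right_mono[OF powr_mono2]]) (use st assms in auto)
  ultimately show "norm (I t - I s) \<le> (M * C + K * (b - a) powr \<alpha>) * (t - s) powr \<alpha>"
    using exp[OF st] unfolding distrib_right real_norm_def by linarith
qed

text \<open>The expansions for the mollified integrators have constants independent of
  \<open>n\<close>; they make the integrals equi-Hoelder, and a uniform limit along a subsequence
  inherits the expansion.\<close>

lemma young_primitive_exists: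
  fixes f g :: "real \<Rightarrow> real"
  assumes f: "holder_on \<alpha> A a b f" and g: "holder_on \<alpha> C a b g"
    and "1/2 < \<alpha>" "\<alpha> \<le> 1" "0 \<le> A" "0 \<le> C" "a \<le> b"
  obtains I K where "0 \<le> K" "\<And>s t. a \<le> s \<Longrightarrow> s \<le> t \<Longrightarrow> t \<le> b \<Longrightarrow>
    \<bar>I t - I s - f s * (g t - g s)\<bar> \<le> K * (t - s) powr (2 * \<alpha>)"
proof -
  define K where "K = A * C / (1 - 2 powr (1 - 2 * \<alpha>))"
  have "2 powr (1 - 2 * \<alpha>) < (1::real)" using powr_less_mono[of "1 - 2 * \<alpha>" 0 2] assms by simp
  then have K0: "0 \<le> K" using assms by (simp add: K_def)
  obtain gn gn' where
    der: "\<And>n t. t \<in> {a..b} \<Longrightarrow> (gn n has_real_derivative gn' n t) (at t within {a..b})"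
    and cont: "\<And>n::nat. continuous_on {a..b} (gn' n)"
    and hol: "\<And>n. holder_on \<alpha> C a b (gn n)"
    and lim: "\<And>t. t \<in> {a..b} \<Longrightarrow> (\<lambda>n. gn n t) \<longlonglongrightarrow> g t"
    by (rule holder_on_mollify[OF g]) (use assms in auto)
  define In where "In n t = integral {a..t} (\<lambda>u. f u * gn' n u)" for n t
  have inc: "\<bar>In n t - In n s - f s * (gn n t - gn n s)\<bar> \<le> K * (t - s) powr (2 * \<alpha>)"
    if "a \<le> s" "s \<le> t" "t \<le> b" for n s t
    unfolding In_def K_def
    by (rule young_estimate_smooth[OF f hol _ _ _ _ der cont that]) (use assms in auto)
  have contf: "continuous_on {a..b} f"
    by (rule holder_on_imp_continuous_on[OF f]) (use assms in auto)
  obtain M where M0: "0 \<le> M" and M: "\<And>u. u \<in> {a..b} \<Longrightarrow> \<bar>f u\<bar> \<le> M"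
    using continuous_on_Icc_bounded[OF contf] by blast
  have "holder_on \<alpha> (M * C + K * (b - a) powr \<alpha>) a b (In n)" for n
    by (rule holder_on_of_expansion[OF hol M M0 K0 _ inc]) (use assms in auto)
  then obtain I k where k: "strict_mono (k :: nat \<Rightarrow> nat)"
    and ul: "uniform_limit {a..b} (\<lambda>n. In (k n)) I sequentially"
    by (rule holder_on_compactness[where F = In and a = a and b = b and B = 0, rotated 2])
      (use assms M0 K0 in \<open>auto simp: In_def\<close>)
  have limI: "(\<lambda>n. In (k n) t) \<longlonglongrightarrow> I t" if "t \<in> {a..b}" for t
    by (rule tendsto_uniform_limitI[OF ul that])
  have limg: "(\<lambda>n. gn (k n) t) \<longlonglongrightarrow> g t" if "t \<in> {a..b}" for t
    using LIMSEQ_subseq_LIMSEQ[OF lim[OF that] k] by (simp add: o_def)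
  have "\<bar>I t - I s - f s * (g t - g s)\<bar> \<le> K * (t - s) powr (2 * \<alpha>)"
    if "a \<le> s" "s \<le> t" "t \<le> b" for s t
  proof (rule LIMSEQ_le_const2)
    show "(\<lambda>n. \<bar>In (k n) t - In (k n) s - f s * (gn (k n) t - gn (k n) s)\<bar>) \<longlonglongrightarrow> \<bar>I t - I s - f s * (g t - g s)\<bar>"
      using that by (intro tendsto_intros limI limg) auto
  qed (use inc[OF that] in blast)
  with K0 show thesis by (rule that)
qed

text \<open>Moving the tag from \<open>s\<close> to an inner point costs another product of two
  \<alpha>-Hoelder increments, again of order \<open>2 * \<alpha> > 1\<close>.\<close>

lemma rs_primitive_of_expansion:
  fixes f g I :: "real \<Rightarrow> real"
  assumes f: "holder_on \<alpha> A a b f" and g: "holder_on \<alpha> C a b g"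
    and "1/2 < \<alpha>" "0 \<le> A" "0 \<le> C" "0 \<le> K"
    and exp: "\<And>s t. a \<le> s \<Longrightarrow> s \<le> t \<Longrightarrow> t \<le> b \<Longrightarrow>
      \<bar>I t - I s - f s * (g t - g s)\<bar> \<le> K * (t - s) powr (2 * \<alpha>)"
  shows "rs_primitive f g I a b"
proof (rule rs_primitive_superlinear[of "2 * \<alpha>" "K + A * C"])
  fix s \<xi> t assume st: "a \<le> s" "s \<le> \<xi>" "\<xi> \<le> t" "t \<le> b"
  have "\<bar>(f \<xi> - f s) * (g t - g s)\<bar> \<le> A * (\<xi> - s) powr \<alpha> * (C * (t - s) powr \<alpha>)"
    unfolding abs_mult using holder_onD[OF f, of s \<xi>] holder_onD[OF g, of s t] st assms
    by (intro mult_mono) auto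
  also have "\<dots> \<le> A * (t - s) powr \<alpha> * (C * (t - s) powr \<alpha>)"
    by (rule mult_right_mono[OF mult_left_mono[OF powr_mono2]]) (use st assms in auto)
  also have "\<dots> = A * C * (t - s) powr (2 * \<alpha>)"
    by (simp add: powr_double)
  finally show "\<bar>I t - I s - f \<xi> * (g t - g s)\<bar> \<le> (K + A * C) * (t - s) powr (2 * \<alpha>)"
    using exp[of s t] st by (simp add: algebra_simps)
qed (use assms in auto)

section \<open>Shuffle algebra and bounded entire maps\<close>

lemma finite_words_of_length [simp]: "finite {w :: 'a::finite list. length w = n}"
  using finite_lists_length_eq[of "UNIV :: 'a set" n] by simp

lemma word_shuffle_Nil2 [simp]: "word_shuffle u [] = {#u#}"
  by (cases u) auto

lemma length_word_shuffle: "w \<in># word_shuffle u v \<Longrightarrow> length w = length u + length v"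
  by (induction u v arbitrary: w rule: word_shuffle.induct) auto

text \<open>The recursion of \<open>word_shuffle\<close> peels first letters. The same rule for last
  letters makes shuffling commute with reversal, which is needed because signatures are computed on
  reversed words.\<close>

lemma word_shuffle_snoc:
  "word_shuffle (u @ [i]) (v @ [j]) =
     image_mset (\<lambda>w. w @ [i]) (word_shuffle u (v @ [j])) +
     image_mset (\<lambda>w. w @ [j]) (word_shuffle (u @ [i]) v)"
proof (induction "length u + length v" arbitrary: u v rule: less_induct)
  case less
  show ?case
  proof (cases u)
    case Nil
    show ?thesis
    proof (cases v)
      case (Cons b v')
      then have "word_shuffle ([] @ [i]) (v' @ [j]) =
          image_mset (\<lambda>w. w @ [i]) (word_shuffle [] (v' @ [j])) +
          image_mset (\<lambda>w. w @ [j]) (word_shuffle ([] @ [i]) v')"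
        using Nil by (intro less) auto
      then show ?thesis using Nil Cons by (simp add: multiset.map_comp o_def)
    qed (use Nil in auto)
  next
    case (Cons a u')
    note u = this
    have 1: "word_shuffle (u' @ [i]) (v @ [j]) =
          image_mset (\<lambda>w. w @ [i]) (word_shuffle u' (v @ [j])) +
          image_mset (\<lambda>w. w @ [j]) (word_shuffle (u' @ [i]) v)"
      using u by (intro less) auto
    show ?thesis
    proof (cases v)
      case Nil
      then show ?thesis using u 1 by (simp add: multiset.map_comp o_def)
    next
      case (Cons b v')
      have "word_shuffle (u @ [i]) (v' @ [j]) =
          image_mset (\<lambda>w. w @ [i]) (word_shuffle u (v' @ [j])) +
          image_mset (\<lambda>w. w @ [j]) (word_shuffle (u @ [i]) v')"
        using Cons by (intro less) auto
      then show ?thesis using u Cons 1 by (simp add: multiset.map_comp o_def)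
    qed
  qed
qed

lemma word_shuffle_rev: "word_shuffle (rev u) (rev v) = image_mset rev (word_shuffle u v)"
proof (induction u v rule: word_shuffle.induct)
  case (3 i u j v)
  have "word_shuffle (rev (i # u)) (rev (j # v)) = word_shuffle (rev u @ [i]) (rev v @ [j])" by simp
  also have "\<dots> = image_mset (\<lambda>w. w @ [i]) (word_shuffle (rev u) (rev (j # v))) +
      image_mset (\<lambda>w. w @ [j]) (word_shuffle (rev (i # u)) (rev v))"
    by (subst word_shuffle_snoc) simp
  finally show ?case unfolding 3 by (simp add: multiset.map_comp o_def)
qed auto

lemma sum_mset_image_count:
  assumes "finite W" "set_mset M \<subseteq> W"
  shows "(\<Sum>w\<in>#M. g w) = (\<Sum>w\<in>W. real (count M w) * g w)"
  using assms(2)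
proof (induction M)
  case (add x M)
  have "(\<Sum>w\<in>W. real (count (add_mset x M) w) * g w) =
      (\<Sum>w\<in>W. (if w = x then g w else 0) + real (count M w) * g w)"
    by (intro sum.cong) (auto simp: algebra_simps)
  also have "\<dots> = g x + (\<Sum>w\<in>W. real (count M w) * g w)"
    using add.prems assms(1) by (simp add: sum.distrib)
  finally show ?case using add by simp
qed simp

lemma tensor_pairing_superset:
  assumes "finite W" "{w. b w \<noteq> 0} \<subseteq> W"
  shows "tensor_pairing b g = (\<Sum>w\<in>W. b w * g w)"
  unfolding tensor_pairing_def by (rule sum.mono_neutral_left) (use assms in auto)

text \<open>Both sides of the defining identity are bilinear in the two polynomials, so pairs of
  words suffice; multiplicities turn the multiset sum into a pairing over the finite set
  \<open>W\<close> of all words that occur.\<close>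

lemma group_likeI:
  assumes g1: "g [] = 1" and sh: "\<And>u v. g u * g v = (\<Sum>w\<in>#word_shuffle u v. g w)"
  shows "g \<in> group_like"
  unfolding group_like_def
proof (intro CollectI conjI ballI)
  show "g \<noteq> (\<lambda>w. 0)" using g1 by auto
  fix b c :: "'a list \<Rightarrow> real" assume bc: "b \<in> tensor_polys" "c \<in> tensor_polys"
  define U V where "U = {u. b u \<noteq> 0}" and "V = {v. c v \<noteq> 0}"
  have fin: "finite U" "finite V" using bc by (auto simp: U_def V_def tensor_polys_def)
  define W where "W = (\<Union>u\<in>U. \<Union>v\<in>V. set_mset (word_shuffle u v))"
  have finW: "finite W" using fin by (auto simp: W_def)
  have supp: "{w. tensor_shuffle b c w \<noteq> 0} \<subseteq> W"
  proof
    fix w assume "w \<in> {w. tensor_shuffle b c w \<noteq> 0}"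
    then have "tensor_shuffle b c w \<noteq> 0" by simp
    then obtain u where u: "u \<in> U" "(\<Sum>v\<in>V. b u * c v * real (count (word_shuffle u v) w)) \<noteq> 0"
      unfolding tensor_shuffle_def U_def[symmetric] V_def[symmetric] by (meson sum.neutral)
    then obtain v where "v \<in> V" "b u * c v * real (count (word_shuffle u v) w) \<noteq> 0"
      by (meson sum.neutral)
    then show "w \<in> W" using u(1) unfolding W_def by (auto simp: count_eq_zero_iff)
  qed
  have "tensor_pairing (tensor_shuffle b c) g = (\<Sum>w\<in>W. tensor_shuffle b c w * g w)"
    by (rule tensor_pairing_superset[OF finW supp])
  also have "\<dots> = (\<Sum>w\<in>W. \<Sum>u\<in>U. \<Sum>v\<in>V. b u * c v * (real (count (word_shuffle u v) w) * g w))"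
    by (simp add: tensor_shuffle_def U_def V_def sum_distrib_right mult.assoc)
  also have "\<dots> = (\<Sum>u\<in>U. \<Sum>w\<in>W. \<Sum>v\<in>V. b u * c v * (real (count (word_shuffle u v) w) * g w))"
    by (rule sum.swap)
  also have "\<dots> = (\<Sum>u\<in>U. \<Sum>v\<in>V. \<Sum>w\<in>W. b u * c v * (real (count (word_shuffle u v) w) * g w))"
    by (intro sum.cong refl sum.swap)
  also have "\<dots> = (\<Sum>u\<in>U. \<Sum>v\<in>V. b u * c v * (g u * g v))"
  proof (intro sum.cong refl)
    fix u v assume uv: "u \<in> U" "v \<in> V"
    have "g u * g v = (\<Sum>w\<in>W. real (count (word_shuffle u v) w) * g w)"
      unfolding sh by (rule sum_mset_image_count[OF finW]) (use uv in \<open>auto simp: W_def\<close>)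
    then show "(\<Sum>w\<in>W. b u * c v * (real (count (word_shuffle u v) w) * g w)) = b u * c v * (g u * g v)"
      by (simp add: sum_distrib_left)
  qed
  also have "\<dots> = (\<Sum>u\<in>U. \<Sum>v\<in>V. (b u * g u) * (c v * g v))" by (simp add: mult_ac)
  also have "\<dots> = tensor_pairing b g * tensor_pairing c g"
    by (simp add: tensor_pairing_def U_def V_def sum_product)
  finally show "tensor_pairing b g * tensor_pairing c g = tensor_pairing (tensor_shuffle b c) g" ..
qed

section \<open>Homogeneous components of series on group-like elements\<close>

definition word_tensor :: "'a list \<Rightarrow> 'a tensor_series" where
  "word_tensor w = (\<lambda>v. if v = w then 1 else 0)"

lemma word_tensor_poly [simp]: "word_tensor w \<in> tensor_polys"
  by (simp add: word_tensor_def tensor_polys_def)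

lemma tensor_pairing_word [simp]: "tensor_pairing (word_tensor w) g = g w"
  by (simp add: word_tensor_def tensor_pairing_def)

lemma group_like_mult:
  "g \<in> group_like \<Longrightarrow> b \<in> tensor_polys \<Longrightarrow> c \<in> tensor_polys \<Longrightarrow>
    tensor_pairing (tensor_shuffle b c) g = tensor_pairing b g * tensor_pairing c g"
  by (simp add: group_like_def)

text \<open>The empty word is the unit of the shuffle product, and some coordinate
  \<open>g w\<close> is nonzero; it is cancelled from \<open>g [] * g w = g w\<close>.\<close>

lemma group_like_Nil [simp]: "g \<in> group_like \<Longrightarrow> g [] = 1"
proof -
  assume g: "g \<in> group_like"
  then obtain w where w: "g w \<noteq> 0" by (auto simp: group_like_def fun_eq_iff)
  have "tensor_shuffle (word_tensor []) (word_tensor w) = word_tensor w"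
    by (auto simp: tensor_shuffle_def word_tensor_def)
  then have "g [] * g w = g w"
    using group_like_mult[OF g word_tensor_poly word_tensor_poly, of "[]" w] by simp
  then show "g [] = 1" using w by simp
qed

definition level :: "nat \<Rightarrow> 'a tensor_series \<Rightarrow> 'a tensor_series" where
  "level n l = (\<lambda>w. if length w = n then l w else 0)"

lemma level_poly [simp]: "level n (l :: 'a::finite tensor_series) \<in> tensor_polys"
  unfolding tensor_polys_def
  by (rule CollectI, rule finite_subset[OF _ finite_words_of_length[of n]]) (auto simp: level_def)

lemma tensor_pairing_homogeneous:
  fixes b :: "'a::finite tensor_series"
  assumes "\<And>w. length w \<noteq> n \<Longrightarrow> b w = 0"
  shows "tensor_pairing b g = level_pairing n b g"
  unfolding level_pairing_def by (rule tensor_pairing_superset) (use assms in auto)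

lemma tensor_pairing_level [simp]:
  "tensor_pairing (level n l) g = level_pairing n (l :: 'a::finite tensor_series) g"
  by (subst tensor_pairing_homogeneous[of n]) (auto simp: level_def level_pairing_def intro: sum.cong)

lemma tensor_shuffle_homogeneous:
  assumes "\<And>w. length w \<noteq> i \<Longrightarrow> b w = 0" "\<And>w. length w \<noteq> j \<Longrightarrow> c w = 0" "length w \<noteq> i + j"
  shows "tensor_shuffle b c w = 0"
  unfolding tensor_shuffle_def
proof (intro sum.neutral ballI)
  fix u v assume "u \<in> {u. b u \<noteq> 0}" "v \<in> {v. c v \<noteq> 0}"
  then have "length u = i" "length v = j" using assms(1,2) by auto
  then have "w \<notin># word_shuffle u v" using length_word_shuffle[of w u v] assms(3) by auto
  then show "b u * c v * real (count (word_shuffle u v) w) = 0" by (simp add: count_eq_zero_iff)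
qed

text \<open>\<open>tensor_shuffle\<close> makes sense only for polynomials, because a sum over an
  infinite support is 0 by default. The product of two series is therefore assembled level by level:
  a word of length \<open>n\<close> receives contributions from levels \<open>i\<close> and
  \<open>n - i\<close> alone.\<close>

definition series_shuffle :: "'a tensor_series \<Rightarrow> 'a tensor_series \<Rightarrow> 'a tensor_series" where
  "series_shuffle b c =
     (\<lambda>w. \<Sum>i\<le>length w. tensor_shuffle (level i b) (level (length w - i) c) w)"

text \<open>On group-like elements shuffling becomes the Cauchy product of level pairings.
  Multiplicativity of entire maps is thereby the product theorem for absolutely convergent
  series.\<close>

lemma level_pairing_shuffle:
  fixes b c :: "'a::finite tensor_series"
  assumes "g \<in> group_like"
  shows "level_pairing n (series_shuffle b c) g = (\<Sum>i\<le>n. level_pairing i b g * level_pairing (n - i) c g)"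
proof -
  have "level_pairing n (series_shuffle b c) g =
      (\<Sum>w | length w = n. \<Sum>i\<le>n. tensor_shuffle (level i b) (level (n - i) c) w * g w)"
    unfolding level_pairing_def series_shuffle_def
    by (intro sum.cong refl) (auto simp: sum_distrib_right)
  also have "\<dots> = (\<Sum>i\<le>n. level_pairing n (tensor_shuffle (level i b) (level (n - i) c)) g)"
    unfolding level_pairing_def by (rule sum.swap)
  also have "\<dots> = (\<Sum>i\<le>n. tensor_pairing (tensor_shuffle (level i b) (level (n - i) c)) g)"
  proof (intro sum.cong refl tensor_pairing_homogeneous[symmetric])
    fix i and w :: "'a list" assume "i \<in> {..n}" "length w \<noteq> n"
    then show "tensor_shuffle (level i b) (level (n - i) c) w = 0"
      by (intro tensor_shuffle_homogeneous[of i _ "n - i"]) (auto simp: level_def)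
  qed
  also have "\<dots> = (\<Sum>i\<le>n. level_pairing i b g * level_pairing (n - i) c g)"
    using assms by (simp add: group_like_mult)
  finally show ?thesis .
qed

section \<open>The algebra of bounded entire maps\<close>

lemma group_like_dual_iff:
  "l \<in> group_like_dual \<longleftrightarrow> (\<forall>g\<in>group_like. summable (\<lambda>n. \<bar>level_pairing n l g\<bar>))"
proof -
  have "gl_abs l g < \<infinity> \<longleftrightarrow> summable (\<lambda>n. \<bar>level_pairing n l g\<bar>)" for g
  proof -
    have "gl_abs l g < \<infinity> \<longleftrightarrow> summable (\<lambda>k. \<bar>level_pairing (Suc k) l g\<bar>)"
    proof
      assume "gl_abs l g < \<infinity>"
      then show "summable (\<lambda>k. \<bar>level_pairing (Suc k) l g\<bar>)"
        unfolding gl_abs_def by (intro summable_suminf_not_top) auto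
    next
      assume "summable (\<lambda>k. \<bar>level_pairing (Suc k) l g\<bar>)"
      then show "gl_abs l g < \<infinity>"
        unfolding gl_abs_def by (subst suminf_ennreal2) auto
    qed
    \<comment> \<open>\<open>gl_abs\<close> starts at level 1; the additional term at level 0 does
      not affect summability.\<close>
    then show ?thesis by (simp add: summable_Suc_iff[of "\<lambda>n. \<bar>level_pairing n l g\<bar>"])
  qed
  then show ?thesis by (auto simp: group_like_dual_def)
qed

lemma bounded_entire_iff:
  "bounded_entire l \<longleftrightarrow> (\<forall>g\<in>group_like. summable (\<lambda>n. \<bar>level_pairing n l g\<bar>)) \<and>
     (\<exists>B. \<forall>g\<in>group_like. \<bar>entire_map l g\<bar> \<le> B)"
  by (auto simp: bounded_entire_def group_like_dual_iff bounded_iff)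

lemma level_pairing_add: "level_pairing n (\<lambda>w. l w + l' w) g = level_pairing n l g + level_pairing n l' g"
  by (simp add: level_pairing_def distrib_right sum.distrib)

lemma bounded_entire_add:
  assumes "bounded_entire l" "bounded_entire l'"
  shows "bounded_entire (\<lambda>w. l w + l' w)"
    and "g \<in> group_like \<Longrightarrow> entire_map (\<lambda>w. l w + l' w) g = entire_map l g + entire_map l' g"
proof -
  have s: "summable (\<lambda>n. \<bar>level_pairing n l g\<bar>)" "summable (\<lambda>n. \<bar>level_pairing n l' g\<bar>)"
    if "g \<in> group_like" for g using assms that by (auto simp: bounded_entire_iff)
  have em: "entire_map (\<lambda>w. l w + l' w) g = entire_map l g + entire_map l' g" if "g \<in> group_like" for g
    unfolding entire_map_def level_pairing_add
    by (rule suminf_add[symmetric]) (use s[OF that] in \<open>auto intro: summable_rabs_cancel\<close>)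
  obtain B B' where "\<forall>g\<in>group_like. \<bar>entire_map l g\<bar> \<le> B" "\<forall>g\<in>group_like. \<bar>entire_map l' g\<bar> \<le> B'"
    using assms by (auto simp: bounded_entire_iff)
  then have "\<forall>g\<in>group_like. \<bar>entire_map (\<lambda>w. l w + l' w) g\<bar> \<le> B + B'"
    using em by (force intro: order_trans[OF abs_triangle_ineq] add_mono)
  moreover have "summable (\<lambda>n. \<bar>level_pairing n (\<lambda>w. l w + l' w) g\<bar>)" if "g \<in> group_like" for g
    unfolding level_pairing_add
    by (rule summable_comparison_test'[OF summable_add[OF s[OF that]]]) auto
  ultimately show "bounded_entire (\<lambda>w. l w + l' w)" unfolding bounded_entire_iff by blast
  show "g \<in> group_like \<Longrightarrow> entire_map (\<lambda>w. l w + l' w) g = entire_map l g + entire_map l' g" by (rule em)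
qed

lemma bounded_entire_shuffle:
  assumes "bounded_entire l" "bounded_entire l'"
  shows "bounded_entire (series_shuffle l l')"
    and "g \<in> group_like \<Longrightarrow> entire_map (series_shuffle l l') g = entire_map l g * entire_map l' g"
proof -
  have s: "summable (\<lambda>n. \<bar>level_pairing n l g\<bar>)" "summable (\<lambda>n. \<bar>level_pairing n l' g\<bar>)"
    if "g \<in> group_like" for g using assms that by (auto simp: bounded_entire_iff)
  have em: "entire_map (series_shuffle l l') g = entire_map l g * entire_map l' g" if "g \<in> group_like" for g
    unfolding entire_map_def level_pairing_shuffle[OF that]
    by (rule Cauchy_product[symmetric]) (use s[OF that] in auto)
  obtain B B' where B: "\<forall>g\<in>group_like. \<bar>entire_map l g\<bar> \<le> B" "\<forall>g\<in>group_like. \<bar>entire_map l' g\<bar> \<le> B'"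
    using assms by (auto simp: bounded_entire_iff)
  have "\<bar>entire_map (series_shuffle l l') g\<bar> \<le> B * B'" if "g \<in> group_like" for g
    unfolding em[OF that] abs_mult
    using B that by (intro mult_mono) (auto intro: order_trans[OF abs_ge_zero])
  moreover have "summable (\<lambda>n. \<bar>level_pairing n (series_shuffle l l') g\<bar>)" if "g \<in> group_like" for g
    unfolding level_pairing_shuffle[OF that]
  proof (rule summable_comparison_test')
    show "summable (\<lambda>n. \<Sum>i\<le>n. \<bar>level_pairing i l g\<bar> * \<bar>level_pairing (n - i) l' g\<bar>)"
      by (rule summable_Cauchy_product) (use s[OF that] in auto)
    show "norm \<bar>\<Sum>i\<le>n. level_pairing i l g * level_pairing (n - i) l' g\<bar>
      \<le> (\<Sum>i\<le>n. \<bar>level_pairing i l g\<bar> * \<bar>level_pairing (n - i) l' g\<bar>)" for n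
      using sum_abs[of "\<lambda>i. level_pairing i l g * level_pairing (n - i) l' g" "{..n}"]
      by (simp add: abs_mult)
  qed
  ultimately show "bounded_entire (series_shuffle l l')" unfolding bounded_entire_iff by blast
  show "g \<in> group_like \<Longrightarrow> entire_map (series_shuffle l l') g = entire_map l g * entire_map l' g" by (rule em)
qed

text \<open>A power series in a coordinate of degree \<open>N\<close> occupies exactly the levels
  \<open>k * N\<close>, with one term each. Summability of the absolute level pairings is then the
  absolute convergence of the power series itself.\<close>

lemma bounded_entire_homogeneous:
  fixes l :: "'a::finite tensor_series"
  assumes N: "0 < N" and lp: "\<And>g n. g \<in> group_like \<Longrightarrow>
      level_pairing n l g = (if N dvd n then c (n div N) * \<phi> g ^ (n div N) else 0)"
    and abs: "\<And>g. g \<in> group_like \<Longrightarrow> summable (\<lambda>k. \<bar>c k * \<phi> g ^ k\<bar>)"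
    and sums: "\<And>g. g \<in> group_like \<Longrightarrow> (\<lambda>k. c k * \<phi> g ^ k) sums F g"
    and bd: "\<And>g. g \<in> group_like \<Longrightarrow> \<bar>F g\<bar> \<le> B"
  shows "bounded_entire l" and "g \<in> group_like \<Longrightarrow> entire_map l g = F g"
proof -
  have mono: "strict_mono (\<lambda>k. k * N)" using N by (auto simp: strict_mono_def)
  have notin: "\<not> N dvd n" if "n \<notin> range (\<lambda>k. k * N)" for n
    using that by (auto simp: dvd_def mult.commute)
  have em: "(\<lambda>n. level_pairing n l g) sums F g" if g: "g \<in> group_like" for g
    by (subst sums_mono_reindex[OF mono, symmetric]) (use notin sums[OF g] N in \<open>auto simp: lp[OF g]\<close>)
  have ab: "summable (\<lambda>n. \<bar>level_pairing n l g\<bar>)" if g: "g \<in> group_like" for g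
    by (subst summable_mono_reindex[OF mono, symmetric])
      (use notin abs[OF g] N in \<open>auto simp: lp[OF g]\<close>)
  have em': "entire_map l g = F g" if "g \<in> group_like" for g
    unfolding entire_map_def using sums_unique[OF em[OF that]] by simp
  show "bounded_entire l" unfolding bounded_entire_iff using ab em' bd by auto
  show "g \<in> group_like \<Longrightarrow> entire_map l g = F g" by (rule em')
qed

lemma bounded_entire_const:
  fixes g :: "'a::finite tensor_series"
  shows "bounded_entire (\<lambda>w :: 'a list. if w = [] then c else 0)"
    and "g \<in> group_like \<Longrightarrow> entire_map (\<lambda>w. if w = [] then c else 0) g = c"
proof -
  have lp: "level_pairing n (\<lambda>w. if w = [] then c else 0) g = (if n = 0 then c else 0)"
    if "g \<in> group_like" for n and g :: "'a tensor_series"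
    using that by (cases n) (auto simp: level_pairing_def intro!: sum.neutral)
  have sm: "(\<lambda>n. if n = 0 then c else 0) sums c" by (rule sums_single)
  have em: "entire_map (\<lambda>w. if w = [] then c else 0) g = c"
    if "g \<in> group_like" for g :: "'a tensor_series"
    unfolding entire_map_def lp[OF that] using sums_unique[OF sm] by simp
  moreover have "summable (\<lambda>n. \<bar>if n = (0::nat) then c else 0\<bar>)"
    by (rule summable_finite[of "{0}"]) auto
  ultimately show "bounded_entire (\<lambda>w :: 'a list. if w = [] then c else 0)"
    unfolding bounded_entire_iff by (auto simp: lp)
  show "g \<in> group_like \<Longrightarrow> entire_map (\<lambda>w. if w = [] then c else 0) g = c" by (rule em)
qed

section \<open>The sine of a word coordinate\<close>

fun word_power :: "'a list \<Rightarrow> nat \<Rightarrow> 'a tensor_series" where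
  "word_power w 0 = word_tensor []"
| "word_power w (Suc k) = tensor_shuffle (word_tensor w) (word_power w k)"

lemma word_power_homogeneous: "length v \<noteq> k * length w \<Longrightarrow> word_power w k v = 0"
proof (induction k arbitrary: v)
  case (Suc k)
  show ?case
    unfolding word_power.simps
    by (rule tensor_shuffle_homogeneous[of "length w" _ "k * length w"])
      (use Suc in \<open>auto simp: word_tensor_def\<close>)
qed (auto simp: word_tensor_def)

lemma word_power_poly [simp]: "word_power (w :: 'a::finite list) k \<in> tensor_polys"
  unfolding tensor_polys_def
  by (rule CollectI, rule finite_subset[OF _ finite_words_of_length[of "k * length w"]])
    (use word_power_homogeneous in blast)

lemma tensor_pairing_word_power:
  "g \<in> group_like \<Longrightarrow> tensor_pairing (word_power (w :: 'a::finite list) k) g = g w ^ k"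
  by (induction k) (simp_all add: group_like_mult)

text \<open>The series of \<open>sin (r g\<^sub>w)\<close>: shuffle powers of a single word are homogeneous, so every level
  contains at most one term of the sine series.\<close>

definition sin_series :: "real \<Rightarrow> 'a list \<Rightarrow> 'a tensor_series" where
  "sin_series r w = (\<lambda>v. let k = length v div length w in sin_coeff k * r ^ k * word_power w k v)"

lemma bounded_entire_sin:
  fixes w :: "'a::finite list"
  assumes "w \<noteq> []"
  shows "bounded_entire (sin_series r w)"
    and "g \<in> group_like \<Longrightarrow> entire_map (sin_series r w) g = sin (r * g w)"
proof -
  have lp: "level_pairing n (sin_series r w) g =
      (if length w dvd n then sin_coeff (n div length w) * r ^ (n div length w) * g w ^ (n div length w) else 0)"
    if g: "g \<in> group_like" for n g
  proof -
    define k where "k = n div length w"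
    have "level_pairing n (sin_series r w) g =
        sin_coeff k * r ^ k * level_pairing n (word_power w k) g"
      by (simp add: level_pairing_def sin_series_def Let_def k_def sum_distrib_left mult.assoc)
    moreover have "level_pairing n (word_power w k) g = (if length w dvd n then g w ^ k else 0)"
    proof (cases "length w dvd n")
      case True
      then have "n = k * length w" by (simp add: k_def)
      then show ?thesis
        using True tensor_pairing_homogeneous[of n "word_power w k" g] word_power_homogeneous[of _ k w]
          tensor_pairing_word_power[OF g, of w k] by simp
    next
      case False
      then have "n \<noteq> k * length w" by auto
      then have "word_power w k v = 0" if "length v = n" for v
        using that word_power_homogeneous[of v k w] by simp
      then show ?thesis using False by (auto simp: level_pairing_def intro: sum.neutral)
    qed
    ultimately show ?thesis by (simp add: k_def)
  qed
  have eq: "sin_coeff k * r ^ k * g w ^ k = sin_coeff k * (r * g w) ^ k" for k and g :: "'a tensor_series"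
    by (simp add: power_mult_distrib)
  have sin: "summable (\<lambda>k. \<bar>sin_coeff k * x ^ k\<bar>)" "(\<lambda>k. sin_coeff k * x ^ k) sums sin x" for x :: real
    using summable_norm_sin[of x] sin_converges[of x] by (simp_all add: abs_mult)
  note * = bounded_entire_homogeneous[of "length w" "sin_series r w" "\<lambda>k. sin_coeff k * r ^ k" "\<lambda>g. g w"
      "\<lambda>g. sin (r * g w)" 1]
  show "bounded_entire (sin_series r w)"
    by (rule *(1)) (use assms lp sin in \<open>auto simp: eq\<close>)
  show "g \<in> group_like \<Longrightarrow> entire_map (sin_series r w) g = sin (r * g w)"
    by (rule *(2)) (use assms lp sin in \<open>auto simp: eq\<close>)
qed

section \<open>Signatures are group-like\<close>

lemma holder_on_seminorm:
  assumes "holder_sup \<gamma> T y < \<infinity>"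
  shows "holder_on \<gamma> (holder_seminorm \<gamma> T y) 0 T y"
  unfolding holder_on_def
proof (intro allI impI)
  fix s t :: real assume "0 \<le> s" "s \<le> t" "t \<le> T"
  then show "norm (y t - y s) \<le> holder_seminorm \<gamma> T y * (t - s) powr \<gamma>"
    using holder_seminorm_bound[of \<gamma> T y s t] assms by (cases "s = t") auto
qed

lemma holder_paths_imp_holder_on:
  "y \<in> holder_paths \<gamma> T \<Longrightarrow> holder_on \<gamma> (holder_seminorm \<gamma> T y) 0 T y"
  by (rule holder_on_seminorm) (simp add: holder_paths_def)

context
  fixes z :: "real \<Rightarrow> real ^ 'a::finite" and \<alpha> T :: real
  assumes \<alpha>: "1/2 < \<alpha>" "\<alpha> \<le> 1" and T: "0 \<le> T"
    and z: "\<And>i. \<exists>C\<ge>0. holder_on \<alpha> C 0 T (\<lambda>s. z s $ i)"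
begin

text \<open>\<open>sig_rev\<close> is specified on a longer word only once the integral is known to
  exist. The Young primitive supplies existence and passes its expansion on; subtracting its value
  at 0 explains the initial condition.\<close>

lemma sig_rev_step:
  assumes "0 \<le> A" "holder_on \<alpha> A 0 T (sig_rev z w)"
  obtains K where "0 \<le> K" "\<And>s t. 0 \<le> s \<Longrightarrow> s \<le> t \<Longrightarrow> t \<le> T \<Longrightarrow>
      \<bar>sig_rev z (i # w) t - sig_rev z (i # w) s - sig_rev z w s * (z t $ i - z s $ i)\<bar> \<le> K * (t - s) powr (2 * \<alpha>)"
    "sig_rev z (i # w) 0 = 0"
proof -
  obtain C where C: "0 \<le> C" "holder_on \<alpha> C 0 T (\<lambda>s. z s $ i)" using z by blast
  obtain I K where K: "0 \<le> K" and I: "\<And>s t. 0 \<le> s \<Longrightarrow> s \<le> t \<Longrightarrow> t \<le> T \<Longrightarrow>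
    \<bar>I t - I s - sig_rev z w s * (z t $ i - z s $ i)\<bar> \<le> K * (t - s) powr (2 * \<alpha>)"
    by (rule young_primitive_exists[OF assms(2) C(2) \<alpha> assms(1) C(1) T]) blast
  have "rs_primitive (sig_rev z w) (\<lambda>s. z s $ i) I 0 T"
    by (rule rs_primitive_of_expansion[OF assms(2) C(2) \<alpha>(1) assms(1) C(1) K I])
  then have eq: "sig_rev z (i # w) t = I t - I 0" if "0 \<le> t" "t \<le> T" for t
    using rs_integral_primitive(2)[of "sig_rev z w" "\<lambda>s. z s $ i" I 0 T 0 t] that by simp
  show thesis
    by (rule that[OF K]) (use I eq T in auto)
qed

text \<open>Every iterated integral is \<alpha>-Hoelder again, with the same exponent, so it can be
  an integrand for the next letter.\<close>

lemma sig_rev_holder: "\<exists>C\<ge>0. holder_on \<alpha> C 0 T (sig_rev z w)"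
proof (induction w)
  case Nil
  then show ?case by (intro exI[of _ 0]) (auto simp: holder_on_def)
next
  case (Cons i w)
  then obtain A where A: "0 \<le> A" "holder_on \<alpha> A 0 T (sig_rev z w)" by blast
  obtain C where C: "0 \<le> C" "holder_on \<alpha> C 0 T (\<lambda>s. z s $ i)" using z by blast
  obtain K where K: "0 \<le> K" "\<And>s t. 0 \<le> s \<Longrightarrow> s \<le> t \<Longrightarrow> t \<le> T \<Longrightarrow>
      \<bar>sig_rev z (i # w) t - sig_rev z (i # w) s - sig_rev z w s * (z t $ i - z s $ i)\<bar> \<le> K * (t - s) powr (2 * \<alpha>)"
    by (rule sig_rev_step[OF A]) blast
  have "continuous_on {0..T} (sig_rev z w)"
    by (rule holder_on_imp_continuous_on[OF A(2) _ A(1)]) (use \<alpha> in simp)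
  then obtain M where M: "0 \<le> M" "\<And>u. u \<in> {0..T} \<Longrightarrow> \<bar>sig_rev z w u\<bar> \<le> M"
    using continuous_on_Icc_bounded by blast
  have "holder_on \<alpha> (M * C + K * (T - 0) powr \<alpha>) 0 T (sig_rev z (i # w))"
    by (rule holder_on_of_expansion[OF C(2) M(2) M(1) K(1) _ K(2)]) (use \<alpha> in auto)
  moreover have "0 \<le> M * C + K * (T - 0) powr \<alpha>" using M C K by simp
  ultimately show ?case by blast
qed

lemma sig_rev_expansion:
  obtains K where "0 \<le> K" "\<And>s t. 0 \<le> s \<Longrightarrow> s \<le> t \<Longrightarrow> t \<le> T \<Longrightarrow>
      \<bar>sig_rev z (i # w) t - sig_rev z (i # w) s - sig_rev z w s * (z t $ i - z s $ i)\<bar> \<le> K * (t - s) powr (2 * \<alpha>)"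
    "sig_rev z (i # w) 0 = 0"
  using sig_rev_holder[of w] sig_rev_step[of _ w i] by blast

lemma sig_rev_0: "w \<noteq> [] \<Longrightarrow> sig_rev z w 0 = 0"
proof (cases w)
  case (Cons i w')
  show ?thesis unfolding Cons by (rule sig_rev_expansion[of i w'])
qed simp

lemma sum_mset_sig_rev_expansion:
  fixes M :: "'a list multiset"
  shows "\<exists>K\<ge>0. \<forall>s t. 0 \<le> s \<longrightarrow> s \<le> t \<longrightarrow> t \<le> T \<longrightarrow>
      \<bar>(\<Sum>w\<in>#M. sig_rev z (i # w) t) - (\<Sum>w\<in>#M. sig_rev z (i # w) s)
        - (\<Sum>w\<in>#M. sig_rev z w s) * (z t $ i - z s $ i)\<bar> \<le> K * (t - s) powr (2 * \<alpha>)"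
proof (induction M)
  case empty
  then show ?case by (intro exI[of _ 0]) auto
next
  case (add w M)
  then obtain K where K: "K \<ge> 0" "\<And>s t. 0 \<le> s \<Longrightarrow> s \<le> t \<Longrightarrow> t \<le> T \<Longrightarrow>
      \<bar>(\<Sum>w\<in>#M. sig_rev z (i # w) t) - (\<Sum>w\<in>#M. sig_rev z (i # w) s)
        - (\<Sum>w\<in>#M. sig_rev z w s) * (z t $ i - z s $ i)\<bar> \<le> K * (t - s) powr (2 * \<alpha>)" by blast
  obtain K' where K': "0 \<le> K'" "\<And>s t. 0 \<le> s \<Longrightarrow> s \<le> t \<Longrightarrow> t \<le> T \<Longrightarrow>
      \<bar>sig_rev z (i # w) t - sig_rev z (i # w) s - sig_rev z w s * (z t $ i - z s $ i)\<bar> \<le> K' * (t - s) powr (2 * \<alpha>)"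
    by (rule sig_rev_expansion[of i w]) blast
  show ?case
  proof (intro exI[of _ "K + K'"] conjI allI impI)
    fix s t assume st: "0 \<le> s" "s \<le> t" "t \<le> T"
    show "\<bar>(\<Sum>w\<in>#add_mset w M. sig_rev z (i # w) t) - (\<Sum>w\<in>#add_mset w M. sig_rev z (i # w) s)
        - (\<Sum>w\<in>#add_mset w M. sig_rev z w s) * (z t $ i - z s $ i)\<bar> \<le> (K + K') * (t - s) powr (2 * \<alpha>)"
      using K(2)[OF st] K'(2)[OF st] unfolding distrib_right image_mset_add_mset sum_mset.add_mset
      unfolding distrib_right by linarith
  qed (use K K' in auto)
qed

text \<open>Both sides of the shuffle identity have the same increments up to superlinear errors: this is
  integration by parts for the iterated integrals.\<close>

lemma sig_rev_shuffle:
  "t \<in> {0..T} \<Longrightarrow> sig_rev z u t * sig_rev z v t = (\<Sum>w\<in>#word_shuffle u v. sig_rev z w t)"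
proof (induction u v arbitrary: t rule: word_shuffle.induct)
  case (3 i u j v)
  define F where "F = sig_rev z (i # u)"
  define G where "G = sig_rev z (j # v)"
  define U where "U = sig_rev z u"
  define V where "V = sig_rev z v"
  define P where "P t = (\<Sum>w\<in>#word_shuffle u (j # v). sig_rev z (i # w) t)" for t
  define Q where "Q t = (\<Sum>w\<in>#word_shuffle (i # u) v. sig_rev z (j # w) t)" for t
  obtain K1 where K1: "0 \<le> K1" "\<And>s t. 0 \<le> s \<Longrightarrow> s \<le> t \<Longrightarrow> t \<le> T \<Longrightarrow>
      \<bar>F t - F s - U s * (z t $ i - z s $ i)\<bar> \<le> K1 * (t - s) powr (2 * \<alpha>)"
    unfolding F_def U_def by (rule sig_rev_expansion[of i u]) blast
  obtain K2 where K2: "0 \<le> K2" "\<And>s t. 0 \<le> s \<Longrightarrow> s \<le> t \<Longrightarrow> t \<le> T \<Longrightarrow>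
      \<bar>G t - G s - V s * (z t $ j - z s $ j)\<bar> \<le> K2 * (t - s) powr (2 * \<alpha>)"
    unfolding G_def V_def by (rule sig_rev_expansion[of j v]) blast
  \<comment> \<open>The induction hypothesis replaces the sum over the shuffles of \<open>u\<close>
    with \<open>j # v\<close> by the product \<open>U s * G s\<close>; likewise for \<open>Q\<close>
    below.\<close>
  obtain K3 where K3: "0 \<le> K3" "\<And>s t. 0 \<le> s \<Longrightarrow> s \<le> t \<Longrightarrow> t \<le> T \<Longrightarrow>
      \<bar>P t - P s - U s * G s * (z t $ i - z s $ i)\<bar> \<le> K3 * (t - s) powr (2 * \<alpha>)"
    using sum_mset_sig_rev_expansion[of i "word_shuffle u (j # v)"] 3(1)
    unfolding P_def U_def G_def by auto
  obtain K4 where K4: "0 \<le> K4" "\<And>s t. 0 \<le> s \<Longrightarrow> s \<le> t \<Longrightarrow> t \<le> T \<Longrightarrow>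
      \<bar>Q t - Q s - F s * V s * (z t $ j - z s $ j)\<bar> \<le> K4 * (t - s) powr (2 * \<alpha>)"
    using sum_mset_sig_rev_expansion[of j "word_shuffle (i # u) v"] 3(2)
    unfolding Q_def V_def F_def by auto
  obtain CF CG where CF: "0 \<le> CF" "holder_on \<alpha> CF 0 T F" and CG: "0 \<le> CG" "holder_on \<alpha> CG 0 T G"
    unfolding F_def G_def using sig_rev_holder by meson
  have cont: "continuous_on {0..T} F" "continuous_on {0..T} G"
    by (rule holder_on_imp_continuous_on[OF CF(2) _ CF(1)] holder_on_imp_continuous_on[OF CG(2) _ CG(1)];
        use \<alpha> in simp)+
  obtain MF where MF: "0 \<le> MF" "\<And>u. u \<in> {0..T} \<Longrightarrow> \<bar>F u\<bar> \<le> MF"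
    using continuous_on_Icc_bounded[OF cont(1)] by blast
  obtain MG where MG: "0 \<le> MG" "\<And>u. u \<in> {0..T} \<Longrightarrow> \<bar>G u\<bar> \<le> MG"
    using continuous_on_Icc_bounded[OF cont(2)] by blast
  define h where "h t = F t * G t - P t - Q t" for t
  have "h t = h 0"
  proof (rule constant_if_superlinear_increments[where h = h and \<theta> = "2 * \<alpha>" and K = "MF * K2 + MG * K1 + CF * CG + K3 + K4"])
    fix s r assume sr: "0 \<le> s" "s \<le> r" "r \<le> t"
    then have rT: "r \<le> T" using 3(3) by simp
    define X where "X = (r - s) powr (2 * \<alpha>)"
    \<comment> \<open>The first order terms of \<open>F * G\<close> and of \<open>P + Q\<close>
      cancel exactly. What is left are four expansion remainders and one product of increments, all
      of order \<open>2 * \<alpha>\<close>.\<close>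
    have e: "h r - h s = F s * (G r - G s - V s * (z r $ j - z s $ j)) + G s * (F r - F s - U s * (z r $ i - z s $ i))
        + (F r - F s) * (G r - G s) - (P r - P s - U s * G s * (z r $ i - z s $ i))
        - (Q r - Q s - F s * V s * (z r $ j - z s $ j))"
      by (simp add: h_def algebra_simps)
    have 1: "\<bar>F s * (G r - G s - V s * (z r $ j - z s $ j))\<bar> \<le> MF * (K2 * X)"
      unfolding abs_mult X_def using MF K2 sr rT by (intro mult_mono) auto
    have 2: "\<bar>G s * (F r - F s - U s * (z r $ i - z s $ i))\<bar> \<le> MG * (K1 * X)"
      unfolding abs_mult X_def using MG K1 sr rT by (intro mult_mono) auto
    have "\<bar>(F r - F s) * (G r - G s)\<bar> \<le> CF * (r - s) powr \<alpha> * (CG * (r - s) powr \<alpha>)"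
      unfolding abs_mult using holder_onD[OF CF(2), of s r] holder_onD[OF CG(2), of s r] CF(1) sr rT
      by (intro mult_mono) auto
    then have 3: "\<bar>(F r - F s) * (G r - G s)\<bar> \<le> CF * CG * X"
      unfolding X_def powr_double by (simp only: mult_ac)
    have 4: "\<bar>P r - P s - U s * G s * (z r $ i - z s $ i)\<bar> \<le> K3 * X"
      "\<bar>Q r - Q s - F s * V s * (z r $ j - z s $ j)\<bar> \<le> K4 * X"
      unfolding X_def using K3 K4 sr rT by auto
    show "\<bar>h r - h s\<bar> \<le> (MF * K2 + MG * K1 + CF * CG + K3 + K4) * (r - s) powr (2 * \<alpha>)"
      unfolding e X_def[symmetric] distrib_right using 1 2 3 4 unfolding mult.assoc[symmetric] by linarith
  qed (use \<alpha> 3(3) MF MG K1 K2 K3 K4 CF CG in auto)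
  also have "h 0 = 0"
    by (simp add: h_def F_def G_def P_def Q_def sig_rev_0 del: sig_rev.simps)
  finally show ?case
    by (simp add: h_def F_def G_def P_def Q_def multiset.map_comp o_def del: sig_rev.simps)
qed (simp_all del: sig_rev.simps(2))

lemma signature_group_like:
  assumes "t \<in> {0..T}"
  shows "signature z t \<in> group_like"
proof (rule group_likeI)
  show "signature z t [] = 1" by (simp add: signature_def)
  show "signature z t u * signature z t v = (\<Sum>w\<in>#word_shuffle u v. signature z t w)" for u v
    unfolding signature_def sig_rev_shuffle[OF assms] word_shuffle_rev
    by (simp add: multiset.map_comp o_def)
qed

end

lemma time_extend_holder:
  assumes "y \<in> holder_paths \<alpha> T" "\<alpha> \<le> 1" "0 < \<alpha>"
  shows "\<exists>C\<ge>0. holder_on \<alpha> C 0 T (\<lambda>s. time_extend y s $ i)"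
proof (cases i)
  case None
  have "holder_on \<alpha> (T powr (1 - \<alpha>)) 0 T (\<lambda>s. time_extend y s $ i)"
    unfolding holder_on_def
  proof (intro allI impI)
    fix s t assume st: "0 \<le> s" "s \<le> t" "t \<le> T"
    have "(t - s) = (t - s) powr (1 - \<alpha>) * (t - s) powr \<alpha>"
      using st by (simp flip: powr_add)
    also have "\<dots> \<le> T powr (1 - \<alpha>) * (t - s) powr \<alpha>"
      using st assms by (intro mult_right_mono powr_mono2) auto
    finally show "norm (time_extend y t $ i - time_extend y s $ i) \<le> T powr (1 - \<alpha>) * (t - s) powr \<alpha>"
      using None st by (simp add: time_extend_def)
  qed
  then show ?thesis by (intro exI[of _ "T powr (1 - \<alpha>)"]) auto
next
  case (Some j)
  have "holder_on \<alpha> (holder_seminorm \<alpha> T y) 0 T (\<lambda>s. time_extend y s $ i)"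
    unfolding holder_on_def
  proof (intro allI impI)
    fix s t assume st: "0 \<le> s" "s \<le> t" "t \<le> T"
    have "norm (y t $ j - y s $ j) \<le> norm (y t - y s)"
      by (metis component_le_norm_cart real_norm_def vector_minus_component)
    also have "\<dots> \<le> holder_seminorm \<alpha> T y * (t - s) powr \<alpha>"
      by (rule holder_onD[OF holder_paths_imp_holder_on[OF assms(1)] st])
    finally show "norm (time_extend y t $ i - time_extend y s $ i) \<le> holder_seminorm \<alpha> T y * (t - s) powr \<alpha>"
      using Some by (simp add: time_extend_def)
  qed
  then show ?thesis using holder_seminorm_nonneg by blast
qed

section \<open>Compactness of Hoelder balls in a weaker Hoelder norm\<close>

lemma holder_on_imp_seminorm:
  assumes "0 \<le> C" "holder_on \<gamma> C 0 T y"
  shows "holder_sup \<gamma> T y < \<infinity>" "holder_seminorm \<gamma> T y \<le> C"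
proof -
  show "holder_sup \<gamma> T y < \<infinity>"
    unfolding holder_sup_finite_iff using assms by (intro exI[of _ C]) (auto simp: holder_on_def)
  show "holder_seminorm \<gamma> T y \<le> C"
    by (rule holder_seminorm_le) (use assms in \<open>auto simp: holder_on_def\<close>)
qed

lemma holder_on_diff:
  assumes "holder_on \<gamma> C a b y" "holder_on \<gamma> D a b z"
  shows "holder_on \<gamma> (C + D) a b (\<lambda>r. y r - z r)"
  unfolding holder_on_def
proof (intro allI impI)
  fix s t assume st: "a \<le> s" "s \<le> t" "t \<le> b"
  have "norm (y t - z t - (y s - z s)) \<le> norm (y t - y s) + norm (z t - z s)"
    using norm_triangle_ineq4[of "y t - y s" "z t - z s"] by (simp add: algebra_simps)
  then show "norm (y t - z t - (y s - z s)) \<le> (C + D) * (t - s) powr \<gamma>"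
    using holder_onD[OF assms(1) st] holder_onD[OF assms(2) st] by (simp add: distrib_right)
qed

lemma holder_on_cong:
  assumes "\<And>t. t \<in> {a..b} \<Longrightarrow> y t = z t"
  shows "holder_on \<gamma> C a b y \<longleftrightarrow> holder_on \<gamma> C a b z"
proof -
  have "norm (y t - y s) = norm (z t - z s)" if "a \<le> s" "s \<le> t" "t \<le> b" for s t
    using assms[of s] assms[of t] that by simp
  then show ?thesis unfolding holder_on_def by auto
qed

lemma holder_on_mono:
  assumes "holder_on \<gamma> C a b y" "C \<le> D" "a \<le> a'" "b' \<le> b"
  shows "holder_on \<gamma> D a' b' y"
  unfolding holder_on_def
proof (intro allI impI)
  fix s t assume "a' \<le> s" "s \<le> t" "t \<le> b'"
  then have "norm (y t - y s) \<le> C * (t - s) powr \<gamma>" using assms by (intro holder_onD[OF assms(1)]) auto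
  also have "\<dots> \<le> D * (t - s) powr \<gamma>" using assms by (intro mult_right_mono) auto
  finally show "norm (y t - y s) \<le> D * (t - s) powr \<gamma>" .
qed

lemma holder_on_stopped:
  assumes "holder_on \<gamma> C 0 s h" "0 \<le> \<gamma>" "0 \<le> C" "0 \<le> s"
  shows "holder_on \<gamma> C 0 T (\<lambda>r. h (min r s))"
  unfolding holder_on_def
proof (intro allI impI)
  fix u v assume uv: "0 \<le> u" "u \<le> v" "v \<le> T"
  have "norm (h (min v s) - h (min u s)) \<le> C * (min v s - min u s) powr \<gamma>"
    using uv assms by (intro holder_onD[OF assms(1)]) auto
  also have "\<dots> \<le> C * (v - u) powr \<gamma>"
    using uv assms by (intro mult_left_mono powr_mono2) auto
  finally show "norm (h (min v s) - h (min u s)) \<le> C * (v - u) powr \<gamma>" .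
qed

text \<open>Interpolation: close points are controlled by the \<open>\<alpha>\<close>-Hoelder bound, distant points by the
  supremum norm.\<close>

lemma holder_interpolation:
  fixes \<alpha> \<beta> C \<epsilon> :: real
  assumes "0 < \<beta>" "\<beta> < \<alpha>" "0 \<le> C" "0 < \<epsilon>"
  obtains e where "0 < e" "\<And>h :: real \<Rightarrow> 'b::real_normed_vector. holder_on \<alpha> C a b h \<Longrightarrow>
    (\<And>t. t \<in> {a..b} \<Longrightarrow> norm (h t) \<le> e) \<Longrightarrow> holder_on \<beta> \<epsilon> a b h"
proof -
  obtain d where d: "d > 0" "\<And>h. \<bar>h\<bar> < d \<Longrightarrow> C * \<bar>h\<bar> powr (\<alpha> - \<beta>) < \<epsilon>"
    using holder_on_small[of "\<alpha> - \<beta>" C \<epsilon>] assms by auto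
  \<comment> \<open>Two values of size \<open>e\<close> differ by at most
    \<open>\<epsilon> * d powr \<beta>\<close>, the increment permitted at distance
    \<open>d\<close>.\<close>
  define e where "e = \<epsilon> * d powr \<beta> / 2"
  show thesis
  proof (rule that[of e])
    show "0 < e" using d assms by (simp add: e_def)
    fix h :: "real \<Rightarrow> 'b"
    assume hol: "holder_on \<alpha> C a b h" and he: "\<And>t. t \<in> {a..b} \<Longrightarrow> norm (h t) \<le> e"
    show "holder_on \<beta> \<epsilon> a b h"
      unfolding holder_on_def
    proof (intro allI impI)
      fix s t assume st: "a \<le> s" "s \<le> t" "t \<le> b"
      show "norm (h t - h s) \<le> \<epsilon> * (t - s) powr \<beta>"
      proof (cases "t - s < d")
        case True
        have "norm (h t - h s) \<le> C * (t - s) powr \<alpha>" by (rule holder_onD[OF hol st])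
        also have "\<dots> = C * (t - s) powr (\<alpha> - \<beta>) * (t - s) powr \<beta>"
          by (simp flip: powr_add)
        also have "\<dots> \<le> \<epsilon> * (t - s) powr \<beta>"
          using d(2)[of "t - s"] True st by (intro mult_right_mono) auto
        finally show ?thesis .
      next
        case False
        have "norm (h t - h s) \<le> e + e"
          using st by (intro order_trans[OF norm_triangle_ineq4] add_mono he) auto
        also have "\<dots> = \<epsilon> * d powr \<beta>" by (simp add: e_def)
        also have "\<dots> \<le> \<epsilon> * (t - s) powr \<beta>"
          using False assms d by (intro mult_left_mono powr_mono2) auto
        finally show ?thesis .
      qed
    qed
  qed
qed

text \<open>With the initial value fixed, a bound on the seminorm alone suffices for compactness,
  and the distance of two members is the seminorm of their difference.\<close>

definition holder_ball :: "real \<Rightarrow> real \<Rightarrow> 'b::real_normed_vector \<Rightarrow> real \<Rightarrow> (real \<Rightarrow> 'b) set" where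
  "holder_ball \<alpha> T w0 R = {y \<in> extensional {0..T}. y 0 = w0 \<and> holder_on \<alpha> R 0 T y}"

lemma holder_ball_subset: "0 \<le> R \<Longrightarrow> holder_ball \<alpha> T w0 R \<subseteq> holder_paths \<alpha> T"
  using holder_on_imp_seminorm(1) by (auto simp: holder_ball_def holder_paths_def)

lemma holder_paths_in_ball:
  "y \<in> holder_paths \<alpha> T \<Longrightarrow> holder_seminorm \<alpha> T y \<le> R \<Longrightarrow> y 0 = w0 \<Longrightarrow> y \<in> holder_ball \<alpha> T w0 R"
  using holder_on_mono[OF holder_paths_imp_holder_on[of y \<alpha> T], of R 0 T]
  by (simp add: holder_ball_def holder_paths_def)

text \<open>Arzela-Ascoli gives uniform convergence. Differences of members have the common
  \<alpha>-constant \<open>R + R\<close>, so interpolation upgrades this to convergence in the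
  weaker Hoelder norm.\<close>

lemma holder_ball_sequentially_compact:
  fixes Y :: "nat \<Rightarrow> real \<Rightarrow> 'b::euclidean_space"
  assumes "0 < \<beta>" "\<beta> < \<alpha>" "0 \<le> T" "0 \<le> R" and Y: "\<And>n. Y n \<in> holder_ball \<alpha> T w0 R"
  obtains y k where "strict_mono (k :: nat \<Rightarrow> nat)" "y \<in> holder_ball \<alpha> T w0 R"
    "(\<lambda>n. holder_dist \<beta> T (Y (k n)) y) \<longlonglongrightarrow> 0"
proof -
  have hol: "holder_on \<alpha> R 0 T (Y n)" and Y0: "Y n 0 = w0" for n
    using Y[of n] by (auto simp: holder_ball_def)
  obtain G k where k: "strict_mono (k :: nat \<Rightarrow> nat)"
    and ul: "uniform_limit {0..T} (\<lambda>n. Y (k n)) G sequentially" and G: "holder_on \<alpha> R 0 T G"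
    by (rule holder_on_compactness[of \<alpha> R 0 T Y "norm w0"]) (use assms hol Y0 in auto)
  define y where "y = restrict G {0..T}"
  have "(\<lambda>n. Y (k n) 0) \<longlonglongrightarrow> G 0" by (rule tendsto_uniform_limitI[OF ul]) (use assms in auto)
  then have G0: "G 0 = w0" using Y0 LIMSEQ_unique[of "\<lambda>n. w0"] by simp
  have "holder_on \<alpha> R 0 T y"
    using G by (subst holder_on_cong[of 0 T _ G]) (auto simp: y_def)
  then have yb: "y \<in> holder_ball \<alpha> T w0 R" using G0 assms by (simp add: holder_ball_def y_def)
  have "(\<lambda>n. holder_dist \<beta> T (Y (k n)) y) \<longlonglongrightarrow> 0"
  proof (rule LIMSEQ_I)
    fix \<epsilon> :: real assume "0 < \<epsilon>"
    obtain e where e: "0 < e" "\<And>h :: real \<Rightarrow> 'b. holder_on \<alpha> (R + R) 0 T h \<Longrightarrow>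
      (\<And>t. t \<in> {0..T} \<Longrightarrow> norm (h t) \<le> e) \<Longrightarrow> holder_on \<beta> (\<epsilon> / 2) 0 T h"
      using holder_interpolation[of \<beta> \<alpha> "R + R" "\<epsilon> / 2" 0 T] assms \<open>0 < \<epsilon>\<close> by auto
    obtain N where N: "\<And>n t. n \<ge> N \<Longrightarrow> t \<in> {0..T} \<Longrightarrow> dist (Y (k n) t) (G t) < e"
      using ul \<open>0 < e\<close> unfolding uniform_limit_iff eventually_sequentially by blast
    have "holder_dist \<beta> T (Y (k n)) y < \<epsilon>" if "n \<ge> N" for n
    proof -
      have "holder_on \<beta> (\<epsilon> / 2) 0 T (\<lambda>r. Y (k n) r - y r)"
      proof (rule e(2))
        show "holder_on \<alpha> (R + R) 0 T (\<lambda>r. Y (k n) r - y r)"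
          by (rule holder_on_diff) (use hol yb in \<open>auto simp: holder_ball_def\<close>)
        show "norm (Y (k n) t - y t) \<le> e" if "t \<in> {0..T}" for t
          using N[OF \<open>n \<ge> N\<close> that] that by (simp add: y_def dist_norm)
      qed
      then have "holder_seminorm \<beta> T (\<lambda>r. Y (k n) r - y r) \<le> \<epsilon> / 2"
        using \<open>0 < \<epsilon>\<close> by (intro holder_on_imp_seminorm) auto
      moreover have "y 0 = w0" using yb by (simp add: holder_ball_def)
      ultimately show ?thesis using \<open>0 < \<epsilon>\<close> by (simp add: holder_dist_def holder_norm_def Y0)
    qed
    then show "\<exists>N. \<forall>n\<ge>N. norm (holder_dist \<beta> T (Y (k n)) y - 0) < \<epsilon>" by auto
  qed
  with that k yb show thesis by blast
qed

lemma compactin_holder_ball: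
  fixes w0 :: "'b::euclidean_space"
  assumes "0 < \<beta>" "\<beta> < \<alpha>" "0 \<le> T" "0 \<le> R"
  shows "compactin (holder_topology \<alpha> \<beta> T) (holder_ball \<alpha> T w0 R)"
proof -
  interpret Metric_space "holder_paths \<alpha> T :: (real \<Rightarrow> 'b) set" "holder_dist \<beta> T"
    by (rule Metric_space_holder) (use assms in auto)
  have sub: "holder_ball \<alpha> T w0 R \<subseteq> holder_paths \<alpha> T" by (rule holder_ball_subset[OF assms(4)])
  show ?thesis
    unfolding holder_topology_def compactin_sequentially
  proof (intro conjI allI impI sub)
    fix Y :: "nat \<Rightarrow> real \<Rightarrow> 'b" assume Y: "range Y \<subseteq> holder_ball \<alpha> T w0 R"
    obtain y k where "strict_mono (k :: nat \<Rightarrow> nat)" "y \<in> holder_ball \<alpha> T w0 R"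
      "(\<lambda>n. holder_dist \<beta> T (Y (k n)) y) \<longlonglongrightarrow> 0"
      by (rule holder_ball_sequentially_compact[OF assms, of Y w0]) (use Y in auto)
    then show "\<exists>l r. l \<in> holder_ball \<alpha> T w0 R \<and> strict_mono r \<and> limitin mtopology (Y \<circ> r) l sequentially"
      using sub Y
      by (intro exI[of _ y] exI[of _ k]) (auto simp: limitin_metric_dist_null intro!: always_eventually)
  qed
qed

lemma holder_dist_pointwise:
  assumes "holder_sup \<beta> T (\<lambda>r. y r - z r) < \<infinity>" "t \<in> {0..T}" "0 \<le> \<beta>"
  shows "norm (y t - z t) \<le> (1 + T powr \<beta>) * holder_dist \<beta> T y z"
proof -
  define H where "H = holder_seminorm \<beta> T (\<lambda>r. y r - z r)"
  have H0: "0 \<le> H" by (simp add: H_def)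
  have "norm (y t - z t) \<le> norm (y 0 - z 0) + norm (y t - z t - (y 0 - z 0))"
    by (metis norm_triangle_sub)
  also have "norm (y t - z t - (y 0 - z 0)) \<le> H * T powr \<beta>"
  proof (cases "t = 0")
    case False
    then have "norm (y t - z t - (y 0 - z 0)) \<le> H * (t - 0) powr \<beta>"
      unfolding H_def using holder_seminorm_bound[OF assms(1), of 0 t] assms by auto
    also have "\<dots> \<le> H * T powr \<beta>"
      using assms H0 by (intro mult_left_mono powr_mono2) auto
    finally show ?thesis .
  qed (use H0 in simp)
  finally have "norm (y t - z t) \<le> norm (y 0 - z 0) + H * T powr \<beta>" by simp
  also have "\<dots> \<le> (1 + T powr \<beta>) * (norm (y 0 - z 0) + H)"
    using H0 by (simp add: algebra_simps)
  finally show ?thesis by (simp add: holder_dist_def holder_norm_def H_def)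
qed

section \<open>Stopped paths: compactness and continuity in the stopping time\<close>

definition stopped_ball ::
  "real \<Rightarrow> real \<Rightarrow> 'b::real_normed_vector \<Rightarrow> real \<Rightarrow> (real \<times> (real \<Rightarrow> 'b)) set" where
  "stopped_ball \<alpha> T w0 R = {(t, y). t \<in> {0..T} \<and> y \<in> holder_ball \<alpha> T w0 R \<and> y = stopped T t y}"

lemma stopped_in_ball:
  assumes "y \<in> holder_ball \<alpha> T w0 R" "t \<in> {0..T}" "0 \<le> \<alpha>" "0 \<le> R"
  shows "stopped T t y \<in> holder_ball \<alpha> T w0 R" "(t, stopped T t y) \<in> stopped_ball \<alpha> T w0 R"
proof -
  have "holder_on \<alpha> R 0 T (\<lambda>r. y (min r t))"
    by (rule holder_on_stopped) (use assms in \<open>auto simp: holder_ball_def intro: holder_on_mono\<close>)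
  then have "holder_on \<alpha> R 0 T (stopped T t y)"
    by (subst holder_on_cong[of 0 T _ "\<lambda>r. y (min r t)"]) (auto simp: stopped_def)
  then show "stopped T t y \<in> holder_ball \<alpha> T w0 R"
    using assms by (auto simp: holder_ball_def stopped_def)
  moreover have "stopped T t (stopped T t y) = stopped T t y"
    using assms by (intro ext) (simp add: stopped_def restrict_def min_def)
  ultimately show "(t, stopped T t y) \<in> stopped_ball \<alpha> T w0 R"
    using assms by (simp add: stopped_ball_def)
qed

lemma stopped_ball_subset: "0 \<le> R \<Longrightarrow> stopped_ball \<alpha> T w0 R \<subseteq> stopped_paths \<alpha> T"
  using holder_ball_subset[of R \<alpha> T w0] by (auto simp: stopped_ball_def stopped_paths_def)

text \<open>Subsequences are extracted first for the times and then for the paths. The members are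
  stopped at varying times \<open>tn\<close>, not at their limit \<open>t\<close>; the discrepancy
  is at most \<open>R * \<bar>tn - t\<bar> powr \<alpha>\<close>, so the limit path is stopped at
  \<open>t\<close>.\<close>

lemma compactin_stopped_ball:
  fixes w0 :: "'b::euclidean_space"
  assumes "0 < \<beta>" "\<beta> < \<alpha>" "0 \<le> T" "0 \<le> R"
  shows "compactin (stopped_topology \<alpha> \<beta> T) (stopped_ball \<alpha> T w0 R)"
proof -
  interpret Metric_space "stopped_paths \<alpha> T :: (real \<times> (real \<Rightarrow> 'b)) set" "stopped_dist \<beta> T"
    by (rule Metric_space_stopped) (use assms in auto)
  have sub: "stopped_ball \<alpha> T w0 R \<subseteq> stopped_paths \<alpha> T" by (rule stopped_ball_subset[OF assms(4)])
  show ?thesis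
    unfolding stopped_topology_def compactin_sequentially
  proof (intro conjI allI impI sub)
    fix P :: "nat \<Rightarrow> real \<times> (real \<Rightarrow> 'b)" assume P: "range P \<subseteq> stopped_ball \<alpha> T w0 R"
    define Y where "Y n = snd (P n)" for n
    have Pn: "fst (P n) \<in> {0..T}" "Y n \<in> holder_ball \<alpha> T w0 R" "Y n = stopped T (fst (P n)) (Y n)" for n
      using P by (auto simp: stopped_ball_def Y_def image_subset_iff split_beta)
    obtain t j where t: "t \<in> {0..T}" and j: "strict_mono (j :: nat \<Rightarrow> nat)" and "((fst \<circ> P) \<circ> j) \<longlonglongrightarrow> t"
      by (rule seq_compactE[of "{0..T}" "fst \<circ> P"]) (use Pn(1) in \<open>auto intro: compact_imp_seq_compact\<close>)
    obtain y k where k: "strict_mono (k :: nat \<Rightarrow> nat)" and y: "y \<in> holder_ball \<alpha> T w0 R"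
      and lim: "(\<lambda>n. holder_dist \<beta> T (Y (j (k n))) y) \<longlonglongrightarrow> 0"
      by (rule holder_ball_sequentially_compact[OF assms, of "\<lambda>n. Y (j n)" w0]) (use Pn(2) in auto)
    define r where "r = j \<circ> k"
    have r: "strict_mono r" unfolding r_def by (rule strict_mono_o[OF j k])
    have limt: "(\<lambda>n. fst (P (r n))) \<longlonglongrightarrow> t"
      using LIMSEQ_subseq_LIMSEQ[OF \<open>((fst \<circ> P) \<circ> j) \<longlonglongrightarrow> t\<close> k] by (simp add: o_def r_def)
    have limd: "(\<lambda>n. holder_dist \<beta> T (Y (r n)) y) \<longlonglongrightarrow> 0" using lim by (simp add: r_def)
    have yp: "y \<in> holder_paths \<alpha> T" "Y n \<in> holder_paths \<alpha> T" for n
      using y Pn(2) holder_ball_subset[OF assms(4)] by blast+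
    have limp: "(\<lambda>n. Y (r n) u) \<longlonglongrightarrow> y u" if u: "u \<in> {0..T}" for u
    proof -
      have "(\<lambda>n. Y (r n) u - y u) \<longlonglongrightarrow> 0"
      proof (rule Lim_null_comparison[OF always_eventually])
        show "\<forall>n. norm (Y (r n) u - y u) \<le> (1 + T powr \<beta>) * holder_dist \<beta> T (Y (r n)) y"
          using holder_dist_pointwise[OF holder_sup_diff_paths[OF _ yp(2) yp(1)] u] assms by simp
        show "(\<lambda>n. (1 + T powr \<beta>) * holder_dist \<beta> T (Y (r n)) y) \<longlonglongrightarrow> 0"
          using tendsto_mult_right_zero[OF limd] by simp
      qed
      then show ?thesis by (simp add: LIM_zero_iff)
    qed
    have "y u = y (min u t)" if u: "u \<in> {0..T}" for u
    proof -
      have *: "norm (Y (r n) u - Y (r n) (min u t)) \<le> R * \<bar>fst (P (r n)) - t\<bar> powr \<alpha>" for n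
      proof -
        define tn where "tn = fst (P (r n))"
        have tn: "tn \<in> {0..T}" unfolding tn_def by (rule Pn(1))
        have e: "Y (r n) v = Y (r n) (min v tn)" if "v \<in> {0..T}" for v
          using fun_cong[OF Pn(3)[of "r n"], of v] that by (simp add: stopped_def tn_def)
        have "norm (Y (r n) u - Y (r n) (min u t)) = norm (Y (r n) (min u tn) - Y (r n) (min (min u t) tn))"
          using e[OF u] e[of "min u t"] u t by auto
        also have "\<dots> \<le> R * \<bar>min u tn - min (min u t) tn\<bar> powr \<alpha>"
          by (rule holder_onD_abs) (use Pn(2) u t tn in \<open>auto simp: holder_ball_def\<close>)
        also have "\<dots> \<le> R * \<bar>tn - t\<bar> powr \<alpha>"
          using assms by (intro mult_left_mono powr_mono2) auto
        finally show ?thesis by (simp add: tn_def)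
      qed
      have "(\<lambda>n. R * \<bar>fst (P (r n)) - t\<bar> powr \<alpha>) \<longlonglongrightarrow> R * \<bar>t - t\<bar> powr \<alpha>"
        using assms by (intro tendsto_intros limt tendsto_powr') auto
      then have "(\<lambda>n. Y (r n) u - Y (r n) (min u t)) \<longlonglongrightarrow> 0"
        using * by (intro Lim_null_comparison[OF always_eventually, of "\<lambda>n. Y (r n) u - Y (r n) (min u t)"
              "\<lambda>n. R * \<bar>fst (P (r n)) - t\<bar> powr \<alpha>"]) auto
      moreover have "(\<lambda>n. Y (r n) u - Y (r n) (min u t)) \<longlonglongrightarrow> y u - y (min u t)"
        using u t by (intro tendsto_diff limp) auto
      ultimately show ?thesis using LIMSEQ_unique by fastforce
    qed
    then have "y = stopped T t y"
      using y by (intro extensionalityI[of _ "{0..T}"]) (auto simp: stopped_def holder_ball_def)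
    then have L: "(t, y) \<in> stopped_ball \<alpha> T w0 R" using t y by (simp add: stopped_ball_def)
    have "(\<lambda>n. \<bar>fst (P (r n)) - t\<bar> + holder_dist \<beta> T (Y (r n)) y) \<longlonglongrightarrow> \<bar>t - t\<bar> + 0"
      by (intro tendsto_intros limt limd)
    then have "limitin mtopology (P \<circ> r) (t, y) sequentially"
      using L sub P
      by (auto simp: limitin_metric_dist_null stopped_dist_def o_def Y_def image_subset_iff intro!: always_eventually)
    then show "\<exists>l r. l \<in> stopped_ball \<alpha> T w0 R \<and> strict_mono r \<and> limitin mtopology (P \<circ> r) l sequentially"
      using L r by blast
  qed
qed

text \<open>Shifting the stopping time moves the stopped path little in supremum norm, and
  interpolation turns this into closeness in the weaker Hoelder norm. At exponent \<alpha> itself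
  this fails, for instance for the path \<open>t powr \<alpha>\<close> stopped near 0.\<close>

lemma continuous_stopping:
  fixes y :: "real \<Rightarrow> 'b::real_normed_vector"
  assumes "0 < \<beta>" "\<beta> < \<alpha>" "0 \<le> T" and y: "y \<in> holder_paths \<alpha> T"
  shows "continuous_map (top_of_set {0..T}) (stopped_topology \<alpha> \<beta> T) (\<lambda>t. (t, stopped T t y))"
proof -
  interpret Metric_space "stopped_paths \<alpha> T :: (real \<times> (real \<Rightarrow> 'b)) set" "stopped_dist \<beta> T"
    by (rule Metric_space_stopped) (use assms in auto)
  define R where "R = holder_seminorm \<alpha> T y"
  have R0: "0 \<le> R" by (simp add: R_def)
  have hol: "holder_on \<alpha> R 0 T y" unfolding R_def by (rule holder_paths_imp_holder_on[OF y])
  have "y \<in> holder_ball \<alpha> T (y 0) R" using hol y by (simp add: holder_ball_def holder_paths_def)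
  then have st: "holder_on \<alpha> R 0 T (stopped T t y)" if "t \<in> {0..T}" for t
    using stopped_in_ball(1)[of y \<alpha> T "y 0" R t] that assms R0 by (simp add: holder_ball_def)
  have M: "(t, stopped T t y) \<in> stopped_paths \<alpha> T" if "t \<in> {0..T}" for t
    using that y by (auto simp: stopped_paths_def)
  show ?thesis
    unfolding stopped_topology_def continuous_map_to_metric
  proof (intro ballI allI impI)
    fix t \<epsilon> assume "t \<in> topspace (top_of_set {0..T})" and "0 < (\<epsilon>::real)"
    then have t: "t \<in> {0..T}" by simp
    obtain e where e: "0 < e" "\<And>h :: real \<Rightarrow> 'b. holder_on \<alpha> (R + R) 0 T h \<Longrightarrow>
      (\<And>t. t \<in> {0..T} \<Longrightarrow> norm (h t) \<le> e) \<Longrightarrow> holder_on \<beta> (\<epsilon> / 2) 0 T h"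
      using holder_interpolation[of \<beta> \<alpha> "R + R" "\<epsilon> / 2" 0 T] assms R0 \<open>0 < \<epsilon>\<close> by auto
    obtain d where d: "d > 0" "\<And>h. \<bar>h\<bar> < d \<Longrightarrow> R * \<bar>h\<bar> powr \<alpha> < e"
      using holder_on_small[of \<alpha> R e] assms R0 e(1) by auto
    define U where "U = {0..T} \<inter> ball t (min d (\<epsilon> / 2))"
    have "(s, stopped T s y) \<in> mball (t, stopped T t y) \<epsilon>" if "s \<in> U" for s
    proof -
      have s: "s \<in> {0..T}" "\<bar>t - s\<bar> < d" "\<bar>t - s\<bar> < \<epsilon> / 2"
        using that by (auto simp: U_def dist_real_def)
      have "holder_on \<beta> (\<epsilon> / 2) 0 T (\<lambda>r. stopped T t y r - stopped T s y r)"
      proof (rule e(2))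
        show "holder_on \<alpha> (R + R) 0 T (\<lambda>r. stopped T t y r - stopped T s y r)"
          by (intro holder_on_diff st s t)
        fix u assume u: "u \<in> {0..T}"
        have "norm (y (min t u) - y (min s u)) \<le> R * \<bar>min t u - min s u\<bar> powr \<alpha>"
          by (rule holder_onD_abs[OF hol]) (use u s t in auto)
        also have "\<dots> < e" using s(2) by (intro d(2)) (auto simp: min_def abs_if split: if_splits)
        finally show "norm (stopped T t y u - stopped T s y u) \<le> e"
          using u by (simp add: stopped_def min.commute)
      qed
      then have "holder_seminorm \<beta> T (\<lambda>r. stopped T t y r - stopped T s y r) \<le> \<epsilon> / 2"
        using \<open>0 < \<epsilon>\<close> by (intro holder_on_imp_seminorm) auto
      moreover have "stopped T t y 0 = stopped T s y 0" using s t by (auto simp: stopped_def)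
      ultimately show ?thesis
        using s t M by (auto simp: in_mball stopped_dist_def holder_dist_def holder_norm_def)
    qed
    moreover have "t \<in> U" using t d \<open>0 < \<epsilon>\<close> by (simp add: U_def)
    moreover have "openin (top_of_set {0..T}) U" unfolding U_def by auto
    ultimately show "\<exists>U. openin (top_of_set {0..T}) U \<and> t \<in> U \<and>
        (\<forall>s\<in>U. (s, stopped T s y) \<in> mball (t, stopped T t y) \<epsilon>)" by blast
  qed
qed

section \<open>Features: iterated time integrals of the path\<close>

lemma rs_primitive_cong:
  assumes "rs_primitive f g I a b" "\<And>t. t \<in> {a..b} \<Longrightarrow> f' t = f t"
  shows "rs_primitive f' g I a b"
  unfolding rs_primitive_def
proof (intro allI impI)
  fix \<epsilon> :: real assume "\<epsilon> > 0"
  obtain \<delta> where \<delta>: "\<delta> > 0" "\<And>s \<xi> t. a \<le> s \<Longrightarrow> s \<le> \<xi> \<Longrightarrow> \<xi> \<le> t \<Longrightarrow> t \<le> b \<Longrightarrow> t - s < \<delta> \<Longrightarrow>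
       \<bar>I t - I s - f \<xi> * (g t - g s)\<bar> \<le> \<epsilon> * (t - s)"
    using rs_primitiveD[OF assms(1) \<open>\<epsilon> > 0\<close>] by blast
  have "\<bar>I t - I s - f' \<xi> * (g t - g s)\<bar> \<le> \<epsilon> * (t - s)"
    if st: "a \<le> s" "s \<le> \<xi>" "\<xi> \<le> t" "t \<le> b" "t - s < \<delta>" for s \<xi> t
    using \<delta>(2)[OF st] assms(2)[of \<xi>] st by simp
  then show "\<exists>\<delta>>0. \<forall>s \<xi> t. a \<le> s \<longrightarrow> s \<le> \<xi> \<longrightarrow> \<xi> \<le> t \<longrightarrow> t \<le> b \<longrightarrow> t - s < \<delta> \<longrightarrow>
      \<bar>I t - I s - f' \<xi> * (g t - g s)\<bar> \<le> \<epsilon> * (t - s)"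
    using \<delta>(1) by blast
qed

lemma rs_primitive_time:
  assumes "continuous_on {a..b} f"
  shows "rs_primitive f (\<lambda>s. s) (\<lambda>t. integral {a..t} f) a b"
proof (rule rs_primitive_of_oscillation[OF assms zero_le_one])
  fix s t c B assume st: "a \<le> s" "s \<le> t" "t \<le> b"
    and bd: "\<And>u. s \<le> u \<Longrightarrow> u \<le> t \<Longrightarrow> \<bar>f u - c\<bar> \<le> B"
  have "\<bar>f u - c\<bar> * \<bar>1\<bar> \<le> B" if "s \<le> u" "u \<le> t" for u using bd[OF that] by simp
  from integral_mult_increment[where g' = "\<lambda>_. 1" and g = "\<lambda>s. s", OF assms _ _ st this]
  show "\<bar>integral {a..t} f - integral {a..s} f - c * (t - s)\<bar> \<le> B * 1 * (t - s)" by simp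
qed

section \<open>Iterated time integrals and moments\<close>

fun iter_int :: "nat \<Rightarrow> (real \<Rightarrow> real) \<Rightarrow> real \<Rightarrow> real" where
  "iter_int 0 e = e"
| "iter_int (Suc k) e = (\<lambda>t. integral {0..t} (iter_int k e))"

lemma continuous_on_iter_int:
  assumes "continuous_on {0..T} e"
  shows "continuous_on {0..T} (iter_int k e)"
proof (induction k)
  case (Suc k)
  then show ?case
    by (auto intro: indefinite_integral_continuous_1 integrable_continuous_interval)
qed (use assms in simp)

lemma iter_int_integrable:
  assumes "continuous_on {0..T} e" "t \<le> T"
  shows "iter_int k e integrable_on {0..t}"
  by (intro integrable_continuous_interval continuous_on_subset[OF continuous_on_iter_int[OF assms(1)]])
    (use assms(2) in auto)

lemma iter_int_diff:
  assumes "continuous_on {0..T} e1" "continuous_on {0..T} e2" "t \<le> T"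
  shows "iter_int k (\<lambda>s. e1 s - e2 s) t = iter_int k e1 t - iter_int k e2 t"
  using assms(3)
proof (induction k arbitrary: t)
  case (Suc k)
  have "integral {0..t} (iter_int k (\<lambda>s. e1 s - e2 s)) = integral {0..t} (\<lambda>u. iter_int k e1 u - iter_int k e2 u)"
    using Suc by (intro integral_cong) auto
  also have "\<dots> = integral {0..t} (iter_int k e1) - integral {0..t} (iter_int k e2)"
    by (intro integral_diff iter_int_integrable[OF assms(1) Suc.prems] iter_int_integrable[OF assms(2) Suc.prems])
  finally show ?case by simp
qed simp

lemma iter_int_bound:
  assumes "continuous_on {0..T} e" "\<And>u. u \<in> {0..t} \<Longrightarrow> \<bar>e u\<bar> \<le> B" "0 \<le> B" "0 \<le> t" "t \<le> T"
  shows "\<bar>iter_int k e t\<bar> \<le> B * T ^ k"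
  using assms(2,4,5)
proof (induction k arbitrary: t)
  case (Suc k)
  have "norm (integral (cbox 0 t) (iter_int k e)) \<le> B * T ^ k * measure lborel (cbox 0 t)"
  proof (rule integrable_bound)
    show "0 \<le> B * T ^ k" using assms(3) Suc.prems by simp
    show "iter_int k e integrable_on cbox 0 t"
      using iter_int_integrable[OF assms(1)] Suc.prems by simp
    show "norm (iter_int k e u) \<le> B * T ^ k" if "u \<in> cbox 0 t" for u
      using that Suc.prems by (auto intro!: Suc.IH)
  qed
  also have "\<dots> \<le> B * T ^ k * T" using Suc.prems assms(3) by (intro mult_left_mono) auto
  finally show ?case by (simp add: mult_ac)
qed auto

lemma iter_int_local:
  assumes "\<And>u. u \<in> {0..t} \<Longrightarrow> e1 u = e2 u" "0 \<le> t"
  shows "iter_int k e1 t = iter_int k e2 t"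
  using assms
proof (induction k arbitrary: t)
  case (Suc k)
  show ?case
    unfolding iter_int.simps by (intro integral_cong Suc.IH) (use Suc.prems in auto)
qed auto

text \<open>Integration by parts reduces the moments of \<open>e\<close> to its iterated integrals at the endpoint.\<close>

lemma iter_int_moments:
  assumes cont: "continuous_on {0..t} e" and "0 \<le> t" and zero: "\<And>k. iter_int (Suc k) e t = 0"
  shows "((\<lambda>u. iter_int k e u * u ^ n) has_integral 0) {0..t}"
proof (induction n arbitrary: k)
  case 0
  have "iter_int k e integrable_on {0..t}" by (rule iter_int_integrable[OF cont]) simp
  then show ?case using zero[of k] by (simp add: has_integral_integrable_integral)
next
  case (Suc n)
  let ?E = "iter_int k e" and ?F = "iter_int (Suc k) e"
  have A: "((\<lambda>u. ?E u * u ^ Suc n + ?F u * (real (Suc n) * u ^ n)) has_integral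
      ?F t * t ^ Suc n - ?F 0 * 0 ^ Suc n) {0..t}"
  proof (rule fundamental_theorem_of_calculus[OF \<open>0 \<le> t\<close>])
    fix u assume u: "u \<in> {0..t}"
    have "(?F has_real_derivative ?E u) (at u within {0..t})"
      unfolding iter_int.simps has_real_derivative_iff_has_vector_derivative
      by (intro integral_has_vector_derivative continuous_on_iter_int cont u)
    moreover have "((\<lambda>u. u ^ Suc n) has_real_derivative real (Suc n) * u ^ n) (at u within {0..t})"
      using DERIV_pow[of "Suc n" u "{0..t}"] by simp
    ultimately have "((\<lambda>u. ?F u * u ^ Suc n) has_real_derivative ?F u * (real (Suc n) * u ^ n) + ?E u * u ^ Suc n) (at u within {0..t})"
      by (rule DERIV_mult')
    then show "((\<lambda>u. ?F u * u ^ Suc n) has_vector_derivative ?E u * u ^ Suc n + ?F u * (real (Suc n) * u ^ n)) (at u within {0..t})"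
      by (simp add: has_real_derivative_iff_has_vector_derivative add.commute)
  qed
  \<comment> \<open>The induction hypothesis is used one integration higher: \<open>k\<close> rises
    while the power \<open>n\<close> falls.\<close>
  have B: "((\<lambda>u. ?F u * (real (Suc n) * u ^ n)) has_integral 0) {0..t}"
    using has_integral_mult_right[OF Suc.IH[of "Suc k"], of "real (Suc n)"] by (simp add: mult_ac del: iter_int.simps)
  have "((\<lambda>u. ?E u * u ^ Suc n) has_integral ?F t * t ^ Suc n - ?F 0 * 0 ^ Suc n - 0) {0..t}"
    using has_integral_diff[OF A B] by (simp only: add_diff_cancel_right')
  then show ?case using zero[of k] by simp
qed

text \<open>A continuous function orthogonal to all polynomials is orthogonal to their uniform
  limits, in particular to itself, so the integral of \<open>e * e\<close> vanishes.\<close>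

lemma zero_if_moments_zero:
  fixes e :: "real \<Rightarrow> real"
  assumes cont: "continuous_on {0..t} e" and "0 < t"
    and mom: "\<And>n. ((\<lambda>u. e u * u ^ n) has_integral 0) {0..t}" and u: "u \<in> {0..t}"
  shows "e u = 0"
proof -
  obtain M where M: "0 \<le> M" "\<And>u. u \<in> {0..t} \<Longrightarrow> \<bar>e u\<bar> \<le> M"
    using continuous_on_Icc_bounded[OF cont] by blast
  have c2: "continuous_on {0..t} (\<lambda>u. e u * e u)" by (intro continuous_on_mult cont)
  have "integral {0..t} (\<lambda>u. e u * e u) \<le> 0"
  proof (rule field_le_epsilon)
    fix \<epsilon> :: real assume "\<epsilon> > 0"
    define \<delta> where "\<delta> = \<epsilon> / (M * t + 1)"
    have Mt: "0 < M * t + 1" using M \<open>0 < t\<close> by (simp add: add_nonneg_pos)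
    have "\<delta> > 0" using \<open>\<epsilon> > 0\<close> Mt by (simp add: \<delta>_def)
    obtain g where "real_polynomial_function g" and g: "\<And>x. x \<in> {0..t} \<Longrightarrow> \<bar>e x - g x\<bar> < \<delta>"
      using Stone_Weierstrass_real_polynomial_function[OF compact_Icc cont \<open>\<delta> > 0\<close>] by blast
    then obtain a n where geq: "g = (\<lambda>x. \<Sum>i\<le>n. a i * x ^ i)"
      unfolding real_polynomial_function_iff_sum by blast
    have "((\<lambda>u. \<Sum>i\<le>n. a i * (e u * u ^ i)) has_integral (\<Sum>i\<le>n. a i * 0)) {0..t}"
      by (intro has_integral_sum has_integral_mult_right mom) auto
    then have "((\<lambda>u. e u * g u) has_integral 0) {0..t}"
      by (simp add: geq sum_distrib_left mult_ac)
    from has_integral_diff[OF integrable_integral[OF integrable_continuous_interval[OF c2]] this]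
    have "((\<lambda>u. e u * (e u - g u)) has_integral integral {0..t} (\<lambda>u. e u * e u)) (cbox 0 t)"
      by (simp add: right_diff_distrib)
    then have "norm (integral {0..t} (\<lambda>u. e u * e u)) \<le> M * \<delta> * measure lborel (cbox 0 t)"
    proof (rule has_integral_bound[rotated])
      show "0 \<le> M * \<delta>" using M \<open>\<delta> > 0\<close> by simp
      show "norm (e u * (e u - g u)) \<le> M * \<delta>" if "u \<in> cbox 0 t" for u
        unfolding norm_mult using M(2)[of u] g[of u] M(1) that by (intro mult_mono) auto
    qed
    also have "\<dots> = M * t * \<delta>" using \<open>0 < t\<close> by simp
    also have "\<dots> \<le> (M * t + 1) * \<delta>" using \<open>\<delta> > 0\<close> by simp
    also have "\<dots> = \<epsilon>" using Mt by (simp add: \<delta>_def)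
    finally show "integral {0..t} (\<lambda>u. e u * e u) \<le> 0 + \<epsilon>" by simp
  qed
  moreover have "0 \<le> integral {0..t} (\<lambda>u. e u * e u)"
    by (rule integral_nonneg[OF integrable_continuous_interval[OF c2]]) simp
  ultimately have "e u * e u = 0"
    using integral_eq_0_iff[OF c2 \<open>0 < t\<close>] u by simp
  then show ?thesis by simp
qed

section \<open>Words whose coordinates separate stopped paths\<close>

type_synonym 'm feature_index = "('m \<times> nat) option"

text \<open>The path letter comes first, so it is the innermost integral. At least one time
  integration always follows: it makes the coordinate Lipschitz in time as well, and such
  coordinates already determine all moments.\<close>

fun feature_word :: "'m feature_index \<Rightarrow> 'm option list" where
  "feature_word None = [None]"
| "feature_word (Some (i, k)) = Some i # replicate (Suc k) None"

text \<open>The path enters centred at its starting value because a signature sees increments only.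
  Separation of paths therefore relies on a common initial value.\<close>

fun feature :: "real \<times> (real \<Rightarrow> real ^ 'm) \<Rightarrow> 'm feature_index \<Rightarrow> real" where
  "feature (t, y) None = t"
| "feature (t, y) (Some (i, k)) = iter_int (Suc k) (\<lambda>s. y s $ i - y 0 $ i) t"

lemma continuous_on_centered:
  fixes y :: "real \<Rightarrow> real ^ 'm"
  assumes "y \<in> holder_paths \<alpha> T" "0 < \<alpha>"
  shows "continuous_on {0..T} (\<lambda>s. y s $ i - y 0 $ i)"
  by (intro continuous_on_diff continuous_on_component continuous_on_const
      holder_on_imp_continuous_on[OF holder_paths_imp_holder_on[OF assms(1)] assms(2)]) simp

lemma signature_feature_word:
  fixes y :: "real \<Rightarrow> real ^ 'm"
  assumes y: "y \<in> holder_paths \<alpha> T" "0 < \<alpha>" and t: "t \<in> {0..T}"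
  shows "signature (time_extend y) t (feature_word q) = feature (t, y) q"
proof (cases q)
  case None
  have "rs_primitive (sig_rev (time_extend y) []) (\<lambda>s. time_extend y s $ None) (\<lambda>s. s) 0 T"
    by (auto simp: rs_primitive_def time_extend_def intro!: exI[of _ 1])
  from rs_integral_primitive(2)[OF this, of 0 t] show ?thesis
    using t None by (simp add: signature_def)
next
  case (Some p)
  obtain i k where p: "p = (i, k)" by (cases p)
  define e where "e = (\<lambda>s. y s $ i - y 0 $ i)"
  have cont: "continuous_on {0..T} e"
    unfolding e_def using continuous_on_centered[OF y] by simp
  \<comment> \<open>On the reversed word the time letters stand in front, so each unfolding of
    \<open>sig_rev\<close> is one time integration.\<close>
  have "sig_rev (time_extend y) (replicate n None @ [Some i]) u = iter_int n e u" if "u \<in> {0..T}" for n u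
    using that
  proof (induction n arbitrary: u)
    case 0
    have "rs_primitive (sig_rev (time_extend y) []) (\<lambda>s. time_extend y s $ Some i) (\<lambda>s. y s $ i) 0 T"
      by (auto simp: rs_primitive_def time_extend_def intro!: exI[of _ 1])
    from rs_integral_primitive(2)[OF this, of 0 u] show ?case
      using 0 by (simp add: e_def)
  next
    case (Suc n)
    have "rs_primitive (iter_int n e) (\<lambda>s. time_extend y s $ None) (iter_int (Suc n) e) 0 T"
      using rs_primitive_time[OF continuous_on_iter_int[OF cont]] by (simp add: time_extend_def)
    then have "rs_primitive (sig_rev (time_extend y) (replicate n None @ [Some i]))
        (\<lambda>s. time_extend y s $ None) (iter_int (Suc n) e) 0 T"
      by (rule rs_primitive_cong) (use Suc.IH in simp)
    from rs_integral_primitive(2)[OF this, of 0 u] show ?case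
      using Suc.prems by simp
  qed
  from this[OF t, of "Suc k"] show ?thesis
    unfolding Some p feature_word.simps feature.simps signature_def e_def
    by (simp only: rev.simps rev_replicate)
qed

lemma feature_stopped:
  assumes "t \<in> {0..T}"
  shows "feature (t, stopped T t y) q = feature (t, y) q"
proof (cases q)
  case (Some p)
  obtain i k where p: "p = (i, k)" by (cases p)
  show ?thesis
    unfolding Some p feature.simps
    by (rule iter_int_local) (use assms in \<open>auto simp: stopped_def\<close>)
qed simp

text \<open>Iterated integration is linear and bounded in the supremum norm, so the coordinate sees
  only the centred difference of the paths up to \<open>t\<close>. This non-anticipative form is
  what the Lipschitz condition on coefficients asks for.\<close>

lemma feature_diff:
  fixes y z :: "real \<Rightarrow> real ^ 'm"
  assumes y: "y \<in> holder_paths \<alpha> T" and z: "z \<in> holder_paths \<alpha> T" and "0 < \<alpha>" and t: "t \<in> {0..T}"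
    and D: "0 \<le> D" "\<And>u. u \<in> {0..t} \<Longrightarrow> norm (y u - z u - (y 0 - z 0)) \<le> D"
  shows "\<bar>feature (t, y) (Some (i, k)) - feature (t, z) (Some (i, k))\<bar> \<le> D * T ^ Suc k"
proof -
  define e1 e2 where "e1 = (\<lambda>s. y s $ i - y 0 $ i)" and "e2 = (\<lambda>s. z s $ i - z 0 $ i)"
  have c: "continuous_on {0..T} e1" "continuous_on {0..T} e2"
    unfolding e1_def e2_def
    by (rule continuous_on_centered[OF y \<open>0 < \<alpha>\<close>] continuous_on_centered[OF z \<open>0 < \<alpha>\<close>])+
  have "\<bar>iter_int (Suc k) (\<lambda>s. e1 s - e2 s) t\<bar> \<le> D * T ^ Suc k"
  proof (rule iter_int_bound[OF _ _ D(1)])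
    show "continuous_on {0..T} (\<lambda>s. e1 s - e2 s)" by (intro continuous_on_diff c)
    fix u assume u: "u \<in> {0..t}"
    have "\<bar>e1 u - e2 u\<bar> = \<bar>(y u - z u - (y 0 - z 0)) $ i\<bar>" by (simp add: e1_def e2_def)
    also have "\<dots> \<le> D" using component_le_norm_cart[of "y u - z u - (y 0 - z 0)" i] D(2)[OF u] by linarith
    finally show "\<bar>e1 u - e2 u\<bar> \<le> D" .
  qed (use t in auto)
  moreover have "iter_int (Suc k) (\<lambda>s. e1 s - e2 s) t = iter_int (Suc k) e1 t - iter_int (Suc k) e2 t"
    by (rule iter_int_diff[OF c]) (use t in auto)
  ultimately show ?thesis unfolding feature.simps e1_def e2_def by simp
qed

lemma feature_inj_on:
  fixes w0 :: "real ^ 'm"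
  assumes "0 < \<alpha>" "0 \<le> R" "0 \<le> T"
  shows "inj_on feature (stopped_ball \<alpha> T w0 R)"
proof (rule inj_onI)
  fix p q assume p: "p \<in> stopped_ball \<alpha> T w0 R" and q: "q \<in> stopped_ball \<alpha> T w0 R" and eq: "feature p = feature q"
  obtain t y s z where pq: "p = (t, y)" "q = (s, z)" by (cases p; cases q)
  have st: "s = t" using fun_cong[OF eq, of None] by (simp add: pq)
  have t: "t \<in> {0..T}" and yz: "y \<in> holder_ball \<alpha> T w0 R" "z \<in> holder_ball \<alpha> T w0 R"
    and stop: "y = stopped T t y" "z = stopped T t z"
    using p q by (auto simp: stopped_ball_def pq st)
  have paths: "y \<in> holder_paths \<alpha> T" "z \<in> holder_paths \<alpha> T" using yz holder_ball_subset[OF assms(2)] by blast+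
  have y0: "y 0 = w0" "z 0 = w0" using yz by (auto simp: holder_ball_def)
  have eqt: "y u = z u" if u: "u \<in> {0..t}" for u
  proof (cases "t = 0")
    \<comment> \<open>There is no interval to integrate over; the common initial value
      decides.\<close>
    case True
    then show ?thesis using u y0 by auto
  next
    case False
    have "y u $ i = z u $ i" for i
    proof -
      define e1 e2 where "e1 = (\<lambda>s. y s $ i - y 0 $ i)" and "e2 = (\<lambda>s. z s $ i - z 0 $ i)"
      have c: "continuous_on {0..T} e1" "continuous_on {0..T} e2"
        unfolding e1_def e2_def
        by (rule continuous_on_centered[OF paths(1) \<open>0 < \<alpha>\<close>] continuous_on_centered[OF paths(2) \<open>0 < \<alpha>\<close>])+
      have ct: "continuous_on {0..t} (\<lambda>s. e1 s - e2 s)"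
        by (rule continuous_on_subset[OF continuous_on_diff[OF c]]) (use t in auto)
      have "iter_int (Suc k) (\<lambda>s. e1 s - e2 s) t = 0" for k
      proof -
        have "iter_int (Suc k) (\<lambda>s. e1 s - e2 s) t = iter_int (Suc k) e1 t - iter_int (Suc k) e2 t"
          by (rule iter_int_diff[OF c]) (use t in auto)
        also have "\<dots> = 0"
          using fun_cong[OF eq, of "Some (i, k)"] unfolding pq st feature.simps e1_def e2_def by simp
        finally show ?thesis .
      qed
      then have "((\<lambda>u. (e1 u - e2 u) * u ^ n) has_integral 0) {0..t}" for n
        using iter_int_moments[OF ct, of 0 n] t by simp
      then have "e1 u - e2 u = 0"
        using zero_if_moments_zero[OF ct _ _ u] False t by simp
      then show ?thesis by (simp add: e1_def e2_def y0)
    qed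
    then show ?thesis by (simp add: vec_eq_iff)
  qed
  have "y u = z u" for u
    using fun_cong[OF stop(1), of u] fun_cong[OF stop(2), of u] eqt[of "min u t"] t
    by (cases "u \<in> {0..T}") (auto simp: stopped_def)
  then show "p = q" by (auto simp: pq st)
qed

text \<open>The product topology reduces the claim to single coordinates. Each is Lipschitz on the
  ball: first the path is changed at a fixed time, then the time along a fixed path.\<close>

lemma continuous_feature:
  fixes w0 :: "real ^ 'm"
  assumes "0 < \<beta>" "\<beta> < \<alpha>" "0 \<le> R" "0 \<le> T"
  shows "continuous_map (subtopology (stopped_topology \<alpha> \<beta> T) (stopped_ball \<alpha> T w0 R)) euclidean feature"
proof -
  interpret P: Metric_space "stopped_paths \<alpha> T :: (real \<times> (real \<Rightarrow> real ^ 'm)) set" "stopped_dist \<beta> T"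
    by (rule Metric_space_stopped) (use assms in auto)
  have sub: "stopped_ball \<alpha> T w0 R \<subseteq> stopped_paths \<alpha> T" by (rule stopped_ball_subset[OF assms(3)])
  interpret Submetric "stopped_paths \<alpha> T" "stopped_dist \<beta> T" "stopped_ball \<alpha> T w0 R"
    by unfold_locales (rule sub)
  have top: "subtopology (stopped_topology \<alpha> \<beta> T) (stopped_ball \<alpha> T w0 R) = sub.mtopology"
    unfolding stopped_topology_def by (rule mtopology_submetric[symmetric])
  have "continuous_map sub.mtopology euclidean (\<lambda>p. feature p q)" for q
  proof -
    obtain C where C: "0 \<le> C" "\<And>p p'. p \<in> stopped_ball \<alpha> T w0 R \<Longrightarrow> p' \<in> stopped_ball \<alpha> T w0 R \<Longrightarrow>
      \<bar>feature p q - feature p' q\<bar> \<le> C * stopped_dist \<beta> T p p'"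
    proof (cases q)
      case None
      show thesis
        by (rule that[of 1]) (auto simp: None stopped_dist_def stopped_ball_def)
    next
      case (Some ik)
      obtain i k where ik: "ik = (i, k)" by (cases ik)
      \<comment> \<open>\<open>A\<close> bounds the integrand of the outermost time integral, hence
        the rate of change in time. In \<open>B\<close>, the factor
        \<open>1 + T powr \<beta>\<close> passes from the Hoelder distance to the supremum norm, 2
        comes from centring and \<open>T ^ Suc k\<close> from the integrations.\<close>
      define A where "A = R * T powr \<alpha> * T ^ k"
      define B where "B = 2 * (1 + T powr \<beta>) * T ^ Suc k"
      have A0: "0 \<le> A" "0 \<le> B" using assms by (auto simp: A_def B_def)
      show thesis
      proof (rule that[of "A + B"])
        show "0 \<le> A + B" using A0 by simp
        fix p p' assume pp: "p \<in> stopped_ball \<alpha> T w0 R" "p' \<in> stopped_ball \<alpha> T w0 R"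
        obtain t y s z where pq: "p = (t, y)" "p' = (s, z)" by (cases p; cases p')
        have t: "t \<in> {0..T}" "s \<in> {0..T}" and yz: "y \<in> holder_ball \<alpha> T w0 R" "z \<in> holder_ball \<alpha> T w0 R"
          using pp by (auto simp: stopped_ball_def pq)
        have paths: "y \<in> holder_paths \<alpha> T" "z \<in> holder_paths \<alpha> T" using yz holder_ball_subset[OF assms(3)] by blast+
        define d where "d = holder_dist \<beta> T y z"
        have pw: "norm (y u - z u) \<le> (1 + T powr \<beta>) * d" if "u \<in> {0..T}" for u
          unfolding d_def by (rule holder_dist_pointwise[OF holder_sup_diff_paths that]) (use paths assms in auto)
        have 1: "\<bar>feature (t, y) q - feature (t, z) q\<bar> \<le> (2 * (1 + T powr \<beta>) * d) * T ^ Suc k"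
          unfolding Some ik
        proof (rule feature_diff[OF paths _ t(1)])
          fix u assume "u \<in> {0..t}"
          then have "norm (y u - z u - (y 0 - z 0)) \<le> (1 + T powr \<beta>) * d + (1 + T powr \<beta>) * d"
            using t by (intro order_trans[OF norm_triangle_ineq4] add_mono pw) auto
          then show "norm (y u - z u - (y 0 - z 0)) \<le> 2 * (1 + T powr \<beta>) * d" by (simp add: algebra_simps)
        qed (use assms in \<open>auto simp: d_def\<close>)
        define e where "e = (\<lambda>s. z s $ i - z 0 $ i)"
        have ce: "continuous_on {0..T} e"
          unfolding e_def by (rule continuous_on_centered[OF paths(2)]) (use assms in simp)
        have eb: "\<bar>e u\<bar> \<le> R * T powr \<alpha>" if u: "u \<in> {0..T}" for u
        proof -
          have "\<bar>(z u - z 0) $ i\<bar> \<le> norm (z u - z 0)" by (rule component_le_norm_cart)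
          also have "\<dots> \<le> R * (u - 0) powr \<alpha>"
            by (rule holder_onD[of \<alpha> R 0 T]) (use yz u in \<open>auto simp: holder_ball_def\<close>)
          also have "\<dots> \<le> R * T powr \<alpha>" using u assms by (intro mult_left_mono powr_mono2) auto
          finally show ?thesis by (simp add: e_def)
        qed
        have inc: "\<bar>iter_int (Suc k) e v - iter_int (Suc k) e u\<bar> \<le> A * (v - u)" if uv: "0 \<le> u" "u \<le> v" "v \<le> T" for u v
        proof -
          have "\<bar>integral {0..v} (\<lambda>r. iter_int k e r * 1) - integral {0..u} (\<lambda>r. iter_int k e r * 1) - 0 * (v - u)\<bar> \<le> A * (v - u)"
          proof (rule integral_mult_increment[OF continuous_on_iter_int[OF ce] _ _ uv])
            fix r assume r: "u \<le> r" "r \<le> v"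
            have "\<bar>iter_int k e r\<bar> \<le> A"
              unfolding A_def by (rule iter_int_bound[OF ce]) (use eb r uv assms in auto)
            then show "\<bar>iter_int k e r - 0\<bar> * \<bar>1\<bar> \<le> A" by simp
          qed (auto intro: derivative_eq_intros)
          then show ?thesis by simp
        qed
        have 2: "\<bar>feature (t, z) q - feature (s, z) q\<bar> \<le> A * \<bar>t - s\<bar>"
          unfolding Some ik feature.simps e_def[symmetric]
          using inc[of s t] inc[of t s] t by (cases "s \<le> t") (auto simp: abs_minus_commute)
        have sd: "stopped_dist \<beta> T p p' = \<bar>t - s\<bar> + d" by (simp add: stopped_dist_def pq d_def)
        have d0: "0 \<le> d" by (simp add: d_def)
        have "\<bar>feature p q - feature p' q\<bar> \<le> A * \<bar>t - s\<bar> + B * d"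
          using 1 2 unfolding pq B_def by (simp add: mult_ac del: feature.simps)
        also have "\<dots> \<le> (A + B) * stopped_dist \<beta> T p p'"
          unfolding sd using A0 d0 by (simp add: algebra_simps)
        finally show "\<bar>feature p q - feature p' q\<bar> \<le> (A + B) * stopped_dist \<beta> T p p'" .
      qed
    qed
    have "continuous_map sub.mtopology Met_TC.mtopology (\<lambda>p. feature p q)"
      unfolding sub.metric_continuous_map[OF Met_TC.Metric_space_axioms]
    proof (intro conjI ballI allI impI)
      fix a and \<epsilon> :: real assume a: "a \<in> stopped_ball \<alpha> T w0 R" and "0 < \<epsilon>"
      show "\<exists>\<delta>>0. \<forall>x. x \<in> stopped_ball \<alpha> T w0 R \<and> stopped_dist \<beta> T a x < \<delta> \<longrightarrow> dist (feature a q) (feature x q) < \<epsilon>"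
      proof (intro exI[of _ "\<epsilon> / (C + 1)"] conjI allI impI)
        fix x assume x: "x \<in> stopped_ball \<alpha> T w0 R \<and> stopped_dist \<beta> T a x < \<epsilon> / (C + 1)"
        then have "\<bar>feature a q - feature x q\<bar> \<le> C * stopped_dist \<beta> T a x" using C a by blast
        also have "\<dots> \<le> C * (\<epsilon> / (C + 1))" using x C by (intro mult_left_mono) auto
        also have "\<dots> < \<epsilon>" using C \<open>0 < \<epsilon>\<close> by (simp add: field_simps)
        finally show "dist (feature a q) (feature x q) < \<epsilon>" by (simp add: dist_real_def)
      qed (use C \<open>0 < \<epsilon>\<close> in auto)
    qed simp
    then show ?thesis by simp
  qed
  then show ?thesis
    unfolding top euclidean_product_topology[symmetric] continuous_map_componentwise_UNIV by simp
qed

section \<open>Density of bounded entire maps\<close>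

text \<open>Dependence on finitely many coordinates replaces a norm on the infinite product, so that
  finitely many coordinate estimates combine into one Lipschitz constant for the coefficient.
  Uniform approximation alone would not provide this, so it is built into the algebra.\<close>

definition lipschitz_coords :: "(('i \<Rightarrow> real) \<Rightarrow> real) \<Rightarrow> bool" where
  "lipschitz_coords h \<longleftrightarrow>
     (\<exists>L S. 0 \<le> L \<and> finite S \<and> (\<forall>u v. \<bar>h u - h v\<bar> \<le> L * (\<Sum>q\<in>S. \<bar>u q - v q\<bar>)))"

text \<open>Elements are functions of the coordinates, each realised by some series. Boundedness on
  the whole coordinate space is included because a product of Lipschitz functions is controlled only
  through bounds on its factors.\<close>

definition entire_features :: "(('m::finite feature_index \<Rightarrow> real) \<Rightarrow> real) set" where
  "entire_features = {h. (\<exists>l. bounded_entire l \<and>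
       (\<forall>g\<in>group_like. entire_map l g = h (\<lambda>q. g (feature_word q)))) \<and>
     bounded (range h) \<and> continuous_on UNIV h \<and> lipschitz_coords h}"

lemma sum_coords_mono:
  fixes u v :: "'i \<Rightarrow> real"
  assumes "finite S'" "S \<subseteq> S'" "0 \<le> L" "L \<le> L'"
  shows "L * (\<Sum>q\<in>S. \<bar>u q - v q\<bar>) \<le> L' * (\<Sum>q\<in>S'. \<bar>u q - v q\<bar>)"
  using assms by (intro mult_mono sum_mono2) (auto intro: sum_nonneg)

lemma lipschitz_coords_add:
  assumes "lipschitz_coords h1" "lipschitz_coords h2"
  shows "lipschitz_coords (\<lambda>u. h1 u + h2 u)"
proof -
  obtain L1 S1 where 1: "0 \<le> L1" "finite S1" "\<And>u v. \<bar>h1 u - h1 v\<bar> \<le> L1 * (\<Sum>q\<in>S1. \<bar>u q - v q\<bar>)"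
    using assms(1) unfolding lipschitz_coords_def by blast
  obtain L2 S2 where 2: "0 \<le> L2" "finite S2" "\<And>u v. \<bar>h2 u - h2 v\<bar> \<le> L2 * (\<Sum>q\<in>S2. \<bar>u q - v q\<bar>)"
    using assms(2) unfolding lipschitz_coords_def by blast
  have "\<bar>h1 u + h2 u - (h1 v + h2 v)\<bar> \<le> (L1 + L2) * (\<Sum>q\<in>S1 \<union> S2. \<bar>u q - v q\<bar>)" for u v
    using 1(3)[of u v] 2(3)[of u v] sum_coords_mono[of "S1 \<union> S2" S1 L1 L1 u v]
      sum_coords_mono[of "S1 \<union> S2" S2 L2 L2 u v] 1(1,2) 2(1,2)
    by (simp add: distrib_right)
  then show ?thesis unfolding lipschitz_coords_def using 1 2
    by (intro exI[of _ "L1 + L2"] exI[of _ "S1 \<union> S2"]) auto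
qed

lemma lipschitz_coords_mult:
  assumes "lipschitz_coords h1" "lipschitz_coords h2" "bounded (range h1)" "bounded (range h2)"
  shows "lipschitz_coords (\<lambda>u. h1 u * h2 u)"
proof -
  obtain L1 S1 where 1: "0 \<le> L1" "finite S1" "\<And>u v. \<bar>h1 u - h1 v\<bar> \<le> L1 * (\<Sum>q\<in>S1. \<bar>u q - v q\<bar>)"
    using assms(1) unfolding lipschitz_coords_def by blast
  obtain L2 S2 where 2: "0 \<le> L2" "finite S2" "\<And>u v. \<bar>h2 u - h2 v\<bar> \<le> L2 * (\<Sum>q\<in>S2. \<bar>u q - v q\<bar>)"
    using assms(2) unfolding lipschitz_coords_def by blast
  obtain B1 B2 where B: "0 < B1" "\<And>u. \<bar>h1 u\<bar> \<le> B1" "0 < B2" "\<And>u. \<bar>h2 u\<bar> \<le> B2"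
    using assms(3,4) unfolding bounded_pos by auto
  have "\<bar>h1 u * h2 u - h1 v * h2 v\<bar> \<le> (B1 * L2 + B2 * L1) * (\<Sum>q\<in>S1 \<union> S2. \<bar>u q - v q\<bar>)" for u v
  proof -
    let ?D = "\<Sum>q\<in>S1 \<union> S2. \<bar>u q - v q\<bar>"
    have D1: "\<bar>h1 u - h1 v\<bar> \<le> L1 * ?D" "\<bar>h2 u - h2 v\<bar> \<le> L2 * ?D"
      using 1(3)[of u v] 2(3)[of u v] sum_coords_mono[of "S1 \<union> S2" S1 L1 L1 u v]
        sum_coords_mono[of "S1 \<union> S2" S2 L2 L2 u v] 1(1,2) 2(1,2) by auto
    have "h1 u * h2 u - h1 v * h2 v = h1 u * (h2 u - h2 v) + h2 v * (h1 u - h1 v)"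
      by (simp add: algebra_simps)
    also have "\<bar>\<dots>\<bar> \<le> B1 * (L2 * ?D) + B2 * (L1 * ?D)"
      unfolding abs_mult[symmetric]
      by (rule order_trans[OF abs_triangle_ineq], unfold abs_mult, rule add_mono; rule mult_mono)
        (use B D1 in \<open>auto simp: less_imp_le\<close>)
    finally show ?thesis by (simp add: algebra_simps)
  qed
  then show ?thesis unfolding lipschitz_coords_def using 1 2 B
    by (intro exI[of _ "B1 * L2 + B2 * L1"] exI[of _ "S1 \<union> S2"]) auto
qed

lemma entire_features_sin:
  "(\<lambda>u. sin (r * u q)) \<in> (entire_features :: (('m::finite feature_index \<Rightarrow> real) \<Rightarrow> real) set)"
proof -
  have "feature_word q \<noteq> []" by (cases q rule: feature_word.cases) auto
  then have "\<exists>l. bounded_entire l \<and> (\<forall>g\<in>group_like. entire_map l g = sin (r * g (feature_word q)))"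
    using bounded_entire_sin[where w = "feature_word q" and r = r] by blast
  moreover have "bounded (range (\<lambda>u :: 'm feature_index \<Rightarrow> real. sin (r * u q)))"
    unfolding bounded_iff by (intro exI[of _ 1]) auto
  moreover have "continuous_on UNIV (\<lambda>u :: 'm feature_index \<Rightarrow> real. sin (r * u q))"
    by (intro continuous_on_sin continuous_on_mult continuous_on_const continuous_on_product_coordinates)
  moreover have "lipschitz_coords (\<lambda>u :: 'm feature_index \<Rightarrow> real. sin (r * u q))"
    unfolding lipschitz_coords_def
  proof (intro exI[of _ "\<bar>r\<bar>"] exI[of _ "{q}"] conjI allI)
    fix u v :: "'m feature_index \<Rightarrow> real"
    have "\<bar>sin (r * u q) - sin (r * v q)\<bar> \<le> \<bar>r * u q - r * v q\<bar>"
    proof -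
      have "\<bar>sin a - sin b\<bar> \<le> \<bar>a - b\<bar>" for a b :: real
      proof -
        have "\<bar>sin a - sin b\<bar> = 2 * \<bar>sin ((a - b) / 2)\<bar> * \<bar>cos ((a + b) / 2)\<bar>"
          by (simp add: sin_diff_sin abs_mult)
        also have "\<dots> \<le> 2 * \<bar>(a - b) / 2\<bar> * 1"
          by (intro mult_mono abs_sin_x_le_abs_x abs_cos_le_one) auto
        finally show ?thesis by simp
      qed
      then show ?thesis .
    qed
    then show "\<bar>sin (r * u q) - sin (r * v q)\<bar> \<le> \<bar>r\<bar> * (\<Sum>q\<in>{q}. \<bar>u q - v q\<bar>)"
      by (simp flip: right_diff_distrib abs_mult)
  qed auto
  ultimately show ?thesis by (simp add: entire_features_def)
qed

lemma function_ring_entire_features: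
  assumes "compact (C :: ('m::finite feature_index \<Rightarrow> real) set)"
  shows "function_ring_on entire_features C"
proof
  fix f g :: "('m feature_index \<Rightarrow> real) \<Rightarrow> real"
  assume f: "f \<in> entire_features"
  show "continuous_on C f" using f by (auto simp: entire_features_def intro: continuous_on_subset)
  assume g: "g \<in> entire_features"
  obtain l l' where l: "bounded_entire l" "\<And>x. x \<in> group_like \<Longrightarrow> entire_map l x = f (\<lambda>q. x (feature_word q))"
    and l': "bounded_entire l'" "\<And>x. x \<in> group_like \<Longrightarrow> entire_map l' x = g (\<lambda>q. x (feature_word q))"
    using f g by (auto simp: entire_features_def)
  obtain B B' where B: "0 < B" "\<And>u. \<bar>f u\<bar> \<le> B" "0 < B'" "\<And>u. \<bar>g u\<bar> \<le> B'"
    using f g unfolding entire_features_def bounded_pos by auto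
  have "bounded (range (\<lambda>x. f x + g x))"
    unfolding bounded_iff
  proof (intro exI[of _ "B + B'"] ballI)
    fix y assume "y \<in> range (\<lambda>x. f x + g x)"
    then show "norm y \<le> B + B'" using B(2,4) by (auto intro: order_trans[OF abs_triangle_ineq] add_mono)
  qed
  moreover have "\<exists>k. bounded_entire k \<and> (\<forall>x\<in>group_like. entire_map k x = f (\<lambda>q. x (feature_word q)) + g (\<lambda>q. x (feature_word q)))"
    using bounded_entire_add[OF l(1) l'(1)] l(2) l'(2) by (intro exI[of _ "\<lambda>w. l w + l' w"]) auto
  ultimately show "(\<lambda>x. f x + g x) \<in> entire_features"
    using f g by (auto simp: entire_features_def intro: continuous_on_add lipschitz_coords_add)
  have "bounded (range (\<lambda>x. f x * g x))"
    unfolding bounded_iff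
  proof (intro exI[of _ "B * B'"] ballI)
    fix y assume "y \<in> range (\<lambda>x. f x * g x)"
    then show "norm y \<le> B * B'" using B by (auto simp: abs_mult intro!: mult_mono)
  qed
  moreover have "\<exists>k. bounded_entire k \<and> (\<forall>x\<in>group_like. entire_map k x = f (\<lambda>q. x (feature_word q)) * g (\<lambda>q. x (feature_word q)))"
    using bounded_entire_shuffle[OF l(1) l'(1)] l(2) l'(2) by (intro exI[of _ "series_shuffle l l'"]) auto
  ultimately show "(\<lambda>x. f x * g x) \<in> entire_features"
    using f g by (auto simp: entire_features_def intro: continuous_on_mult lipschitz_coords_mult)
next
  fix c :: real
  have "lipschitz_coords (\<lambda>_ :: 'm feature_index \<Rightarrow> real. c)"
    unfolding lipschitz_coords_def by (intro exI[of _ 0] exI[of _ "{}"]) auto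
  then show "(\<lambda>_. c) \<in> (entire_features :: (('m feature_index \<Rightarrow> real) \<Rightarrow> real) set)"
    using bounded_entire_const[where c = c] by (auto simp: entire_features_def)
next
  fix x y :: "'m feature_index \<Rightarrow> real" assume "x \<noteq> y"
  then obtain q where q: "x q \<noteq> y q" by blast
  \<comment> \<open>Scaling by \<open>1 / m\<close> brings both coordinates into
    \<open>[-1, 1]\<close>, where the sine is injective.\<close>
  define m where "m = 1 + \<bar>x q\<bar> + \<bar>y q\<bar>"
  have m: "0 < m" "\<bar>x q\<bar> \<le> m" "\<bar>y q\<bar> \<le> m" by (auto simp: m_def)
  have b: "-1 \<le> 1 / m * x q" "1 / m * x q \<le> 1" "-1 \<le> 1 / m * y q" "1 / m * y q \<le> 1"
    using m by (auto simp: field_simps abs_le_iff)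
  have "sin (1 / m * x q) \<noteq> sin (1 / m * y q)"
  proof
    assume "sin (1 / m * x q) = sin (1 / m * y q)"
    then have "1 / m * x q = 1 / m * y q"
      by (rule sin_inj_pi[rotated 4]; use b pi_ge_two in linarith)
    then show False using q m by simp
  qed
  then show "\<exists>f\<in>entire_features. f x \<noteq> f y"
    using entire_features_sin[of "1 / m" q] by (intro bexI[of _ "\<lambda>u. sin (1 / m * u q)"]) auto
qed (rule assms)

text \<open>A continuous injection from a compact space into a Hausdorff space is a homeomorphism
  onto its image. Hence \<open>F\<close> becomes a continuous function on the compact set
  \<open>C\<close> of coordinate vectors, where the Stone-Weierstrass theorem applies.\<close>

lemma bounded_entire_dense:
  fixes w0 :: "real ^ 'm" and F :: "real \<times> (real \<Rightarrow> real ^ 'm) \<Rightarrow> real"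
  assumes "0 < \<beta>" "\<beta> < \<alpha>" "0 \<le> R" "0 \<le> T"
    and F: "continuous_map (stopped_topology \<alpha> \<beta> T) euclidean F" and "0 < \<epsilon>"
  obtains h where "h \<in> entire_features"
    "\<And>t y. t \<in> {0..T} \<Longrightarrow> y \<in> holder_ball \<alpha> T w0 R \<Longrightarrow>
      \<bar>F (t, stopped T t y) - h (feature (t, y))\<bar> < \<epsilon>"
proof -
  define X where "X = subtopology (stopped_topology \<alpha> \<beta> T) (stopped_ball \<alpha> T w0 R)"
  define C where "C = feature ` stopped_ball \<alpha> T w0 R"
  have comp: "compactin (stopped_topology \<alpha> \<beta> T) (stopped_ball \<alpha> T w0 R)"
    by (rule compactin_stopped_ball) (use assms in auto)
  then have topX: "topspace X = stopped_ball \<alpha> T w0 R"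
    unfolding X_def topspace_subtopology using compactin_subset_topspace[OF comp] by blast
  have compX: "compact_space X" unfolding X_def using comp by (rule compact_space_subtopology)
  have cont: "continuous_map X (top_of_set C) feature"
    unfolding continuous_map_in_subtopology
    using continuous_feature[OF assms(1-4), of w0] topX by (auto simp: X_def C_def)
  have "compactin euclidean C"
    unfolding C_def topX[symmetric]
    by (rule image_compactin[of X]) (use compX cont in \<open>auto simp: compact_space_def continuous_map_in_subtopology\<close>)
  then have "compact C" by simp
  have "homeomorphic_map X (top_of_set C) feature"
  proof (rule continuous_imp_homeomorphic_map[OF cont compX])
    show "Hausdorff_space (top_of_set C)" by (intro Hausdorff_space_subtopology Hausdorff_space_euclidean)
    show "feature ` topspace X = topspace (top_of_set C)" by (simp add: topX C_def)
    show "inj_on feature (topspace X)"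
      unfolding topX by (rule feature_inj_on) (use assms in auto)
  qed
  then obtain k where k: "homeomorphic_maps X (top_of_set C) feature k"
    unfolding homeomorphic_map_maps by blast
  have kf: "k (feature p) = p" if "p \<in> stopped_ball \<alpha> T w0 R" for p
    using k that by (simp add: homeomorphic_maps_def topX)
  have "continuous_map (top_of_set C) euclidean (F \<circ> k)"
  proof (rule continuous_map_compose)
    show "continuous_map (top_of_set C) X k" using k by (simp add: homeomorphic_maps_def)
    show "continuous_map X euclidean F" unfolding X_def by (rule continuous_map_from_subtopology[OF F])
  qed
  then have "continuous_on C (F \<circ> k)" by simp
  interpret function_ring_on "entire_features :: (('m feature_index \<Rightarrow> real) \<Rightarrow> real) set" C
    by (rule function_ring_entire_features[OF \<open>compact C\<close>])
  obtain h where h: "h \<in> entire_features" "\<forall>x\<in>C. \<bar>(F \<circ> k) x - h x\<bar> < \<epsilon>"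
    using Stone_Weierstrass_basic[OF \<open>continuous_on C (F \<circ> k)\<close> \<open>0 < \<epsilon>\<close>] by blast
  show thesis
  proof (rule that[OF h(1)])
    fix t y assume t: "t \<in> {0..T}" and y: "y \<in> holder_ball \<alpha> T w0 R"
    have p: "(t, stopped T t y) \<in> stopped_ball \<alpha> T w0 R"
      by (rule stopped_in_ball[OF y t]) (use assms in auto)
    then have "\<bar>F (t, stopped T t y) - h (feature (t, stopped T t y))\<bar> < \<epsilon>"
      using h(2) kf[OF p] by (auto simp: C_def)
    moreover have "feature (t, stopped T t y) = feature (t, y)"
      by (rule ext) (rule feature_stopped[OF t])
    ultimately show "\<bar>F (t, stopped T t y) - h (feature (t, y))\<bar> < \<epsilon>" by simp
  qed
qed

section \<open>Equations driven by Lipschitz paths\<close>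

lemma holder_on_exponent_mono:
  assumes "holder_on \<alpha> C a b y" "\<beta> \<le> \<alpha>" "0 \<le> C"
  shows "holder_on \<beta> (C * (b - a) powr (\<alpha> - \<beta>)) a b y"
  unfolding holder_on_def
proof (intro allI impI)
  fix s t assume st: "a \<le> s" "s \<le> t" "t \<le> b"
  have "norm (y t - y s) \<le> C * ((t - s) powr (\<alpha> - \<beta>) * (t - s) powr \<beta>)"
    using holder_onD[OF assms(1) st] by (simp flip: powr_add)
  also have "\<dots> \<le> C * ((b - a) powr (\<alpha> - \<beta>) * (t - s) powr \<beta>)"
    by (rule mult_left_mono[OF mult_right_mono[OF powr_mono2]]) (use st assms in auto)
  finally show "norm (y t - y s) \<le> C * (b - a) powr (\<alpha> - \<beta>) * (t - s) powr \<beta>" by (simp add: mult.assoc)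
qed

text \<open>Hoelder bounds with an exponential weight make the Picard map a global contraction.\<close>

definition weighted_holder ::
  "real \<Rightarrow> real \<Rightarrow> real \<Rightarrow> real \<Rightarrow> (real \<Rightarrow> 'b::real_normed_vector) \<Rightarrow> bool" where
  "weighted_holder \<beta> \<rho> M T h \<longleftrightarrow>
     (\<forall>s t. 0 \<le> s \<longrightarrow> s \<le> t \<longrightarrow> t \<le> T \<longrightarrow> norm (h t - h s) \<le> M * exp (\<rho> * t) * (t - s) powr \<beta>)"

text \<open>The weight sits at the right endpoint and increases, so on \<open>[0, s]\<close> its
  largest value is the one at \<open>s\<close>.\<close>

lemma weighted_holder_imp_holder_on:
  assumes "weighted_holder \<beta> \<rho> M T h" "0 \<le> M" "0 \<le> \<rho>" "s \<le> T"
  shows "holder_on \<beta> (M * exp (\<rho> * s)) 0 s h"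
  unfolding holder_on_def
proof (intro allI impI)
  fix u t assume ut: "0 \<le> u" "u \<le> t" "t \<le> s"
  then have "norm (h t - h u) \<le> M * exp (\<rho> * t) * (t - u) powr \<beta>"
    using assms(1,4) by (simp add: weighted_holder_def)
  also have "\<dots> \<le> M * exp (\<rho> * s) * (t - u) powr \<beta>"
    using ut assms by (intro mult_right_mono mult_left_mono) (auto intro: mult_left_mono)
  finally show "norm (h t - h u) \<le> M * exp (\<rho> * s) * (t - u) powr \<beta>" .
qed

lemma holder_on_imp_weighted_holder:
  assumes "holder_on \<beta> M 0 T h" "0 \<le> M" "0 \<le> \<rho>"
  shows "weighted_holder \<beta> \<rho> M T h"
  unfolding weighted_holder_def
proof (intro allI impI)
  fix s t assume st: "0 \<le> s" "s \<le> t" "t \<le> T"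
  have "norm (h t - h s) \<le> M * 1 * (t - s) powr \<beta>" using holder_onD[OF assms(1) st] by simp
  also have "\<dots> \<le> M * exp (\<rho> * t) * (t - s) powr \<beta>"
    using st assms by (intro mult_right_mono mult_left_mono) auto
  finally show "norm (h t - h s) \<le> M * exp (\<rho> * t) * (t - s) powr \<beta>" .
qed

lemma weighted_holder_mono:
  assumes "weighted_holder \<beta> \<rho> M T h" "M \<le> M'"
  shows "weighted_holder \<beta> \<rho> M' T h"
  unfolding weighted_holder_def
proof (intro allI impI)
  fix s t assume st: "0 \<le> s" "s \<le> t" "t \<le> T"
  then have "norm (h t - h s) \<le> M * exp (\<rho> * t) * (t - s) powr \<beta>"
    using assms(1) by (simp add: weighted_holder_def)
  also have "\<dots> \<le> M' * exp (\<rho> * t) * (t - s) powr \<beta>"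
    using assms(2) by (intro mult_right_mono) auto
  finally show "norm (h t - h s) \<le> M' * exp (\<rho> * t) * (t - s) powr \<beta>" .
qed

section \<open>Increments of the exponential weight\<close>

lemma exp_increment_le:
  fixes \<rho> s t :: real
  assumes "0 < \<rho>" "s \<le> t"
  shows "exp (\<rho> * s) * (t - s) \<le> (exp (\<rho> * t) - exp (\<rho> * s)) / \<rho>"
    and "(exp (\<rho> * t) - exp (\<rho> * s)) / \<rho> \<le> exp (\<rho> * t) * (t - s)"
proof -
  have "exp (\<rho> * s) * (1 + \<rho> * (t - s)) \<le> exp (\<rho> * s) * exp (\<rho> * (t - s))"
    by (intro mult_left_mono exp_ge_add_one_self) auto
  also have "\<dots> = exp (\<rho> * t)" by (simp add: right_diff_distrib flip: exp_add)
  finally show "exp (\<rho> * s) * (t - s) \<le> (exp (\<rho> * t) - exp (\<rho> * s)) / \<rho>"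
    using assms by (simp add: field_simps)
  have "exp (\<rho> * t) * (1 + (- (\<rho> * (t - s)))) \<le> exp (\<rho> * t) * exp (- (\<rho> * (t - s)))"
    by (intro mult_left_mono exp_ge_add_one_self) auto
  also have "\<dots> = exp (\<rho> * s)" by (simp add: right_diff_distrib flip: exp_add)
  finally show "(exp (\<rho> * t) - exp (\<rho> * s)) / \<rho> \<le> exp (\<rho> * t) * (t - s)"
    using assms by (simp add: field_simps)
qed

text \<open>This is the source of the gain in \<rho>. On intervals of length at most
  \<open>1 / \<rho>\<close> the linear bound is interpolated; on longer ones
  \<open>exp (\<rho> * t) / \<rho>\<close> is enough, because \<open>(t - s) powr \<beta>\<close> is
  at least \<open>(1 / \<rho>) powr \<beta>\<close>.\<close>

lemma exp_increment_holder:
  fixes \<rho> \<beta> s t :: real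
  assumes "0 < \<rho>" "s \<le> t" "0 < \<beta>" "\<beta> < 1"
  shows "(exp (\<rho> * t) - exp (\<rho> * s)) / \<rho> \<le> \<rho> powr (\<beta> - 1) * exp (\<rho> * t) * (t - s) powr \<beta>"
proof (cases "t - s \<le> 1 / \<rho>")
  case True
  have "t - s = (t - s) powr (1 - \<beta>) * (t - s) powr \<beta>" using assms by (simp flip: powr_add)
  also have "\<dots> \<le> (1 / \<rho>) powr (1 - \<beta>) * (t - s) powr \<beta>"
    using True assms by (intro mult_right_mono powr_mono2) auto
  also have "(1 / \<rho>) powr (1 - \<beta>) = \<rho> powr (\<beta> - 1)"
    using assms by (simp add: powr_divide powr_minus_divide[symmetric])
  finally have "exp (\<rho> * t) * (t - s) \<le> exp (\<rho> * t) * (\<rho> powr (\<beta> - 1) * (t - s) powr \<beta>)"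
    by (intro mult_left_mono) auto
  with exp_increment_le(2)[OF assms(1,2)]
  have "(exp (\<rho> * t) - exp (\<rho> * s)) / \<rho> \<le> exp (\<rho> * t) * (\<rho> powr (\<beta> - 1) * (t - s) powr \<beta>)"
    by (rule order_trans)
  then show ?thesis by (simp only: mult_ac)
next
  case False
  have "1 / \<rho> = (1 / \<rho>) powr (1 - \<beta>) * (1 / \<rho>) powr \<beta>" using assms by (simp flip: powr_add)
  also have "\<dots> \<le> (1 / \<rho>) powr (1 - \<beta>) * (t - s) powr \<beta>"
    using False assms by (intro mult_left_mono powr_mono2) auto
  also have "(1 / \<rho>) powr (1 - \<beta>) = \<rho> powr (\<beta> - 1)"
    using assms by (simp add: powr_divide powr_minus_divide[symmetric])
  finally have "exp (\<rho> * t) * (1 / \<rho>) \<le> exp (\<rho> * t) * (\<rho> powr (\<beta> - 1) * (t - s) powr \<beta>)"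
    by (intro mult_left_mono) auto
  moreover have "(exp (\<rho> * t) - exp (\<rho> * s)) / \<rho> \<le> exp (\<rho> * t) * (1 / \<rho>)"
    using assms by (simp add: field_simps)
  ultimately have "(exp (\<rho> * t) - exp (\<rho> * s)) / \<rho> \<le> exp (\<rho> * t) * (\<rho> powr (\<beta> - 1) * (t - s) powr \<beta>)"
    by linarith
  then show ?thesis by (simp only: mult_ac)
qed

lemma small_rate:
  fixes \<beta> K :: real
  assumes "\<beta> < 1" "0 \<le> K"
  obtains \<rho> where "0 < \<rho>" "K * \<rho> powr (\<beta> - 1) \<le> 1 / 2"
\<comment> \<open>The rate is chosen so that \<open>\<rho> powr (\<beta> - 1)\<close> equals
  \<open>1 / (2 * K + 1)\<close>.\<close>
proof (rule that[of "(2 * K + 1) powr (1 / (1 - \<beta>))"])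
  have "1 / (1 - \<beta>) * (\<beta> - 1) = - 1" using assms by (simp add: field_simps)
  then have "((2 * K + 1) powr (1 / (1 - \<beta>))) powr (\<beta> - 1) = (2 * K + 1) powr (- 1)"
    by (simp only: powr_powr)
  also have "\<dots> = 1 / (2 * K + 1)" using assms by (simp add: powr_minus_divide)
  finally have eq: "((2 * K + 1) powr (1 / (1 - \<beta>))) powr (\<beta> - 1) = 1 / (2 * K + 1)" .
  show "K * ((2 * K + 1) powr (1 / (1 - \<beta>))) powr (\<beta> - 1) \<le> 1 / 2"
    unfolding eq using assms by (simp add: field_simps)
qed (use assms in simp)

text \<open>The common interface of functional and signature coefficients. The Lipschitz bound looks
  at \<open>[0, s]\<close> only, so a weighted bound can be inserted with the value
  \<open>M * exp (\<rho> * s)\<close>. The constant may depend on \<open>R\<close> and on the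
  coefficient.\<close>

definition regular_coeff ::
  "real \<Rightarrow> real \<Rightarrow> real \<Rightarrow> real ^ 'm \<Rightarrow> ((real \<Rightarrow> real ^ 'm) \<Rightarrow> real \<Rightarrow> 'm \<Rightarrow> 'd \<Rightarrow> real) \<Rightarrow> bool" where
  "regular_coeff \<alpha> \<beta> T w0 F \<longleftrightarrow>
     (\<forall>y\<in>holder_paths \<alpha> T. y 0 = w0 \<longrightarrow> (\<forall>i j. continuous_on {0..T} (\<lambda>s. F y s i j))) \<and>
     (\<forall>R\<ge>0. \<forall>i j. \<exists>L\<ge>0. \<forall>y\<in>holder_ball \<alpha> T w0 R. \<forall>z\<in>holder_ball \<alpha> T w0 R. \<forall>s\<in>{0..T}. \<forall>A\<ge>0.
        holder_on \<beta> A 0 s (\<lambda>r. y r - z r) \<longrightarrow> \<bar>F y s i j - F z s i j\<bar> \<le> L * A)"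

lemma regular_coeff_lipschitz:
  fixes F :: "(real \<Rightarrow> real ^ 'm) \<Rightarrow> real \<Rightarrow> 'm \<Rightarrow> 'd::finite \<Rightarrow> real"
  assumes "regular_coeff \<alpha> \<beta> T w0 F" "0 \<le> R"
  obtains L where "0 \<le> L" "\<And>y z s A i j. y \<in> holder_ball \<alpha> T w0 R \<Longrightarrow> z \<in> holder_ball \<alpha> T w0 R \<Longrightarrow>
    s \<in> {0..T} \<Longrightarrow> 0 \<le> A \<Longrightarrow> holder_on \<beta> A 0 s (\<lambda>r. y r - z r) \<Longrightarrow> \<bar>F y s i j - F z s i j\<bar> \<le> L * A"
proof -
  define P where "P i j L \<longleftrightarrow> 0 \<le> L \<and> (\<forall>y\<in>holder_ball \<alpha> T w0 R. \<forall>z\<in>holder_ball \<alpha> T w0 R. \<forall>s\<in>{0..T}. \<forall>A\<ge>0.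
        holder_on \<beta> A 0 s (\<lambda>r. y r - z r) \<longrightarrow> \<bar>F y s i j - F z s i j\<bar> \<le> L * A)" for i j L
  have "\<forall>i j. \<exists>L. P i j L" using assms unfolding regular_coeff_def P_def by blast
  then obtain L where P: "\<And>i j. P i j (L i j)" by metis
  then have L: "0 \<le> L i j" "\<forall>y\<in>holder_ball \<alpha> T w0 R. \<forall>z\<in>holder_ball \<alpha> T w0 R. \<forall>s\<in>{0..T}. \<forall>A\<ge>0.
        holder_on \<beta> A 0 s (\<lambda>r. y r - z r) \<longrightarrow> \<bar>F y s i j - F z s i j\<bar> \<le> L i j * A" for i j
    unfolding P_def by blast+
  have le: "L i j \<le> (\<Sum>i\<in>UNIV. \<Sum>j\<in>UNIV. L i j)" for i j
  proof -
    have "L i j \<le> (\<Sum>j\<in>UNIV. L i j)" using L(1) by (intro member_le_sum) auto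
    also have "\<dots> \<le> (\<Sum>i\<in>UNIV. \<Sum>j\<in>UNIV. L i j)"
      using L(1) by (intro member_le_sum[of i UNIV "\<lambda>i. \<Sum>j\<in>UNIV. L i j"]) (auto intro: sum_nonneg)
    finally show ?thesis .
  qed
  show thesis
  proof (rule that[of "\<Sum>i\<in>UNIV. \<Sum>j\<in>UNIV. L i j"])
    show "0 \<le> (\<Sum>i\<in>UNIV. \<Sum>j\<in>UNIV. L i j)" using L(1) by (intro sum_nonneg) auto
    fix y z s A i j
    assume "y \<in> holder_ball \<alpha> T w0 R" "z \<in> holder_ball \<alpha> T w0 R" "s \<in> {0..T}" "0 \<le> (A::real)"
      "holder_on \<beta> A 0 s (\<lambda>r. y r - z r)"
    then have "\<bar>F y s i j - F z s i j\<bar> \<le> L i j * A" using L(2) by blast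
    also have "\<dots> \<le> (\<Sum>i\<in>UNIV. \<Sum>j\<in>UNIV. L i j) * A" using le \<open>0 \<le> A\<close> by (intro mult_right_mono)
    finally show "\<bar>F y s i j - F z s i j\<bar> \<le> (\<Sum>i\<in>UNIV. \<Sum>j\<in>UNIV. L i j) * A" .
  qed
qed

section \<open>The Picard map: stability, uniqueness and fixed points\<close>

locale driven_equation =
  fixes T0 T1 \<alpha> \<beta> Bx Bw :: real and w0 :: "real ^ 'm" and x :: "real \<Rightarrow> real ^ 'd" and w :: "real \<Rightarrow> real ^ 'm"
  assumes T: "0 \<le> T0" "T0 < T1" and \<beta>: "0 < \<beta>" "\<beta> < \<alpha>" and \<alpha>: "\<alpha> < 1"
    and B: "0 \<le> Bx" "0 \<le> Bw"
    and x: "holder_on 1 Bx 0 T1 x" and w: "holder_on \<alpha> Bw 0 T0 w" and w0: "w 0 = w0"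
begin

text \<open>The cardinalities arise from bounding a norm by the sum over the components of the
  solution, each of which is a sum over the components of the driver.\<close>

definition \<kappa> :: real where "\<kappa> = real CARD('m) * real CARD('d) * Bx"

lemma \<kappa>_nonneg [simp]: "0 \<le> \<kappa>" using B by (simp add: \<kappa>_def)

lemma x_component: "holder_on 1 Bx T0 T1 (\<lambda>s. x s $ j)"
  unfolding holder_on_def
proof (intro allI impI)
  fix s t assume st: "T0 \<le> s" "s \<le> t" "t \<le> T1"
  have "norm (x t $ j - x s $ j) \<le> norm (x t - x s)"
    by (metis component_le_norm_cart real_norm_def vector_minus_component)
  also have "\<dots> \<le> Bx * (t - s) powr 1" by (rule holder_onD[OF x]) (use st T in auto)
  finally show "norm (x t $ j - x s $ j) \<le> Bx * (t - s) powr 1" .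
qed

definition picard ::
  "((real \<Rightarrow> real ^ 'm) \<Rightarrow> real \<Rightarrow> 'm \<Rightarrow> 'd \<Rightarrow> real) \<Rightarrow> (real \<Rightarrow> real ^ 'm) \<Rightarrow> (real \<Rightarrow> real ^ 'm)" where
  "picard F y = (\<lambda>t\<in>{0..T1}. if t \<le> T0 then w t
     else (\<chi> i. w T0 $ i + (\<Sum>j\<in>UNIV. rs_integral (\<lambda>s. F y s i j) (\<lambda>s. x s $ j) T0 t)))"

lemma coeff_primitives:
  assumes F: "regular_coeff \<alpha> \<beta> T1 w0 F" and y: "y \<in> holder_paths \<alpha> T1" "y 0 = w0"
  obtains I where "\<And>i j. rs_primitive (\<lambda>s. F y s i j) (\<lambda>s. x s $ j) (I i j) T0 T1"
proof -
  have "continuous_on {T0..T1} (\<lambda>s. F y s i j)" for i j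
    using F y T by (auto simp: regular_coeff_def intro: continuous_on_subset[of "{0..T1}"])
  then have "\<exists>I. rs_primitive (\<lambda>s. F y s i j) (\<lambda>s. x s $ j) I T0 T1" for i j
    using rs_primitive_Lipschitz_exists[OF _ x_component B(1)] T by (metis less_imp_le)
  then show thesis using that by metis
qed

lemma picard_primitives:
  assumes I: "\<And>i j. rs_primitive (\<lambda>s. F y s i j) (\<lambda>s. x s $ j) (I i j) T0 T1" and t: "t \<in> {T0..T1}"
  shows "picard F y t $ i = w T0 $ i + (\<Sum>j\<in>UNIV. I i j t - I i j T0)"
proof (cases "t = T0")
  case True
  then show ?thesis using T by (simp add: picard_def)
next
  case False
  then show ?thesis
    using t T rs_integral_primitive(2)[OF I, of T0 t] by (simp add: picard_def)
qed

lemma picard_initial: "t \<in> {0..T0} \<Longrightarrow> picard F y t = w t"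
  using T by (simp add: picard_def)

text \<open>Along a Hoelder path a regular coefficient is continuous in time, so the integrability
  that belongs to being a solution is automatic. Extensionality turns the equation on
  \<open>[0, T1]\<close> into an equation of functions.\<close>

lemma solves_iff_picard:
  assumes F: "regular_coeff \<alpha> \<beta> T1 w0 F"
  shows "solves \<alpha> T0 T1 F x w y \<longleftrightarrow> y \<in> holder_paths \<alpha> T1 \<and> y = picard F y"
proof
  assume sol: "solves \<alpha> T0 T1 F x w y"
  then have y: "y \<in> holder_paths \<alpha> T1" "y 0 = w0" using T w0 by (auto simp: solves_def)
  have "y t = picard F y t" for t
  proof (cases "t \<in> {0..T1}")
    case True
    then show ?thesis using sol by (auto simp: solves_def picard_def vec_eq_iff)
  next
    case False
    then show ?thesis using y by (auto simp: picard_def holder_paths_def extensional_def)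
  qed
  then show "y \<in> holder_paths \<alpha> T1 \<and> y = picard F y" using y by auto
next
  assume y: "y \<in> holder_paths \<alpha> T1 \<and> y = picard F y"
  then have y0: "y 0 = w0" using picard_initial[of 0 F y] T w0 by simp
  obtain I where I: "\<And>i j. rs_primitive (\<lambda>s. F y s i j) (\<lambda>s. x s $ j) (I i j) T0 T1"
    using coeff_primitives[OF F conjunct1[OF y] y0] by blast
  show "solves \<alpha> T0 T1 F x w y"
    unfolding solves_def
  proof (intro conjI ballI allI)
    fix t assume t: "t \<in> {0..T0}"
    then show "y t = w t" using picard_initial[of t F y] y by simp
  next
    fix t i assume t: "t \<in> {T0..T1}"
    show "rs_integrable (\<lambda>s. F y s i j) (\<lambda>s. x s $ j) T0 t" for j
      by (rule rs_integral_primitive(1)[OF I]) (use t in auto)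
    have "y t $ i = w T0 $ i + (\<Sum>j\<in>UNIV. I i j t - I i j T0)"
      using picard_primitives[where F = F and y = y, OF I t, of i] y by simp
    then show "y t $ i = w T0 $ i + (\<Sum>j\<in>UNIV. rs_integral (\<lambda>s. F y s i j) (\<lambda>s. x s $ j) T0 t)"
      using rs_integral_primitive(2)[OF I, of T0 t] t by simp
  qed (use y in auto)
qed

text \<open>The majorant \<open>Bx * M * exp (\<rho> * u) / \<rho>\<close> integrates the weighted
  bound exactly; the quotient by \<rho> is what is later traded for the gain factor.\<close>

lemma driven_increment:
  fixes D I :: "'m \<Rightarrow> 'd \<Rightarrow> real \<Rightarrow> real"
  assumes I: "\<And>i j. rs_primitive (D i j) (\<lambda>s. x s $ j) (I i j) T0 T1"
    and bd: "\<And>i j s. s \<in> {T0..T1} \<Longrightarrow> \<bar>D i j s\<bar> \<le> M * exp (\<rho> * s)"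
    and h: "\<And>i. h t $ i - h s $ i = (\<Sum>j\<in>UNIV. I i j t - I i j s)"
    and "0 \<le> M" "0 < \<rho>" "T0 \<le> s" "s \<le> t" "t \<le> T1"
  shows "norm (h t - h s :: real ^ 'm) \<le> \<kappa> * M * ((exp (\<rho> * t) - exp (\<rho> * s)) / \<rho>)"
proof -
  have one: "\<bar>I i j t - I i j s\<bar> \<le> Bx * M * ((exp (\<rho> * t) - exp (\<rho> * s)) / \<rho>)" for i j
  proof -
    have "\<bar>I i j t - I i j s\<bar> \<le> Bx * M * (exp (\<rho> * t) / \<rho>) - Bx * M * (exp (\<rho> * s) / \<rho>)"
    proof (rule rs_primitive_bound[OF I, where \<Phi> = "\<lambda>u. Bx * M * (exp (\<rho> * u) / \<rho>)"])
      show "\<bar>x v $ j - x u $ j\<bar> \<le> Bx * (v - u)" if "T0 \<le> u" "u \<le> v" "v \<le> T1" for u v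
        using holder_onD[OF x_component that] that by simp
      fix u v assume uv: "s \<le> u" "u \<le> v" "v \<le> t"
      have "\<bar>D i j u\<bar> * Bx * (v - u) \<le> M * exp (\<rho> * u) * Bx * (v - u)"
        using uv assms B by (intro mult_right_mono bd) auto
      also have "\<dots> = Bx * M * (exp (\<rho> * u) * (v - u))" by (simp add: mult_ac)
      also have "\<dots> \<le> Bx * M * ((exp (\<rho> * v) - exp (\<rho> * u)) / \<rho>)"
        using assms B by (intro mult_left_mono exp_increment_le uv) auto
      finally show "\<bar>D i j u\<bar> * Bx * (v - u) \<le> Bx * M * (exp (\<rho> * v) / \<rho>) - Bx * M * (exp (\<rho> * u) / \<rho>)"
        by (simp add: right_diff_distrib diff_divide_distrib)
    qed (use assms B in auto)
    then show ?thesis by (simp add: right_diff_distrib diff_divide_distrib)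
  qed
  have "norm (h t - h s) \<le> (\<Sum>i\<in>UNIV. \<bar>(h t - h s) $ i\<bar>)" by (rule norm_le_l1_cart)
  also have "\<dots> \<le> (\<Sum>i\<in>(UNIV :: 'm set). \<Sum>j\<in>(UNIV :: 'd set). Bx * M * ((exp (\<rho> * t) - exp (\<rho> * s)) / \<rho>))"
  proof (rule sum_mono)
    fix i
    have "\<bar>(h t - h s) $ i\<bar> \<le> (\<Sum>j\<in>UNIV. \<bar>I i j t - I i j s\<bar>)"
      unfolding vector_minus_component h by (rule sum_abs)
    also have "\<dots> \<le> (\<Sum>j\<in>(UNIV :: 'd set). Bx * M * ((exp (\<rho> * t) - exp (\<rho> * s)) / \<rho>))"
      by (intro sum_mono one)
    finally show "\<bar>(h t - h s) $ i\<bar> \<le> (\<Sum>j\<in>(UNIV :: 'd set). Bx * M * ((exp (\<rho> * t) - exp (\<rho> * s)) / \<rho>))" .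
  qed
  also have "\<dots> = \<kappa> * M * ((exp (\<rho> * t) - exp (\<rho> * s)) / \<rho>)" by (simp add: \<kappa>_def)
  finally show ?thesis .
qed

text \<open>An interval that straddles \<open>T0\<close> is split there, and the two pieces are
  estimated separately; this is why the constants add.\<close>

lemma weighted_holder_glue:
  fixes h :: "real \<Rightarrow> real ^ 'm"
  assumes pre: "holder_on \<gamma> N 0 T0 h" and "0 \<le> N" "0 \<le> Q" "0 \<le> \<rho>" "0 \<le> \<gamma>"
    and post: "\<And>s t. T0 \<le> s \<Longrightarrow> s \<le> t \<Longrightarrow> t \<le> T1 \<Longrightarrow>
      norm (h t - h s) \<le> Q * exp (\<rho> * t) * (t - s) powr \<gamma>"
  shows "weighted_holder \<gamma> \<rho> (N + Q) T1 h"
  unfolding weighted_holder_def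
proof (intro allI impI)
  fix s t assume st: "0 \<le> s" "s \<le> t" "t \<le> T1"
  have pre': "norm (h t - h s) \<le> N * exp (\<rho> * t) * (t - s) powr \<gamma>" if "0 \<le> s" "s \<le> t" "t \<le> T0" for s t
    using holder_on_imp_weighted_holder[OF pre \<open>0 \<le> N\<close>, of \<rho>] assms that by (simp add: weighted_holder_def)
  consider "t \<le> T0" | "T0 \<le> s" | "s < T0" "T0 < t" by linarith
  then have "norm (h t - h s) \<le> N * exp (\<rho> * t) * (t - s) powr \<gamma> + Q * exp (\<rho> * t) * (t - s) powr \<gamma>"
  proof cases
    case 1
    have "0 \<le> Q * exp (\<rho> * t) * (t - s) powr \<gamma>" using assms by simp
    then show ?thesis using pre'[of s t] 1 st by linarith
  next
    case 2
    have "0 \<le> N * exp (\<rho> * t) * (t - s) powr \<gamma>" using assms by simp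
    then show ?thesis using post[of s t] 2 st by linarith
  next
    case 3
    have "norm (h t - h s) \<le> norm (h T0 - h s) + norm (h t - h T0)"
      using norm_triangle_ineq[of "h T0 - h s" "h t - h T0"] by simp
    also have "\<dots> \<le> N * exp (\<rho> * T0) * (T0 - s) powr \<gamma> + Q * exp (\<rho> * t) * (t - T0) powr \<gamma>"
      using 3 st by (intro add_mono pre' post) auto
    also have "\<dots> \<le> N * exp (\<rho> * t) * (t - s) powr \<gamma> + Q * exp (\<rho> * t) * (t - s) powr \<gamma>"
      using 3 st assms by (intro add_mono mult_mono powr_mono2 mult_left_mono) (auto intro: mult_left_mono)
    finally show ?thesis .
  qed
  then show "norm (h t - h s) \<le> (N + Q) * exp (\<rho> * t) * (t - s) powr \<gamma>"
    by (simp add: distrib_right)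
qed

lemma weighted_holder_of_increment:
  fixes h :: "real \<Rightarrow> real ^ 'm"
  assumes pre: "holder_on \<beta> N 0 T0 h" and "0 \<le> N" "0 \<le> M" "0 < \<rho>"
    and post: "\<And>s t. T0 \<le> s \<Longrightarrow> s \<le> t \<Longrightarrow> t \<le> T1 \<Longrightarrow>
      norm (h t - h s) \<le> \<kappa> * M * ((exp (\<rho> * t) - exp (\<rho> * s)) / \<rho>)"
  shows "weighted_holder \<beta> \<rho> (N + \<kappa> * M * \<rho> powr (\<beta> - 1)) T1 h"
proof (rule weighted_holder_glue[OF pre])
  fix s t assume st: "T0 \<le> s" "s \<le> t" "t \<le> T1"
  have "norm (h t - h s) \<le> \<kappa> * M * (\<rho> powr (\<beta> - 1) * exp (\<rho> * t) * (t - s) powr \<beta>)"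
    using assms \<beta> \<alpha> st
    by (intro order_trans[OF post[OF st]] mult_left_mono exp_increment_holder) auto
  then show "norm (h t - h s) \<le> \<kappa> * M * \<rho> powr (\<beta> - 1) * exp (\<rho> * t) * (t - s) powr \<beta>"
    by (simp add: mult_ac)
qed (use assms \<beta> in auto)

text \<open>Both images equal \<open>w\<close> up to \<open>T0\<close>, so the constant contributed
  by that part is 0 and only the integrals after \<open>T0\<close> count.\<close>

lemma picard_difference:
  assumes F: "regular_coeff \<alpha> \<beta> T1 w0 F" and G: "regular_coeff \<alpha> \<beta> T1 w0 G"
    and y: "y \<in> holder_paths \<alpha> T1" "y 0 = w0" and z: "z \<in> holder_paths \<alpha> T1" "z 0 = w0"
    and bd: "\<And>i j s. s \<in> {T0..T1} \<Longrightarrow> \<bar>F y s i j - G z s i j\<bar> \<le> M * exp (\<rho> * s)"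
    and "0 \<le> M" "0 < \<rho>"
  shows "weighted_holder \<beta> \<rho> (\<kappa> * M * \<rho> powr (\<beta> - 1)) T1 (\<lambda>t. picard F y t - picard G z t)"
proof -
  obtain I where I: "\<And>i j. rs_primitive (\<lambda>s. F y s i j) (\<lambda>s. x s $ j) (I i j) T0 T1"
    using coeff_primitives[OF F y] by blast
  obtain J where J: "\<And>i j. rs_primitive (\<lambda>s. G z s i j) (\<lambda>s. x s $ j) (J i j) T0 T1"
    using coeff_primitives[OF G z] by blast
  have IJ: "rs_primitive (\<lambda>s. F y s i j - G z s i j) (\<lambda>s. x s $ j) (\<lambda>s. I i j s - J i j s) T0 T1" for i j
    by (rule rs_primitive_diff[OF I J])
  have "weighted_holder \<beta> \<rho> (0 + \<kappa> * M * \<rho> powr (\<beta> - 1)) T1 (\<lambda>t. picard F y t - picard G z t)"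
  proof (rule weighted_holder_of_increment)
    show "holder_on \<beta> 0 0 T0 (\<lambda>t. picard F y t - picard G z t)"
      by (auto simp: holder_on_def picard_initial)
    fix s t assume st: "T0 \<le> s" "s \<le> t" "t \<le> T1"
    show "norm (picard F y t - picard G z t - (picard F y s - picard G z s)) \<le>
        \<kappa> * M * ((exp (\<rho> * t) - exp (\<rho> * s)) / \<rho>)"
    proof (rule driven_increment[OF IJ bd, where h = "\<lambda>t. picard F y t - picard G z t"])
      fix i
      have "picard F y t $ i - picard G z t $ i - (picard F y s $ i - picard G z s $ i) =
          (\<Sum>j\<in>UNIV. I i j t - I i j T0) - (\<Sum>j\<in>UNIV. J i j t - J i j T0)
          - ((\<Sum>j\<in>UNIV. I i j s - I i j T0) - (\<Sum>j\<in>UNIV. J i j s - J i j T0))"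
        using picard_primitives[where F = F and y = y, OF I] picard_primitives[where F = G and y = z, OF J] st by simp
      also have "\<dots> = (\<Sum>j\<in>UNIV. I i j t - J i j t - (I i j s - J i j s))"
        by (simp add: sum_subtractf)
      finally show "(picard F y t - picard G z t) $ i - (picard F y s - picard G z s) $ i =
          (\<Sum>j\<in>UNIV. I i j t - J i j t - (I i j s - J i j s))" by simp
    qed (use assms st in auto)
  qed (use assms in auto)
  then show ?thesis by simp
qed

text \<open>An a priori weighted bound \<open>M\<close> on \<open>y - z\<close> improves itself to
  \<open>M / 2 + b\<close>: the choice of \<rho> halves the contribution of
  \<open>F y - F z\<close>, and \<open>b\<close> stems from \<open>F z - G z\<close>. Iteration from
  the crude bound for two members of the ball tends to \<open>2 * b\<close>.\<close>

lemma stability: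
  assumes F: "regular_coeff \<alpha> \<beta> T1 w0 F" and G: "regular_coeff \<alpha> \<beta> T1 w0 G" and "0 \<le> R"
    and y: "y \<in> holder_ball \<alpha> T1 w0 R" "y = picard F y" and z: "z \<in> holder_ball \<alpha> T1 w0 R" "z = picard G z"
    and L: "0 \<le> L" "\<And>s A i j. s \<in> {0..T1} \<Longrightarrow> 0 \<le> A \<Longrightarrow> holder_on \<beta> A 0 s (\<lambda>r. y r - z r) \<Longrightarrow>
      \<bar>F y s i j - F z s i j\<bar> \<le> L * A"
    and close: "\<And>s i j. s \<in> {0..T1} \<Longrightarrow> \<bar>F z s i j - G z s i j\<bar> \<le> \<epsilon>" and "0 \<le> \<epsilon>"
    and \<rho>: "0 < \<rho>" "\<kappa> * L * \<rho> powr (\<beta> - 1) \<le> 1 / 2"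
  shows "weighted_holder \<beta> \<rho> (2 * \<kappa> * \<epsilon> * \<rho> powr (\<beta> - 1)) T1 (\<lambda>t. y t - z t)"
proof -
  have paths: "y \<in> holder_paths \<alpha> T1" "z \<in> holder_paths \<alpha> T1" "y 0 = w0" "z 0 = w0"
    using y z holder_ball_subset[OF \<open>0 \<le> R\<close>] by (auto simp: holder_ball_def)
  define b where "b = \<kappa> * \<epsilon> * \<rho> powr (\<beta> - 1)"
  have b0: "0 \<le> b" using assms by (simp add: b_def)
  have step: "weighted_holder \<beta> \<rho> (M / 2 + b) T1 (\<lambda>t. y t - z t)"
    if M: "0 \<le> M" "weighted_holder \<beta> \<rho> M T1 (\<lambda>t. y t - z t)" for M
  proof -
    have "\<bar>F y s i j - G z s i j\<bar> \<le> (L * M + \<epsilon>) * exp (\<rho> * s)" if s: "s \<in> {T0..T1}" for s i j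
    proof -
      have s': "s \<in> {0..T1}" using s T by auto
      have "holder_on \<beta> (M * exp (\<rho> * s)) 0 s (\<lambda>t. y t - z t)"
        by (rule weighted_holder_imp_holder_on[OF M(2,1)]) (use \<rho> s in auto)
      then have "\<bar>F y s i j - F z s i j\<bar> \<le> L * (M * exp (\<rho> * s))"
        using M by (intro L(2)[OF s']) auto
      moreover have "\<epsilon> * 1 \<le> \<epsilon> * exp (\<rho> * s)"
        using \<open>0 \<le> \<epsilon>\<close> \<rho> s' by (intro mult_left_mono) auto
      ultimately show ?thesis using close[OF s', of i j] by (simp add: distrib_right mult.assoc)
    qed
    then have "weighted_holder \<beta> \<rho> (\<kappa> * (L * M + \<epsilon>) * \<rho> powr (\<beta> - 1)) T1 (\<lambda>t. picard F y t - picard G z t)"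
      using L M \<open>0 \<le> \<epsilon>\<close> \<rho> by (intro picard_difference F G paths) auto
    then have "weighted_holder \<beta> \<rho> (\<kappa> * (L * M + \<epsilon>) * \<rho> powr (\<beta> - 1)) T1 (\<lambda>t. y t - z t)"
      using y(2) z(2) by simp
    moreover have "\<kappa> * (L * M + \<epsilon>) * \<rho> powr (\<beta> - 1) = (\<kappa> * L * \<rho> powr (\<beta> - 1)) * M + b"
      by (simp add: b_def algebra_simps)
    moreover have "(\<kappa> * L * \<rho> powr (\<beta> - 1)) * M \<le> 1 / 2 * M" using \<rho> M by (intro mult_right_mono) auto
    ultimately show ?thesis by (intro weighted_holder_mono[where M' = "M / 2 + b"]) auto
  qed
  define M where "M = (R + R) * (T1 - 0) powr (\<alpha> - \<beta>)"
  have M0: "0 \<le> M" using \<open>0 \<le> R\<close> by (simp add: M_def)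
  have "holder_on \<alpha> (R + R) 0 T1 (\<lambda>t. y t - z t)"
    using y z by (intro holder_on_diff) (auto simp: holder_ball_def)
  then have "holder_on \<beta> M 0 T1 (\<lambda>t. y t - z t)"
    unfolding M_def using \<beta> \<open>0 \<le> R\<close> by (intro holder_on_exponent_mono) auto
  then have "weighted_holder \<beta> \<rho> M T1 (\<lambda>t. y t - z t)"
    using M0 \<rho> by (intro holder_on_imp_weighted_holder) auto
  then have iter: "weighted_holder \<beta> \<rho> (M / 2 ^ n + 2 * b) T1 (\<lambda>t. y t - z t)" for n
  proof (induction n)
    case 0
    then show ?case using b0 by (auto intro: weighted_holder_mono)
  next
    case (Suc n)
    have "weighted_holder \<beta> \<rho> ((M / 2 ^ n + 2 * b) / 2 + b) T1 (\<lambda>t. y t - z t)"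
      by (rule step[OF _ Suc.IH[OF Suc.prems]]) (use M0 b0 in auto)
    moreover have "(M / 2 ^ n + 2 * b) / 2 + b = M / 2 ^ Suc n + 2 * b" by (simp add: field_simps)
    ultimately show ?case by simp
  qed
  have "weighted_holder \<beta> \<rho> (2 * b) T1 (\<lambda>t. y t - z t)"
    unfolding weighted_holder_def
  proof (intro allI impI)
    fix s t assume st: "0 \<le> s" "s \<le> t" "t \<le> T1"
    have lim: "(\<lambda>n. (M / 2 ^ n + 2 * b) * exp (\<rho> * t) * (t - s) powr \<beta>)
        \<longlonglongrightarrow> (0 + 2 * b) * exp (\<rho> * t) * (t - s) powr \<beta>"
      by (intro tendsto_intros LIMSEQ_divide_realpow_zero) auto
    have "norm (y t - z t - (y s - z s)) \<le> (0 + 2 * b) * exp (\<rho> * t) * (t - s) powr \<beta>"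
      by (rule LIMSEQ_le_const[OF lim]) (use iter st in \<open>auto simp: weighted_holder_def\<close>)
    then show "norm (y t - z t - (y s - z s)) \<le> 2 * b * exp (\<rho> * t) * (t - s) powr \<beta>" by simp
  qed
  then show ?thesis by (simp add: b_def mult_ac)
qed

text \<open>This is stability with equal coefficients and error 0. The radius is chosen after the
  two solutions, so uniqueness holds among all Hoelder paths and not merely within a prescribed
  ball.\<close>

lemma picard_unique:
  assumes F: "regular_coeff \<alpha> \<beta> T1 w0 F"
    and y: "y \<in> holder_paths \<alpha> T1" "y = picard F y" and z: "z \<in> holder_paths \<alpha> T1" "z = picard F z"
  shows "y = z"
proof -
  define R where "R = max (holder_seminorm \<alpha> T1 y) (holder_seminorm \<alpha> T1 z)"
  have R0: "0 \<le> R" by (simp add: R_def le_max_iff_disj)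
  have i0: "y 0 = w0" "z 0 = w0" using picard_initial[of 0 F] y(2) z(2) T w0 by (metis atLeastAtMost_iff order_refl)+
  have yb: "y \<in> holder_ball \<alpha> T1 w0 R" and zb: "z \<in> holder_ball \<alpha> T1 w0 R"
    using y z i0 by (auto simp: R_def intro!: holder_paths_in_ball)
  obtain L where L: "0 \<le> L" "\<And>y z s A i j. y \<in> holder_ball \<alpha> T1 w0 R \<Longrightarrow> z \<in> holder_ball \<alpha> T1 w0 R \<Longrightarrow>
    s \<in> {0..T1} \<Longrightarrow> 0 \<le> A \<Longrightarrow> holder_on \<beta> A 0 s (\<lambda>r. y r - z r) \<Longrightarrow> \<bar>F y s i j - F z s i j\<bar> \<le> L * A"
    using regular_coeff_lipschitz[OF F R0] by blast
  obtain \<rho> where \<rho>: "0 < \<rho>" "(\<kappa> * L) * \<rho> powr (\<beta> - 1) \<le> 1 / 2"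
    using small_rate[of \<beta> "\<kappa> * L"] \<beta> \<alpha> L(1) by auto
  have "weighted_holder \<beta> \<rho> (2 * \<kappa> * 0 * \<rho> powr (\<beta> - 1)) T1 (\<lambda>t. y t - z t)"
    by (rule stability[OF F F R0 yb y(2) zb z(2) L(1) L(2)[OF yb zb] _ _ \<rho>]) auto
  then have "norm (y t - z t - (y 0 - z 0)) \<le> 0" if "t \<in> {0..T1}" for t
    using that by (auto simp: weighted_holder_def)
  then have "y t = z t" if "t \<in> {0..T1}" for t using that i0 by simp
  then show "y = z"
    by (intro extensionalityI[of y "{0..T1}" z]) (use yb zb in \<open>simp_all add: holder_ball_def\<close>)
qed

text \<open>The constant \<open>R\<close> depends on \<open>F\<close> through the growth constant \<open>C\<close> only.\<close>

lemma picard_fixed_point: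
  assumes F: "regular_coeff \<alpha> \<beta> T1 w0 F" and "0 \<le> C"
    and \<rho>: "0 < \<rho>" "\<kappa> * C * \<rho> powr (\<beta> - 1) \<le> 1 / 2"
    and R: "R = Bw + \<kappa> * (C * (2 + 2 * Bw * T1 powr (\<alpha> - \<beta>))) * exp (\<rho> * T1) * T1 powr (1 - \<alpha>)"
    and growth: "\<And>y s A i j. y \<in> holder_ball \<alpha> T1 w0 R \<Longrightarrow> s \<in> {0..T1} \<Longrightarrow> 0 \<le> A \<Longrightarrow>
      holder_on \<beta> A 0 s y \<Longrightarrow> \<bar>F y s i j\<bar> \<le> C * (1 + A)"
  obtains y where "y \<in> holder_ball \<alpha> T1 w0 R" "y = picard F y"
proof -
  have T1: "0 \<le> T1" "0 < T1" using T by auto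
  define N where "N = Bw * T1 powr (\<alpha> - \<beta>)"
  \<comment> \<open>\<open>M\<close> solves \<open>N + (1 + M) / 2 = M\<close>, which closes the
    estimate for the image when \<rho> provides the factor one half.\<close>
  define M where "M = 1 + 2 * N"
  have N0: "0 \<le> N" using B by (simp add: N_def)
  have M0: "0 \<le> M" using N0 by (simp add: M_def)
  define K where "K = C * (1 + M)"
  have K0: "0 \<le> K" using M0 \<open>0 \<le> C\<close> by (simp add: K_def)
  have R': "R = Bw + \<kappa> * K * exp (\<rho> * T1) * T1 powr (1 - \<alpha>)"
    by (simp add: R K_def M_def N_def algebra_simps)
  have R0: "0 \<le> R" using B K0 by (simp add: R')
  have wN: "holder_on \<beta> N 0 T0 w"
  proof -
    have "holder_on \<beta> (Bw * (T0 - 0) powr (\<alpha> - \<beta>)) 0 T0 w"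
      using \<beta> B by (intro holder_on_exponent_mono w) auto
    moreover have "Bw * (T0 - 0) powr (\<alpha> - \<beta>) \<le> N"
      unfolding N_def using B T \<beta> by (intro mult_left_mono powr_mono2) auto
    ultimately show ?thesis by (rule holder_on_mono) auto
  qed
  \<comment> \<open>The weighted bound is the one that reproduces itself, through the growth
    condition. The \<alpha>-bound with radius \<open>R\<close> follows from it, and keeps the
    iterates in a compact ball and within the range where growth is assumed.\<close>
  define Q where "Q = {y \<in> holder_ball \<alpha> T1 w0 R. weighted_holder \<beta> \<rho> M T1 y}"
  have inQ: "picard F y \<in> Q" if y: "y \<in> Q" for y
  proof -
    have yb: "y \<in> holder_ball \<alpha> T1 w0 R" and yM: "weighted_holder \<beta> \<rho> M T1 y" using y by (auto simp: Q_def)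
    have yp: "y \<in> holder_paths \<alpha> T1" "y 0 = w0" using yb holder_ball_subset[OF R0] by (auto simp: holder_ball_def)
    obtain I where I: "\<And>i j. rs_primitive (\<lambda>s. F y s i j) (\<lambda>s. x s $ j) (I i j) T0 T1"
      using coeff_primitives[OF F yp] by blast
    have bd: "\<bar>F y s i j\<bar> \<le> K * exp (\<rho> * s)" if s: "s \<in> {T0..T1}" for s i j
    proof -
      have e: "1 \<le> exp (\<rho> * s)" using \<rho> s T by simp
      have "\<bar>F y s i j\<bar> \<le> C * (1 + M * exp (\<rho> * s))"
        using s T M0 \<rho> by (intro growth[OF yb] weighted_holder_imp_holder_on[OF yM]) auto
      also have "\<dots> \<le> C * (exp (\<rho> * s) + M * exp (\<rho> * s))"
        using e \<open>0 \<le> C\<close> by (intro mult_left_mono) auto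
      finally show ?thesis by (simp add: K_def algebra_simps)
    qed
    have post: "norm (picard F y t - picard F y s) \<le> \<kappa> * K * ((exp (\<rho> * t) - exp (\<rho> * s)) / \<rho>)"
      if st: "T0 \<le> s" "s \<le> t" "t \<le> T1" for s t
    proof (rule driven_increment[OF I bd])
      show "picard F y t $ i - picard F y s $ i = (\<Sum>j\<in>UNIV. I i j t - I i j s)" for i
        using picard_primitives[where F = F and y = y, OF I] st by (simp add: sum_subtractf)
    qed (use K0 \<rho> st in auto)
    have pre: "holder_on \<gamma> C' 0 T0 (picard F y) \<longleftrightarrow> holder_on \<gamma> C' 0 T0 w" for \<gamma> C'
      by (rule holder_on_cong) (rule picard_initial)
    have "weighted_holder \<beta> \<rho> (N + \<kappa> * K * \<rho> powr (\<beta> - 1)) T1 (picard F y)"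
      by (rule weighted_holder_of_increment) (use wN pre post N0 K0 \<rho> in auto)
    moreover have "N + \<kappa> * K * \<rho> powr (\<beta> - 1) \<le> M"
    proof -
      have "\<kappa> * K * \<rho> powr (\<beta> - 1) = (\<kappa> * C * \<rho> powr (\<beta> - 1)) * (1 + M)" by (simp add: K_def)
      also have "\<dots> \<le> 1 / 2 * (1 + M)" using \<rho> M0 by (intro mult_right_mono) auto
      finally show ?thesis by (simp add: M_def)
    qed
    ultimately have wh: "weighted_holder \<beta> \<rho> M T1 (picard F y)" by (rule weighted_holder_mono)
    define E where "E = \<kappa> * K * exp (\<rho> * T1) * T1 powr (1 - \<alpha>)"
    have E0: "0 \<le> E" using K0 by (simp add: E_def)
    have postE: "norm (picard F y t - picard F y s) \<le> E * (t - s) powr \<alpha>"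
      if st: "T0 \<le> s" "s \<le> t" "t \<le> T1" for s t
    proof -
      have "(exp (\<rho> * t) - exp (\<rho> * s)) / \<rho> \<le> exp (\<rho> * t) * (t - s)"
        by (rule exp_increment_le) (use \<rho> st in auto)
      also have "\<dots> \<le> exp (\<rho> * T1) * (T1 powr (1 - \<alpha>) * (t - s) powr \<alpha>)"
      proof (rule mult_mono)
        have "t - s = (t - s) powr (1 - \<alpha>) * (t - s) powr \<alpha>" using st by (simp flip: powr_add)
        also have "\<dots> \<le> T1 powr (1 - \<alpha>) * (t - s) powr \<alpha>"
          using st T \<alpha> by (intro mult_right_mono powr_mono2) auto
        finally show "t - s \<le> T1 powr (1 - \<alpha>) * (t - s) powr \<alpha>" .
      qed (use st \<rho> in auto)
      finally have "\<kappa> * K * ((exp (\<rho> * t) - exp (\<rho> * s)) / \<rho>) \<le> \<kappa> * K * (exp (\<rho> * T1) * (T1 powr (1 - \<alpha>) * (t - s) powr \<alpha>))"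
        using K0 by (intro mult_left_mono) auto
      then show ?thesis using post[OF st] by (simp add: E_def mult.assoc)
    qed
    have "weighted_holder \<alpha> 0 (Bw + E) T1 (picard F y)"
      by (rule weighted_holder_glue) (use pre w E0 B \<beta> postE in auto)
    then have "holder_on \<alpha> R 0 T1 (picard F y)"
      by (simp add: weighted_holder_def holder_on_def R' E_def)
    moreover have "picard F y 0 = w0" using picard_initial[of 0 F y] T w0 by simp
    ultimately have "picard F y \<in> holder_ball \<alpha> T1 w0 R" by (simp add: holder_ball_def picard_def)
    then show ?thesis using wh by (simp add: Q_def)
  qed
  define y0 where "y0 = (\<lambda>t\<in>{0..T1}. w (min t T0))"
  have y0Q: "y0 \<in> Q"
  proof -
    have eq: "holder_on \<gamma> C' 0 T1 y0 \<longleftrightarrow> holder_on \<gamma> C' 0 T1 (\<lambda>t. w (min t T0))" for \<gamma> C'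
      by (rule holder_on_cong) (simp add: y0_def)
    have "holder_on \<alpha> Bw 0 T1 (\<lambda>t. w (min t T0))"
      by (rule holder_on_stopped[OF w]) (use \<beta> B T in auto)
    moreover have "Bw \<le> R" using K0 by (simp add: R')
    ultimately have "holder_on \<alpha> R 0 T1 y0" unfolding eq by (rule holder_on_mono) auto
    moreover have "holder_on \<beta> N 0 T1 (\<lambda>t. w (min t T0))"
      by (rule holder_on_stopped[OF wN]) (use \<beta> N0 T in auto)
    then have "weighted_holder \<beta> \<rho> N T1 y0"
      unfolding eq[symmetric] by (rule holder_on_imp_weighted_holder) (use N0 \<rho> in auto)
    then have "weighted_holder \<beta> \<rho> M T1 y0" by (rule weighted_holder_mono) (use N0 in \<open>simp add: M_def\<close>)
    ultimately show ?thesis using T w0 by (auto simp: Q_def holder_ball_def y0_def)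
  qed
  define Y where "Y n = (picard F ^^ n) y0" for n
  have YQ: "Y n \<in> Q" for n by (induction n) (auto simp: Y_def intro: y0Q inQ)
  have Yb: "Y n \<in> holder_ball \<alpha> T1 w0 R" for n using YQ[of n] by (simp add: Q_def)
  have ballp: "y \<in> holder_paths \<alpha> T1" "y 0 = w0" if "y \<in> holder_ball \<alpha> T1 w0 R" for y
    using that holder_ball_subset[OF R0] by (auto simp: holder_ball_def)
  obtain L where L: "0 \<le> L" "\<And>y z s A i j. y \<in> holder_ball \<alpha> T1 w0 R \<Longrightarrow> z \<in> holder_ball \<alpha> T1 w0 R \<Longrightarrow>
    s \<in> {0..T1} \<Longrightarrow> 0 \<le> A \<Longrightarrow> holder_on \<beta> A 0 s (\<lambda>r. y r - z r) \<Longrightarrow> \<bar>F y s i j - F z s i j\<bar> \<le> L * A"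
    using regular_coeff_lipschitz[OF F R0] by blast
  \<comment> \<open>A second rate is required: \<open>L\<close> depends on \<open>R\<close>, and
    \<open>R\<close> depends on \<rho>, so \<rho> itself could not be adapted to \<open>L\<close>
    without circularity.\<close>
  obtain \<mu> where \<mu>: "0 < \<mu>" "(\<kappa> * L) * \<mu> powr (\<beta> - 1) \<le> 1 / 2"
    using small_rate[of \<beta> "\<kappa> * L"] \<beta> \<alpha> L(1) by auto
  have contr: "weighted_holder \<beta> \<mu> (D / 2) T1 (\<lambda>t. picard F y t - picard F z t)"
    if yz: "y \<in> holder_ball \<alpha> T1 w0 R" "z \<in> holder_ball \<alpha> T1 w0 R" and D: "0 \<le> D" "weighted_holder \<beta> \<mu> D T1 (\<lambda>t. y t - z t)"
    for y z D
  proof -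
    have "\<bar>F y s i j - F z s i j\<bar> \<le> (L * D) * exp (\<mu> * s)" if s: "s \<in> {T0..T1}" for s i j
    proof -
      have "\<bar>F y s i j - F z s i j\<bar> \<le> L * (D * exp (\<mu> * s))"
        using s T D \<mu> by (intro L(2)[OF yz] weighted_holder_imp_holder_on[OF D(2,1)]) auto
      then show ?thesis by (simp add: mult.assoc)
    qed
    then have "weighted_holder \<beta> \<mu> (\<kappa> * (L * D) * \<mu> powr (\<beta> - 1)) T1 (\<lambda>t. picard F y t - picard F z t)"
      using L D \<mu> by (intro picard_difference F ballp yz) auto
    moreover have "\<kappa> * (L * D) * \<mu> powr (\<beta> - 1) = (\<kappa> * L * \<mu> powr (\<beta> - 1)) * D" by simp
    moreover have "(\<kappa> * L * \<mu> powr (\<beta> - 1)) * D \<le> 1 / 2 * D" using \<mu> D by (intro mult_right_mono) auto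
    ultimately show ?thesis by (intro weighted_holder_mono[where M' = "D / 2"]) auto
  qed
  define D where "D = (R + R) * (T1 - 0) powr (\<alpha> - \<beta>)"
  have D0: "0 \<le> D" using R0 by (simp add: D_def)
  have steps: "weighted_holder \<beta> \<mu> (D / 2 ^ n) T1 (\<lambda>t. Y (Suc n) t - Y n t)" for n
  proof (induction n)
    case 0
    have "holder_on \<alpha> (R + R) 0 T1 (\<lambda>t. Y 1 t - Y 0 t)"
      using Yb by (intro holder_on_diff) (auto simp: holder_ball_def)
    then have "holder_on \<beta> D 0 T1 (\<lambda>t. Y 1 t - Y 0 t)"
      unfolding D_def using \<beta> R0 by (intro holder_on_exponent_mono) auto
    then show ?case using D0 \<mu> by (auto intro: holder_on_imp_weighted_holder)
  next
    case (Suc n)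
    have "weighted_holder \<beta> \<mu> (D / 2 ^ n / 2) T1 (\<lambda>t. picard F (Y (Suc n)) t - picard F (Y n) t)"
      by (rule contr[OF Yb Yb _ Suc]) (use D0 in auto)
    then show ?case by (simp add: Y_def mult.commute)
  qed
  \<comment> \<open>In place of a completeness argument, compactness provides a limit point
    \<open>y\<close>. Since consecutive iterates approach each other and the Picard map is
    continuous in the weighted sense, \<open>y\<close> is fixed.\<close>
  obtain y k where k: "strict_mono (k :: nat \<Rightarrow> nat)" and y: "y \<in> holder_ball \<alpha> T1 w0 R"
    and lim: "(\<lambda>n. holder_dist \<beta> T1 (Y (k n)) y) \<longlonglongrightarrow> 0"
    by (rule holder_ball_sequentially_compact[OF \<beta> T1(1) R0, of Y w0]) (use Yb in auto)
  define d where "d n = holder_dist \<beta> T1 (Y (k n)) y" for n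
  have d0: "0 \<le> d n" for n by (simp add: d_def)
  have fin: "holder_sup \<beta> T1 (\<lambda>t. Y (k n) t - y t) < \<infinity>" for n
    using \<beta> by (intro holder_sup_diff_paths[of \<beta> \<alpha>] ballp Yb y) auto
  have dn: "weighted_holder \<beta> \<mu> (d n) T1 (\<lambda>t. Y (k n) t - y t)" for n
  proof -
    have "holder_on \<beta> (d n) 0 T1 (\<lambda>t. Y (k n) t - y t)"
      by (rule holder_on_mono[OF holder_on_seminorm[OF fin]]) (auto simp: d_def holder_dist_def holder_norm_def)
    then show ?thesis by (rule holder_on_imp_weighted_holder) (use d0 \<mu> in auto)
  qed
  have "picard F y t = y t" if t: "t \<in> {0..T1}" for t
  proof -
    define E where "E = exp (\<mu> * t) * t powr \<beta>"
    have at0: "norm (h t - h 0) \<le> A * E" if "weighted_holder \<beta> \<mu> A T1 h" for A and h :: "real \<Rightarrow> real ^ 'm"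
      using that t by (auto simp: weighted_holder_def E_def mult.assoc)
    have P0: "picard F v 0 = w0" for v using picard_initial[of 0 F v] T w0 by simp
    have "norm (picard F y t - y t) \<le> (d n / 2 + D / 2 ^ k n + d n) * E" for n
    proof -
      have 1: "norm (picard F (Y (k n)) t - picard F y t) \<le> d n / 2 * E"
        using at0[OF contr[OF Yb y d0 dn]] by (simp add: P0)
      have 2: "norm (picard F (Y (k n)) t - Y (k n) t) \<le> D / 2 ^ k n * E"
      proof -
        have YS: "Y (Suc (k n)) = picard F (Y (k n))" by (simp add: Y_def)
        show ?thesis using at0[OF steps[of "k n"]] ballp(2)[OF Yb] unfolding YS by (simp add: P0)
      qed
      have 3: "norm (Y (k n) t - y t) \<le> d n * E"
        using at0[OF dn] ballp(2)[OF y] ballp(2)[OF Yb] by simp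
      define a b c where "a = Y (k n) t - y t" and "b = picard F (Y (k n)) t - Y (k n) t"
        and "c = picard F (Y (k n)) t - picard F y t"
      have "norm (picard F y t - y t) = norm (a + b - c)" by (simp add: a_def b_def c_def)
      also have "\<dots> \<le> norm a + norm b + norm c"
        by (rule order_trans[OF norm_triangle_ineq4 add_right_mono[OF norm_triangle_ineq]])
      finally have "norm (picard F y t - y t) \<le> d n * E + D / 2 ^ k n * E + d n / 2 * E"
        using 1 2 3 unfolding a_def b_def c_def by linarith
      also have "\<dots> = (d n / 2 + D / 2 ^ k n + d n) * E" by (simp only: distrib_right add_ac)
      finally show ?thesis .
    qed
    moreover have "(\<lambda>n. (d n / 2 + D / 2 ^ k n + d n) * E) \<longlonglongrightarrow> (0 / 2 + 0 + 0) * E"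
    proof -
      have "(\<lambda>n. D / 2 ^ k n) \<longlonglongrightarrow> 0"
        using LIMSEQ_subseq_LIMSEQ[OF LIMSEQ_divide_realpow_zero[of 2 D] k] by (simp add: o_def)
      moreover have "d \<longlonglongrightarrow> 0" using lim unfolding d_def[abs_def] .
      ultimately show ?thesis by (intro tendsto_intros) auto
    qed
    ultimately have "norm (picard F y t - y t) \<le> (0 / 2 + 0 + 0) * E"
      by (intro LIMSEQ_le_const) auto
    then show ?thesis by simp
  qed
  then have "y = picard F y"
    by (intro extensionalityI[of y "{0..T1}"]) (use y in \<open>simp_all add: holder_ball_def picard_def\<close>)
  with y show thesis by (rule that)
qed

end

section \<open>Functional and signature coefficients\<close>

lemma abs_matrix_blinfun_le:
  fixes b :: "(real ^ 'd) \<Rightarrow>\<^sub>L (real ^ 'm)"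
  shows "\<bar>matrix (blinfun_apply b) $ i $ j\<bar> \<le> norm b"
proof -
  have "\<bar>matrix (blinfun_apply b) $ i $ j\<bar> \<le> norm (blinfun_apply b (axis j 1))"
    unfolding matrix_def by (simp add: component_le_norm_cart)
  also have "\<dots> \<le> norm b * norm (axis j (1::real))" by (rule norm_blinfun)
  finally show ?thesis by simp
qed

lemma continuous_map_matrix_entry:
  fixes f :: "'a \<Rightarrow> (real ^ 'd) \<Rightarrow>\<^sub>L (real ^ 'm)"
  assumes "continuous_map X euclidean f"
  shows "continuous_map X euclidean (\<lambda>p. matrix (blinfun_apply (f p)) $ i $ j)"
proof -
  have "continuous_on UNIV (\<lambda>b :: (real ^ 'd) \<Rightarrow>\<^sub>L (real ^ 'm). blinfun_apply b (axis j 1) $ i)"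
    by (intro continuous_intros)
  then have "continuous_map euclidean euclidean (\<lambda>b :: (real ^ 'd) \<Rightarrow>\<^sub>L (real ^ 'm). matrix (blinfun_apply b) $ i $ j)"
    by (simp add: matrix_def)
  from continuous_map_compose[OF assms this] show ?thesis by (simp add: o_def)
qed

lemma holder_seminorm_stopped_le:
  fixes h :: "real \<Rightarrow> 'b::real_normed_vector"
  assumes "holder_on \<gamma> A 0 s h" "0 \<le> \<gamma>" "0 \<le> A" "s \<in> {0..T}"
    and "\<And>r. r \<in> {0..T} \<Longrightarrow> k r = h (min r s)"
  shows "holder_seminorm \<gamma> T k \<le> A"
proof (rule holder_on_imp_seminorm(2)[OF assms(3)])
  have "holder_on \<gamma> A 0 T (\<lambda>r. h (min r s))" by (rule holder_on_stopped) (use assms in auto)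
  then show "holder_on \<gamma> A 0 T k" by (subst holder_on_cong[of 0 T k]) (use assms in auto)
qed

text \<open>Balls are compact, so the local Lipschitz hypothesis applies to them. Stopping at
  \<open>s\<close> turns the seminorm over the whole interval into a bound by the Hoelder constant
  on \<open>[0, s]\<close>, and equal initial values remove the remaining term. Continuity in time
  is that of stopping, composed with \<open>f\<close>.\<close>

lemma regular_functional_coeff:
  fixes f :: "real \<times> (real \<Rightarrow> real ^ 'm) \<Rightarrow> (real ^ 'd) \<Rightarrow>\<^sub>L (real ^ 'm)"
  assumes "0 < \<beta>" "\<beta> < \<alpha>" "0 \<le> T"
    and f_cont: "continuous_map (stopped_topology \<alpha> \<beta> T) euclidean f"
    and f_lip: "\<And>K. compactin (holder_topology \<alpha> \<beta> T) K \<Longrightarrow>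
      \<exists>L>0. \<forall>t\<in>{0..T}. \<forall>u\<in>K. \<forall>v\<in>K.
        norm (f (t, stopped T t u) - f (t, stopped T t v)) \<le>
        L * (norm (u 0 - v 0) + holder_seminorm \<beta> T (\<lambda>r. stopped T t u r - stopped T t v r))"
  shows "regular_coeff \<alpha> \<beta> T w0 (functional_coeff T f)"
  unfolding regular_coeff_def
proof (intro conjI ballI allI impI)
  fix y :: "real \<Rightarrow> real ^ 'm" and i :: 'm and j :: 'd
  assume y: "y \<in> holder_paths \<alpha> T"
  from continuous_map_compose[OF continuous_stopping[OF assms(1-3) y] continuous_map_matrix_entry[OF f_cont]]
  show "continuous_on {0..T} (\<lambda>s. functional_coeff T f y s i j)"
    by (simp add: o_def functional_coeff_def)
next
  fix R :: real and i :: 'm and j :: 'd assume "0 \<le> R"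
  obtain L where L: "0 < L" "\<And>t u v. t \<in> {0..T} \<Longrightarrow> u \<in> holder_ball \<alpha> T w0 R \<Longrightarrow> v \<in> holder_ball \<alpha> T w0 R \<Longrightarrow>
        norm (f (t, stopped T t u) - f (t, stopped T t v)) \<le>
        L * (norm (u 0 - v 0) + holder_seminorm \<beta> T (\<lambda>r. stopped T t u r - stopped T t v r))"
    using f_lip[OF compactin_holder_ball[OF assms(1-3) \<open>0 \<le> R\<close>]] by blast
  have "\<bar>functional_coeff T f y s i j - functional_coeff T f z s i j\<bar> \<le> L * A"
    if y: "y \<in> holder_ball \<alpha> T w0 R" and z: "z \<in> holder_ball \<alpha> T w0 R" and s: "s \<in> {0..T}" and A: "0 \<le> A"
      "holder_on \<beta> A 0 s (\<lambda>r. y r - z r)" for y z s A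
  proof -
    have "functional_coeff T f y s i j - functional_coeff T f z s i j =
        matrix (blinfun_apply (f (s, stopped T s y) - f (s, stopped T s z))) $ i $ j"
      by (simp add: functional_coeff_def matrix_def blinfun.diff_left)
    then have "\<bar>functional_coeff T f y s i j - functional_coeff T f z s i j\<bar>
        \<le> norm (f (s, stopped T s y) - f (s, stopped T s z))"
      using abs_matrix_blinfun_le by simp
    also have "\<dots> \<le> L * (norm (y 0 - z 0) + holder_seminorm \<beta> T (\<lambda>r. stopped T s y r - stopped T s z r))"
      by (rule L(2)[OF s y z])
    also have "\<dots> \<le> L * A"
    proof -
      have "holder_seminorm \<beta> T (\<lambda>r. stopped T s y r - stopped T s z r) \<le> A"
        by (rule holder_seminorm_stopped_le[OF A(2) _ A(1) s]) (use assms in \<open>auto simp: stopped_def\<close>)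
      then show ?thesis using y z L(1) by (simp add: holder_ball_def)
    qed
    finally show ?thesis .
  qed
  then show "\<exists>L\<ge>0. \<forall>y\<in>holder_ball \<alpha> T w0 R. \<forall>z\<in>holder_ball \<alpha> T w0 R. \<forall>s\<in>{0..T}. \<forall>A\<ge>0.
        holder_on \<beta> A 0 s (\<lambda>r. y r - z r) \<longrightarrow>
        \<bar>functional_coeff T f y s i j - functional_coeff T f z s i j\<bar> \<le> L * A"
    using L(1) by (intro exI[of _ L]) auto
qed

lemma functional_coeff_growth:
  fixes f :: "real \<times> (real \<Rightarrow> real ^ 'm) \<Rightarrow> (real ^ 'd) \<Rightarrow>\<^sub>L (real ^ 'm)"
  assumes "0 < \<beta>" "\<beta> < \<alpha>" "0 \<le> Cf" "0 \<le> R"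
    and growth: "\<forall>(t, u)\<in>stopped_paths \<alpha> T. norm (f (t, u)) \<le> Cf * (1 + norm (u 0) + holder_seminorm \<beta> T u)"
    and y: "y \<in> holder_ball \<alpha> T w0 R" and s: "s \<in> {0..T}" and A: "0 \<le> A" "holder_on \<beta> A 0 s y"
  shows "\<bar>functional_coeff T f y s i j\<bar> \<le> Cf * (1 + norm w0) * (1 + A)"
proof -
  have "(s, stopped T s y) \<in> stopped_paths \<alpha> T"
    using s y holder_ball_subset[OF \<open>0 \<le> R\<close>, of \<alpha> T w0] by (auto simp: stopped_paths_def)
  then have "norm (f (s, stopped T s y)) \<le> Cf * (1 + norm (stopped T s y 0) + holder_seminorm \<beta> T (stopped T s y))"
    using growth by auto
  also have "\<dots> \<le> Cf * (1 + norm w0 + A)"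
  proof -
    have "holder_seminorm \<beta> T (stopped T s y) \<le> A"
      by (rule holder_seminorm_stopped_le[OF A(2) _ A(1) s]) (use assms in \<open>auto simp: stopped_def\<close>)
    moreover have "stopped T s y 0 = w0" using y s by (simp add: stopped_def holder_ball_def)
    ultimately show ?thesis using \<open>0 \<le> Cf\<close> by (intro mult_left_mono) auto
  qed
  also have "\<dots> \<le> Cf * ((1 + norm w0) * (1 + A))"
    using A \<open>0 \<le> Cf\<close> by (intro mult_left_mono) (auto simp: algebra_simps)
  finally have "norm (f (s, stopped T s y)) \<le> Cf * (1 + norm w0) * (1 + A)" by (simp add: mult.assoc)
  then show ?thesis
    unfolding functional_coeff_def using abs_matrix_blinfun_le order_trans by blast
qed

lemma signature_coeff_eq_feature:
  fixes y :: "real \<Rightarrow> real ^ 'm"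
  assumes "1/2 < \<alpha>" "\<alpha> \<le> 1" and y: "y \<in> holder_paths \<alpha> T" and s: "s \<in> {0..T}"
    and h: "\<And>g. g \<in> group_like \<Longrightarrow> entire_map (l i j) g = h (\<lambda>q. g (feature_word q))"
  shows "signature_coeff l y s i j = h (feature (s, y))"
proof -
  have "signature (time_extend y) s \<in> group_like"
    by (rule signature_group_like[OF assms(1,2) _ time_extend_holder[OF y] s]) (use assms in auto)
  moreover have "(\<lambda>q. signature (time_extend y) s (feature_word q)) = feature (s, y)"
    using signature_feature_word[OF y _ s] assms(1) by auto
  ultimately show ?thesis by (simp add: signature_coeff_def h)
qed

lemma continuous_on_feature:
  fixes y :: "real \<Rightarrow> real ^ 'm"
  assumes y: "y \<in> holder_paths \<alpha> T" "0 < \<alpha>"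
  shows "continuous_on {0..T} (\<lambda>s. feature (s, y))"
proof (rule continuous_on_coordinatewise_then_product)
  fix q :: "'m feature_index"
  show "continuous_on {0..T} (\<lambda>s. feature (s, y) q)"
  proof (cases q)
    case (Some p)
    obtain i k where p: "p = (i, k)" by (cases p)
    show ?thesis
      unfolding Some p feature.simps
      using continuous_on_iter_int[OF continuous_on_centered[OF y, of i], of "Suc k"] by simp
  qed simp
qed

lemma regular_signature_coeff:
  fixes w0 :: "real ^ 'm" and l :: "'m \<Rightarrow> 'd \<Rightarrow> 'm option tensor_series"
  assumes "1/2 < \<alpha>" "\<alpha> \<le> 1" "0 < \<beta>" "\<beta> < \<alpha>" "0 \<le> T"
    and h: "\<And>i j g. g \<in> group_like \<Longrightarrow> entire_map (l i j) g = h i j (\<lambda>q. g (feature_word q))"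
    and cont: "\<And>i j. continuous_on UNIV (h i j)" and lip: "\<And>i j. lipschitz_coords (h i j)"
  shows "regular_coeff \<alpha> \<beta> T w0 (signature_coeff l)"
  unfolding regular_coeff_def
proof (intro conjI ballI allI impI)
  fix y :: "real \<Rightarrow> real ^ 'm" and i :: 'm and j :: 'd
  assume y: "y \<in> holder_paths \<alpha> T"
  have *: "continuous_on {0..T} (\<lambda>s. h i j (feature (s, y)))"
    by (rule continuous_on_compose2[OF cont continuous_on_feature[OF y]]) (use assms in auto)
  show "continuous_on {0..T} (\<lambda>s. signature_coeff l y s i j)"
    by (rule continuous_on_cong[THEN iffD1, OF refl _ *])
      (rule signature_coeff_eq_feature[where l = l, OF assms(1,2) y _ h, symmetric])
next
  fix R :: real and i :: 'm and j :: 'd assume "0 \<le> R"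
  obtain L S where L: "0 \<le> L" "finite S" "\<And>u v. \<bar>h i j u - h i j v\<bar> \<le> L * (\<Sum>q\<in>S. \<bar>u q - v q\<bar>)"
    using lip[of i j] unfolding lipschitz_coords_def by blast
  \<comment> \<open>These are the Lipschitz constants of the coordinates:
    \<open>T powr \<beta>\<close> turns a Hoelder bound into a supremum bound, each time integration
    adds a factor \<open>T\<close>. The time coordinate gets 0, as both paths are evaluated at the
    same \<open>s\<close>.\<close>
  define c where "c q = (case q of None \<Rightarrow> 0 | Some (i :: 'm, k) \<Rightarrow> T powr \<beta> * T ^ Suc k)" for q
  have c0: "0 \<le> c q" for q using assms by (auto simp: c_def split: option.split)
  have "\<bar>signature_coeff l y s i j - signature_coeff l z s i j\<bar> \<le> L * (\<Sum>q\<in>S. c q) * A"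
    if y: "y \<in> holder_ball \<alpha> T w0 R" and z: "z \<in> holder_ball \<alpha> T w0 R" and s: "s \<in> {0..T}" and A: "0 \<le> A"
      "holder_on \<beta> A 0 s (\<lambda>r. y r - z r)" for y z s A
  proof -
    have paths: "y \<in> holder_paths \<alpha> T" "z \<in> holder_paths \<alpha> T"
      using y z holder_ball_subset[OF \<open>0 \<le> R\<close>] by blast+
    have "\<bar>feature (s, y) q - feature (s, z) q\<bar> \<le> c q * A" for q
    proof (cases q)
      case (Some p)
      obtain i' k where p: "p = (i', k)" by (cases p)
      have "\<bar>feature (s, y) (Some (i', k)) - feature (s, z) (Some (i', k))\<bar> \<le> (A * T powr \<beta>) * T ^ Suc k"
      proof (rule feature_diff[OF paths _ s])
        fix u assume u: "u \<in> {0..s}"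
        have "norm (y u - z u - (y 0 - z 0)) \<le> A * (u - 0) powr \<beta>"
          by (rule holder_onD[OF A(2)]) (use u in auto)
        also have "\<dots> \<le> A * T powr \<beta>"
          using u s A assms by (intro mult_left_mono powr_mono2) auto
        finally show "norm (y u - z u - (y 0 - z 0)) \<le> A * T powr \<beta>" .
      qed (use A assms in auto)
      then show ?thesis by (simp add: Some p c_def mult_ac del: feature.simps)
    qed (simp add: c_def)
    then have "(\<Sum>q\<in>S. \<bar>feature (s, y) q - feature (s, z) q\<bar>) \<le> (\<Sum>q\<in>S. c q * A)"
      by (intro sum_mono)
    then have "L * (\<Sum>q\<in>S. \<bar>feature (s, y) q - feature (s, z) q\<bar>) \<le> L * ((\<Sum>q\<in>S. c q) * A)"
      using L(1) by (intro mult_left_mono) (auto simp: sum_distrib_right)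
    then have "\<bar>h i j (feature (s, y)) - h i j (feature (s, z))\<bar> \<le> L * (\<Sum>q\<in>S. c q) * A"
      using L(3)[of "feature (s, y)" "feature (s, z)"] by (simp add: mult.assoc)
    then show ?thesis
      using signature_coeff_eq_feature[where l = l, OF assms(1,2) paths(1) s h]
        signature_coeff_eq_feature[where l = l, OF assms(1,2) paths(2) s h] by simp
  qed
  moreover have "0 \<le> L * (\<Sum>q\<in>S. c q)" using L(1) c0 by (intro mult_nonneg_nonneg sum_nonneg)
  ultimately show "\<exists>L\<ge>0. \<forall>y\<in>holder_ball \<alpha> T w0 R. \<forall>z\<in>holder_ball \<alpha> T w0 R. \<forall>s\<in>{0..T}. \<forall>A\<ge>0.
        holder_on \<beta> A 0 s (\<lambda>r. y r - z r) \<longrightarrow>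
        \<bar>signature_coeff l y s i j - signature_coeff l z s i j\<bar> \<le> L * A"
    by (intro exI[of _ "L * (\<Sum>q\<in>S. c q)"]) auto
qed

text \<open>The entries are approximated one by one. The coordinate functions \<open>h i j\<close>
  are kept alongside the series, because continuity and Lipschitz bounds are read off from
  them.\<close>

lemma signature_coeff_approximation:
  fixes f :: "real \<times> (real \<Rightarrow> real ^ 'm) \<Rightarrow> (real ^ 'd) \<Rightarrow>\<^sub>L (real ^ 'm)"
  assumes "1/2 < \<alpha>" "\<alpha> \<le> 1" "0 < \<beta>" "\<beta> < \<alpha>" "0 \<le> T" "0 \<le> R" "0 < \<epsilon>"
    and f_cont: "continuous_map (stopped_topology \<alpha> \<beta> T) euclidean f"
  obtains l :: "'m \<Rightarrow> 'd \<Rightarrow> 'm option tensor_series" where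
    "\<And>i j. bounded_entire (l i j)" "regular_coeff \<alpha> \<beta> T w0 (signature_coeff l)"
    "\<And>y s i j. y \<in> holder_ball \<alpha> T w0 R \<Longrightarrow> s \<in> {0..T} \<Longrightarrow>
      \<bar>functional_coeff T f y s i j - signature_coeff l y s i j\<bar> < \<epsilon>"
proof -
  define P where "P i j l h \<longleftrightarrow> bounded_entire l \<and>
      (\<forall>g\<in>group_like. entire_map l g = h (\<lambda>q. g (feature_word q))) \<and>
      continuous_on UNIV h \<and> lipschitz_coords h \<and>
      (\<forall>t\<in>{0..T}. \<forall>y\<in>holder_ball \<alpha> T w0 R. \<bar>functional_coeff T f y t i j - h (feature (t, y))\<bar> < \<epsilon>)"
    for i :: 'm and j :: 'd and l :: "'m option tensor_series" and h :: "('m feature_index \<Rightarrow> real) \<Rightarrow> real"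
  have "\<exists>l h. P i j l h" for i j
  proof -
    obtain h :: "('m feature_index \<Rightarrow> real) \<Rightarrow> real" where "h \<in> entire_features"
      "\<And>t y. t \<in> {0..T} \<Longrightarrow> y \<in> holder_ball \<alpha> T w0 R \<Longrightarrow>
        \<bar>matrix (blinfun_apply (f (t, stopped T t y))) $ i $ j - h (feature (t, y))\<bar> < \<epsilon>"
      by (rule bounded_entire_dense[OF assms(3,4,6,5) continuous_map_matrix_entry[OF f_cont, of i j] assms(7), of w0]) blast
    then show ?thesis unfolding P_def entire_features_def functional_coeff_def by blast
  qed
  then obtain l h where lh: "\<And>i j. P i j (l i j) (h i j)" by metis
  show thesis
  proof (rule that[of l])
    show "bounded_entire (l i j)" for i j using lh[of i j] by (simp add: P_def)
    have h: "\<And>i j g. g \<in> group_like \<Longrightarrow> entire_map (l i j) g = h i j (\<lambda>q. g (feature_word q))"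
      using lh by (simp add: P_def)
    show "regular_coeff \<alpha> \<beta> T w0 (signature_coeff l)"
      by (rule regular_signature_coeff[where h = h]) (use assms h lh in \<open>auto simp: P_def\<close>)
    fix y s i j assume y: "y \<in> holder_ball \<alpha> T w0 R" and s: "s \<in> {0..T}"
    have "signature_coeff l y s i j = h i j (feature (s, y))"
      using y holder_ball_subset[OF assms(6)]
      by (intro signature_coeff_eq_feature[where l = l, OF assms(1,2) _ s h]) auto
    then show "\<bar>functional_coeff T f y s i j - signature_coeff l y s i j\<bar> < \<epsilon>"
      using lh[of i j] y s by (simp add: P_def)
  qed
qed

section \<open>Uniform convergence of the approximating solutions\<close>

lemma driven_equation_input_set:
  assumes "(x, w) \<in> input_set \<alpha> T0 T1 Bx Bw w0" "0 \<le> T0" "T0 < T1" "0 < \<beta>" "\<beta> < \<alpha>" "\<alpha> < 1" "0 < Bx" "0 < Bw"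
  shows "driven_equation T0 T1 \<alpha> \<beta> Bx Bw w0 x w"
proof
  have xw: "x \<in> holder_paths 1 T1" "holder_norm 1 T1 x \<le> Bx" "w \<in> holder_paths \<alpha> T0" "w 0 = w0"
    "holder_seminorm \<alpha> T0 w \<le> Bw"
    using assms(1) by (auto simp: input_set_def)
  have "holder_seminorm 1 T1 x \<le> Bx"
    using xw(2) unfolding holder_norm_def by (rule order_trans[rotated]) simp
  then show "holder_on 1 Bx 0 T1 x"
    by (intro holder_on_mono[OF holder_paths_imp_holder_on[OF xw(1)]]) auto
  show "holder_on \<alpha> Bw 0 T0 w"
    using xw(5) by (intro holder_on_mono[OF holder_paths_imp_holder_on[OF xw(3)]]) auto
  show "w 0 = w0" by (rule xw(4))
qed (use assms in auto)

theorem corollary4p14: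
  fixes T0 T1 \<alpha> \<beta> Bx Bw :: real
    and w0 :: "real ^ 'm"
    and f :: "real \<times> (real \<Rightarrow> real ^ 'm) \<Rightarrow> (real ^ 'd) \<Rightarrow>\<^sub>L (real ^ 'm)"
    and \<sigma> :: "complex \<Rightarrow> complex"
  assumes "0 < T1" and "0 \<le> T0" and "T0 < T1"
    and "1/2 < \<alpha>" and "\<alpha> < 1" and "0 < \<beta>" and "\<beta> < \<alpha>"
    and "0 < Bx" and "0 < Bw"
    and f_cont: "continuous_map (stopped_topology \<alpha> \<beta> T1) euclidean f"
    and f_lip: "\<And>K. compactin (holder_topology \<alpha> \<beta> T1) K \<Longrightarrow>
      \<exists>L>0. \<forall>t\<in>{0..T1}. \<forall>u\<in>K. \<forall>v\<in>K.
        norm (f (t, stopped T1 t u) - f (t, stopped T1 t v)) \<le>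
        L * (norm (u 0 - v 0) +
             holder_seminorm \<beta> T1 (\<lambda>r. stopped T1 t u r - stopped T1 t v r))"
    and f_growth: "\<exists>Cf>0. \<forall>(t, u)\<in>stopped_paths \<alpha> T1.
      norm (f (t, u)) \<le> Cf * (1 + norm (u 0) + holder_seminorm \<beta> T1 u)"
    and \<sigma>_entire: "\<sigma> holomorphic_on UNIV"
    and \<sigma>_real: "\<And>r::real. \<sigma> (of_real r) \<in> \<real>"
    and \<sigma>_bounded: "bounded (range (\<lambda>r::real. Re (\<sigma> (of_real r))))"
    and \<sigma>_lipschitz: "\<exists>C. C-lipschitz_on UNIV (\<lambda>r::real. Re (\<sigma> (of_real r)))"
    and \<sigma>_monotone: "strict_mono (\<lambda>r::real. Re (\<sigma> (of_real r))) \<or>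
      strict_mono (\<lambda>r::real. - Re (\<sigma> (of_real r)))"
  shows "\<exists>l :: nat \<Rightarrow> 'm \<Rightarrow> 'd \<Rightarrow> 'm option tensor_series.
    (\<forall>n i j. bounded_entire (l n i j)) \<and>
    (\<forall>(x, w)\<in>input_set \<alpha> T0 T1 Bx Bw w0.
       (\<exists>!y. solves \<alpha> T0 T1 (functional_coeff T1 f) x w y) \<and>
       (\<forall>n. \<exists>!y. solves \<alpha> T0 T1 (signature_coeff (l n)) x w y)) \<and>
    (\<forall>\<epsilon>>0. \<forall>\<^sub>F n in sequentially. \<forall>(x, w)\<in>input_set \<alpha> T0 T1 Bx Bw w0.
       \<forall>yn y. solves \<alpha> T0 T1 (signature_coeff (l n)) x w yn \<longrightarrow>
              solves \<alpha> T0 T1 (functional_coeff T1 f) x w y \<longrightarrow>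
              holder_dist \<beta> T1 yn y < \<epsilon>)"
proof -
  obtain Cf where Cf: "0 < Cf" "\<forall>(t, u)\<in>stopped_paths \<alpha> T1.
      norm (f (t, u)) \<le> Cf * (1 + norm (u 0) + holder_seminorm \<beta> T1 u)"
    using f_growth by blast
  \<comment> \<open>The summand 1 dominates every approximation error
    \<open>1 / real (Suc n)\<close>, so \<open>f\<close> and all its approximations share one growth
    constant on the ball.\<close>
  define C where "C = Cf * (1 + norm w0) + 1"
  have C0: "0 \<le> C" using Cf(1) by (simp add: C_def)
  define K where "K = real CARD('m) * real CARD('d) * Bx"
  have K0: "0 \<le> K" using \<open>0 < Bx\<close> by (simp add: K_def)
  obtain \<rho> where \<rho>: "0 < \<rho>" "(K * C) * \<rho> powr (\<beta> - 1) \<le> 1 / 2"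
    using small_rate[of \<beta> "K * C"] K0 C0 assms by auto
  \<comment> \<open>This is the radius required by \<open>picard_fixed_point\<close>. It is settled
    before the approximations, which are then chosen to be close on precisely this ball.\<close>
  define R where "R = Bw + K * (C * (2 + 2 * Bw * T1 powr (\<alpha> - \<beta>))) * exp (\<rho> * T1) * T1 powr (1 - \<alpha>)"
  have R0: "0 \<le> R"
    using K0 C0 \<open>0 < Bw\<close> unfolding R_def by (intro add_nonneg_nonneg mult_nonneg_nonneg) auto
  let ?F = "functional_coeff T1 f"
  have regF: "regular_coeff \<alpha> \<beta> T1 w0 ?F"
    by (rule regular_functional_coeff[OF _ _ _ f_cont f_lip]) (use assms in auto)
  have growF: "\<bar>?F y s i j\<bar> \<le> (C - 1) * (1 + A)"
    if "y \<in> holder_ball \<alpha> T1 w0 R" "s \<in> {0..T1}" "0 \<le> A" "holder_on \<beta> A 0 s y" for y s A i j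
    using functional_coeff_growth[OF _ _ _ R0 Cf(2) that] Cf(1) assms by (simp add: C_def)
  have "\<exists>l :: 'm \<Rightarrow> 'd \<Rightarrow> 'm option tensor_series.
      (\<forall>i j. bounded_entire (l i j)) \<and> regular_coeff \<alpha> \<beta> T1 w0 (signature_coeff l) \<and>
      (\<forall>y\<in>holder_ball \<alpha> T1 w0 R. \<forall>s\<in>{0..T1}. \<forall>i j. \<bar>?F y s i j - signature_coeff l y s i j\<bar> < 1 / real (Suc n))" for n
  proof -
    obtain l :: "'m \<Rightarrow> 'd \<Rightarrow> 'm option tensor_series" where
      "\<And>i j. bounded_entire (l i j)" "regular_coeff \<alpha> \<beta> T1 w0 (signature_coeff l)"
      "\<And>y s i j. y \<in> holder_ball \<alpha> T1 w0 R \<Longrightarrow> s \<in> {0..T1} \<Longrightarrow>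
        \<bar>?F y s i j - signature_coeff l y s i j\<bar> < 1 / real (Suc n)"
      by (rule signature_coeff_approximation[OF assms(4) less_imp_le[OF assms(5)] assms(6,7)
            less_imp_le[OF assms(1)] R0 _ f_cont, of "1 / real (Suc n)" w0, OF divide_pos_pos[OF zero_less_one]])
        (simp, blast)
    then show ?thesis by blast
  qed
  then obtain l :: "nat \<Rightarrow> 'm \<Rightarrow> 'd \<Rightarrow> 'm option tensor_series" where
    l: "\<And>n i j. bounded_entire (l n i j)" "\<And>n. regular_coeff \<alpha> \<beta> T1 w0 (signature_coeff (l n))"
    and close: "\<And>n y s i j. y \<in> holder_ball \<alpha> T1 w0 R \<Longrightarrow> s \<in> {0..T1} \<Longrightarrow>
      \<bar>?F y s i j - signature_coeff (l n) y s i j\<bar> < 1 / real (Suc n)"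
    by metis
  obtain L where L: "0 \<le> L" "\<And>y z s A i j. y \<in> holder_ball \<alpha> T1 w0 R \<Longrightarrow> z \<in> holder_ball \<alpha> T1 w0 R \<Longrightarrow>
    s \<in> {0..T1} \<Longrightarrow> 0 \<le> A \<Longrightarrow> holder_on \<beta> A 0 s (\<lambda>r. y r - z r) \<Longrightarrow> \<bar>?F y s i j - ?F z s i j\<bar> \<le> L * A"
    using regular_coeff_lipschitz[OF regF R0] by blast
  \<comment> \<open>Only the Lipschitz constant of the limit coefficient enters here, so the rate is
    the same for all \<open>n\<close> and all inputs.\<close>
  obtain \<mu> where \<mu>: "0 < \<mu>" "(K * L) * \<mu> powr (\<beta> - 1) \<le> 1 / 2"
    using small_rate[of \<beta> "K * L"] K0 L(1) assms by auto
  have growG: "\<bar>signature_coeff (l n) y s i j\<bar> \<le> C * (1 + A)"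
    if y: "y \<in> holder_ball \<alpha> T1 w0 R" "s \<in> {0..T1}" "0 \<le> A" "holder_on \<beta> A 0 s y" for n y s A i j
  proof -
    have "1 / real (Suc n) \<le> 1" by simp
    moreover have "(C - 1) * (1 + A) + 1 \<le> C * (1 + A)" using y(3) by (simp add: algebra_simps)
    ultimately show ?thesis using growF[OF y, of i j] close[OF y(1,2), of i j n] by linarith
  qed
  have growF': "\<bar>?F y s i j\<bar> \<le> C * (1 + A)"
    if y: "y \<in> holder_ball \<alpha> T1 w0 R" "s \<in> {0..T1}" "0 \<le> A" "holder_on \<beta> A 0 s y" for y s A i j
    using growF[OF y, of i j] y(3) by (simp add: algebra_simps)
  \<comment> \<open>A fixed point is found inside the ball; by uniqueness every solution is this
    one. So arbitrary solutions lie where the approximation is valid.\<close>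
  have wellposed: "\<exists>!y. solves \<alpha> T0 T1 F x w y" "\<And>y. solves \<alpha> T0 T1 F x w y \<Longrightarrow>
      y \<in> holder_ball \<alpha> T1 w0 R \<and> y = driven_equation.picard T0 T1 x w F y"
    if xw: "(x, w) \<in> input_set \<alpha> T0 T1 Bx Bw w0" and F: "regular_coeff \<alpha> \<beta> T1 w0 F"
      and grow: "\<And>y s A i j. y \<in> holder_ball \<alpha> T1 w0 R \<Longrightarrow> s \<in> {0..T1} \<Longrightarrow> 0 \<le> A \<Longrightarrow>
        holder_on \<beta> A 0 s y \<Longrightarrow> \<bar>F y s i j\<bar> \<le> C * (1 + A)"
    for x :: "real \<Rightarrow> real ^ 'd" and w and F :: "(real \<Rightarrow> real ^ 'm) \<Rightarrow> real \<Rightarrow> 'm \<Rightarrow> 'd \<Rightarrow> real"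
  proof -
    interpret driven_equation T0 T1 \<alpha> \<beta> Bx Bw w0 x w
      by (rule driven_equation_input_set[OF xw]) (use assms in auto)
    have \<kappa>K: "\<kappa> = K" by (simp add: \<kappa>_def K_def)
    obtain y where y: "y \<in> holder_ball \<alpha> T1 w0 R" "y = picard F y"
      by (rule picard_fixed_point[OF F C0 \<rho>(1) _ _ grow, unfolded \<kappa>K, OF \<rho>(2) R_def]) blast
    have yp: "y \<in> holder_paths \<alpha> T1" using y(1) holder_ball_subset[OF R0] by blast
    have sol: "solves \<alpha> T0 T1 F x w z \<longleftrightarrow> z = y" for z
      using solves_iff_picard[OF F, of z] picard_unique[OF F _ _ yp y(2), of z] yp y(2) by blast
    then show "\<exists>!y. solves \<alpha> T0 T1 F x w y" by simp
    show "z \<in> holder_ball \<alpha> T1 w0 R \<and> z = picard F z" if "solves \<alpha> T0 T1 F x w z" for z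
      using that y unfolding sol by simp
  qed
  \<comment> \<open>The bound contains \<open>n\<close> but neither \<open>x\<close> nor
    \<open>w\<close>, which is the asserted uniformity. It is the stability estimate with error
    \<open>1 / real (Suc n)\<close>, with the weight replaced by its largest value
    \<open>exp (\<mu> * T1)\<close>.\<close>
  have dist: "holder_dist \<beta> T1 yn y \<le> 2 * K * \<mu> powr (\<beta> - 1) * exp (\<mu> * T1) * (1 / real (Suc n))"
    if xw: "(x, w) \<in> input_set \<alpha> T0 T1 Bx Bw w0"
      and yn: "solves \<alpha> T0 T1 (signature_coeff (l n)) x w yn" and y: "solves \<alpha> T0 T1 ?F x w y"
    for n x w yn y
  proof -
    interpret driven_equation T0 T1 \<alpha> \<beta> Bx Bw w0 x w
      by (rule driven_equation_input_set[OF xw]) (use assms in auto)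
    have \<kappa>K: "\<kappa> = K" by (simp add: \<kappa>_def K_def)
    have yb: "y \<in> holder_ball \<alpha> T1 w0 R" "y = picard ?F y"
      using wellposed(2)[OF xw regF growF' y] by auto
    have ynb: "yn \<in> holder_ball \<alpha> T1 w0 R" "yn = picard (signature_coeff (l n)) yn"
      using wellposed(2)[OF xw l(2) growG yn] by auto
    define M where "M = 2 * K * (1 / real (Suc n)) * \<mu> powr (\<beta> - 1)"
    have M0: "0 \<le> M" using K0 by (simp add: M_def)
    have "weighted_holder \<beta> \<mu> M T1 (\<lambda>t. y t - yn t)"
      unfolding M_def \<kappa>K[symmetric]
      by (rule stability[OF regF l(2) R0 yb ynb L(1) L(2)[OF yb(1) ynb(1)] less_imp_le[OF close[OF ynb(1)]] _ \<mu>(1)])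
        (use \<mu>(2) \<kappa>K in auto)
    then have "holder_on \<beta> (M * exp (\<mu> * T1)) 0 T1 (\<lambda>t. y t - yn t)"
      using M0 \<mu>(1) by (intro weighted_holder_imp_holder_on) auto
    then have "holder_seminorm \<beta> T1 (\<lambda>t. y t - yn t) \<le> M * exp (\<mu> * T1)"
      using M0 by (intro holder_on_imp_seminorm) auto
    moreover have "y 0 = yn 0" using yb(1) ynb(1) by (simp add: holder_ball_def)
    ultimately have "holder_dist \<beta> T1 y yn \<le> M * exp (\<mu> * T1)"
      by (simp add: holder_dist_def holder_norm_def)
    then show ?thesis by (simp add: M_def mult_ac holder_dist_commute[of \<beta> T1 yn y])
  qed
  show ?thesis
  proof (intro exI[of _ l] conjI allI impI)
    show "bounded_entire (l n i j)" for n i j by (rule l(1))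
    show "\<forall>(x, w)\<in>input_set \<alpha> T0 T1 Bx Bw w0.
       (\<exists>!y. solves \<alpha> T0 T1 ?F x w y) \<and> (\<forall>n. \<exists>!y. solves \<alpha> T0 T1 (signature_coeff (l n)) x w y)"
      using wellposed(1)[OF _ regF growF'] wellposed(1)[OF _ l(2) growG] by blast
    fix \<epsilon> :: real assume "0 < \<epsilon>"
    have "(\<lambda>n. 2 * K * \<mu> powr (\<beta> - 1) * exp (\<mu> * T1) * (1 / real (Suc n))) \<longlonglongrightarrow> 2 * K * \<mu> powr (\<beta> - 1) * exp (\<mu> * T1) * 0"
      by (intro tendsto_mult tendsto_const LIMSEQ_inverse_real_of_nat[unfolded inverse_eq_divide])
    then have "\<forall>\<^sub>F n in sequentially. 2 * K * \<mu> powr (\<beta> - 1) * exp (\<mu> * T1) * (1 / real (Suc n)) < \<epsilon>"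
      using \<open>0 < \<epsilon>\<close> by (auto dest: order_tendstoD(2))
    then show "\<forall>\<^sub>F n in sequentially. \<forall>(x, w)\<in>input_set \<alpha> T0 T1 Bx Bw w0.
       \<forall>yn y. solves \<alpha> T0 T1 (signature_coeff (l n)) x w yn \<longrightarrow> solves \<alpha> T0 T1 ?F x w y \<longrightarrow>
              holder_dist \<beta> T1 yn y < \<epsilon>"
    proof eventually_elim
      case (elim n)
      show ?case using le_less_trans[OF dist elim] by blast
    qed
  qed
qed

end
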